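(* Let $\mathcal H$ be a real Hilbert space and $\beta\ge0$. Let $f:\mathcal H\to\mathbb R$ be a convex function which is twice continuously differentiable, and such that $\inf_{\mathcal H}f>-\infty$. Suppose that (i) $\nabla f$ is Lipschitz continuous on the bounded subsets of $\mathcal H$; (ii) $\nabla^2f$ is Lipschitz continuous on the bounded subsets of $\mathcal H$. Let $\phi:\mathcal H\to\mathbb R_+$ be a damping potential. Then, for any Cauchy data $(x_0,x_1)\in\mathcal H\times\mathcal H$, there exists a unique strong global solution $x:[0,+\infty[\to\mathcal H$ of $$\ddot x(t)+\partial\phi(\dot x(t))+\beta\nabla^2f(x(t))\dot x(t)+\nabla f(x(t))\ni0$$ satisfying $x(0)=x_0$ and $\dot x(0)=x_1$.
   Context: $\nabla^2f$ takes values in the space $\mathcal L(\mathcal H,\mathcal H)$ of bounded linear operators, equipped with the operator norm. A function $\phi:\mathcal H\to\mathbb R_+$ is a damping potential if: (i) $\phi$ is nonnegative, convex and continuous; (ii) $\phi(0)=0=\min_{\mathcal H}\phi$; (iii) for every $R>0$, $\sup_{\|u\|\le R}\|(\partial\phi)^0(u)\|<+\infty$, where $\partial\phi$ is the convex subdifferential and $(\partial\phi)^0(u)$ is the element of minimal norm of $\partial\phi(u)$. A function $x:[0,+\infty[\to\mathcal H$ is a strong global solution of the inclusion if: (i) $x\in\mathcal C^1([0,+\infty[;\mathcal H)$; (ii) for all $T>0$, $\dot x$ is Lipschitz continuous on $(0,T)$ and $\ddot x\in L^\infty(0,T;\mathcal H)$; (iii) the inclusion holds for almost every $t>0$. *)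

theory Defs
  imports "HOL-Analysis.Analysis"
begin

definition subdifferential :: "('a::real_inner \<Rightarrow> real) \<Rightarrow> 'a \<Rightarrow> 'a set" where
  "subdifferential \<phi> u = {\<xi>. \<forall>v. \<phi> v \<ge> \<phi> u + \<xi> \<bullet> (v - u)}"

text \<open>The element of minimal norm of the subdifferential. For a convex continuous \<open>\<phi>\<close> on a Hilbert
  space the subdifferential is nonempty, closed and convex, so this element exists and is unique.\<close>

definition min_subgradient :: "('a::real_inner \<Rightarrow> real) \<Rightarrow> 'a \<Rightarrow> 'a" where
  "min_subgradient \<phi> u = (ARG_MIN norm \<xi>. \<xi> \<in> subdifferential \<phi> u)"

definition damping_potential :: "('a::real_inner \<Rightarrow> real) \<Rightarrow> bool" where
  "damping_potential \<phi> \<longleftrightarrow>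
     (\<forall>u. 0 \<le> \<phi> u) \<and> convex_on UNIV \<phi> \<and> continuous_on UNIV \<phi> \<and>
     \<phi> 0 = 0 \<and> (\<forall>u. \<phi> 0 \<le> \<phi> u) \<and>
     (\<forall>R>0. bdd_above ((\<lambda>u. norm (min_subgradient \<phi> u)) ` cball 0 R))"

definition lipschitz_on_bounded_sets :: "('a::metric_space \<Rightarrow> 'b::metric_space) \<Rightarrow> bool" where
  "lipschitz_on_bounded_sets F \<longleftrightarrow> (\<forall>B. bounded B \<longrightarrow> (\<exists>L. L-lipschitz_on B F))"

text \<open>\<open>f\<close> is twice continuously (Frechet) differentiable with gradient \<open>g\<close> and Hessian \<open>h\<close>;
  the type of bounded linear maps carries the operator norm. Both \<open>g\<close> and \<open>h\<close> are determined
  by \<open>f\<close>, and by the Riesz theorem they exist for every \<open>f\<close> of class C2 on a Hilbert space.\<close>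

definition C2_with ::
    "('a::real_inner \<Rightarrow> real) \<Rightarrow> ('a \<Rightarrow> 'a) \<Rightarrow> ('a \<Rightarrow> 'a \<Rightarrow>\<^sub>L 'a) \<Rightarrow> bool" where
  "C2_with f g h \<longleftrightarrow>
     (\<forall>x. GDERIV f x :> g x) \<and>
     (\<forall>x. (g has_derivative blinfun_apply (h x)) (at x)) \<and>
     continuous_on UNIV h"

text \<open>Measurability in the sense of Bochner: values lie in a possibly nonseparable space, so Borel
  measurability alone would be too weak.\<close>

definition strongly_measurable :: "'b measure \<Rightarrow> ('b \<Rightarrow> 'a::real_normed_vector) \<Rightarrow> bool" where
  "strongly_measurable M F \<longleftrightarrow>
     (\<exists>s. (\<forall>n::nat. simple_function M (s n)) \<and> (AE t in M. (\<lambda>n. s n t) \<longlonglongrightarrow> F t))"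

definition in_Linfty :: "'b measure \<Rightarrow> ('b \<Rightarrow> 'a::real_normed_vector) \<Rightarrow> bool" where
  "in_Linfty M F \<longleftrightarrow> strongly_measurable M F \<and> (\<exists>C. AE t in M. norm (F t) \<le> C)"

text \<open>The derivative of \<open>x\<close> is one-sided at \<open>0\<close>, so that it only depends on \<open>x\<close> on \<open>[0,\<infinity>)\<close>.\<close>

definition velocity :: "(real \<Rightarrow> 'a::real_normed_vector) \<Rightarrow> real \<Rightarrow> 'a" where
  "velocity x t = vector_derivative x (at t within {0..})"

definition acceleration :: "(real \<Rightarrow> 'a::real_normed_vector) \<Rightarrow> real \<Rightarrow> 'a" where
  "acceleration x t = vector_derivative (velocity x) (at t)"

text \<open>Strong global solution of
  \<open>x'' + \<partial>\<phi>(x') + \<beta> h(x) x' + g(x) \<ni> 0\<close>. The operator \<^const>\<open>vector_derivative\<close> returns an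
  arbitrary value where the derivative does not exist, hence the explicit differentiability
  conditions.\<close>

definition strong_global_solution ::
    "('a::real_inner \<Rightarrow> real) \<Rightarrow> real \<Rightarrow> ('a \<Rightarrow> 'a) \<Rightarrow> ('a \<Rightarrow> 'a \<Rightarrow>\<^sub>L 'a) \<Rightarrow> (real \<Rightarrow> 'a) \<Rightarrow> bool" where
  "strong_global_solution \<phi> \<beta> g h x \<longleftrightarrow>
     x differentiable_on {0..} \<and> continuous_on {0..} (velocity x) \<and>
     (\<forall>T>0. (\<exists>L. L-lipschitz_on {0<..<T} (velocity x)) \<and>
             (AE t in lebesgue_on {0<..<T}. velocity x differentiable (at t)) \<and>
             in_Linfty (lebesgue_on {0<..<T}) (acceleration x)) \<and>
     (AE t in lebesgue_on {0<..}.
        0 \<in> {acceleration x t + \<xi> + \<beta> *\<^sub>R blinfun_apply (h (x t)) (velocity x t) + g (x t) | \<xi>.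
              \<xi> \<in> subdifferential \<phi> (velocity x t)})"

end

theory Submission
  imports Defs
begin

text \<open>
  In the phase space of pairs (position, velocity) the equation reads \<open>x' = u\<close>,
  \<open>- u' \<in> \<partial>\<phi>(u) + F(x, u)\<close> with \<open>F(x, u) = \<beta> \<nabla>\<^sup>2f(x) u + \<nabla>f(x)\<close>. The subdifferential is a maximal
  monotone operator, which the bound on minimal subgradients makes bounded on bounded sets
  (\<open>bounded_m_accretive_subdifferential\<close>), and \<open>F\<close> is Lipschitz on bounded sets
  (\<open>damping_force_lipschitz\<close>). So this is a Lipschitz perturbation of a monotone evolution, and
  uniqueness is Gronwall's inequality for the squared phase space distance of two solutions, which is
  differentiable almost everywhere (\<open>trajectory_unique\<close>).

  For existence, \<open>\<partial>\<phi>\<close> is replaced by its Yosida approximation of parameter \<open>l\<close>, which leaves an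
  ordinary differential equation. Convexity of \<open>f\<close> makes the Hessian positive semidefinite
  (\<open>hessian_psd\<close>), hence the energy \<open>f(x) + |u|\<^sup>2 / 2\<close> decreases. As \<open>f\<close> is bounded below, velocities
  are bounded and solutions global, with bounds independent of \<open>l\<close> (\<open>regularized_flow_exists\<close>,
  \<open>regularized_flow_uniform\<close>). Two regularized solutions differ by \<open>O(sqrt (l + m))\<close> on compact
  intervals (\<open>regularized_flows_close\<close>), so they converge locally uniformly as \<open>l \<rightarrow> 0\<close>.

  It remains to differentiate the limit velocity \<open>u\<close>. It is Lipschitz, and its derivative should be the
  negative of the least element \<open>\<zeta>\<close> of \<open>\<partial>\<phi>(u) + F\<close>. Two facts survive the limit: the increment
  of \<open>u\<close> over a time \<open>h\<close> is at most \<open>h |\<zeta>| + O(h\<^sup>2)\<close> (\<open>forward_increment\<close>), and \<open>u\<close> satisfies a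
  local integral form of the inclusion (\<open>local_minty\<close>). The second one bounds the component of a
  difference quotient along approximants of \<open>\<zeta>\<close> by \<open>- |\<zeta>|\<^sup>2\<close>, and together they force the quotients
  to converge strongly to \<open>- \<zeta>\<close> (\<open>tendsto_neg_by_projection\<close>). This yields the right derivative at
  every time. Moreover, increments over equal times almost decrease, so that \<open>|\<zeta>|\<close> is monotone up to
  a linear term and thus continuous off a countable set; at its points of continuity the same
  argument yields the left derivative (\<open>left_derivative\<close>). Thus \<open>u\<close> is differentiable and the
  inclusion holds outside a countable set, and the acceleration is strongly measurable as a limit of
  sampled difference quotients (\<open>derivative_of_lipschitz_in_Linfty\<close>).
\<close>

section \<open>Derivatives and differential inequalities\<close>

lemma increment_le_of_deriv_le:
  fixes g g' :: "real \<Rightarrow> real"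
  assumes "a \<le> b"
    and "\<And>t. t \<in> {a..b} \<Longrightarrow> (g has_real_derivative g' t) (at t within {a..b})"
    and "\<And>t. t \<in> {a..b} \<Longrightarrow> g' t \<le> k"
  shows "g b - g a \<le> k * (b - a)"
proof -
  have "\<exists>x\<in>{a..b}. g b - g a = (*) (g' x) (b - a)"
    using assms(1,2) by (intro mvt_very_simple) (auto simp: has_field_derivative_def)
  then obtain x where "x \<in> {a..b}" "g b - g a = g' x * (b - a)" by auto
  then show ?thesis
    using assms(1) assms(3)[of x] by (simp add: mult_right_mono)
qed

lemma has_real_derivative_inner_self:
  fixes w :: "real \<Rightarrow> 'a::real_inner"
  assumes "(w has_vector_derivative w') (at t within S)"
  shows "((\<lambda>t. inner (w t) (w t)) has_real_derivative 2 * inner w' (w t)) (at t within S)"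
  using assms unfolding has_vector_derivative_def has_field_derivative_def
  by (auto intro!: derivative_eq_intros ext simp: inner_commute algebra_simps)

lemma has_vector_derivative_fst:
  "(z has_vector_derivative z') net \<Longrightarrow> ((\<lambda>t. fst (z t)) has_vector_derivative fst z') net"
  by (rule bounded_linear.has_vector_derivative[OF bounded_linear_fst])

lemma has_vector_derivative_snd:
  "(z has_vector_derivative z') net \<Longrightarrow> ((\<lambda>t. snd (z t)) has_vector_derivative snd z') net"
  by (rule bounded_linear.has_vector_derivative[OF bounded_linear_snd])

lemma has_vector_derivative_shift_within:
  fixes z :: "real \<Rightarrow> 'b::real_normed_vector"
  assumes "(z has_vector_derivative z') (at (r + h) within {a + h..b + h})"
  shows "((\<lambda>r. z (r + h)) has_vector_derivative z') (at r within {a..b})"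
proof -
  have "((\<lambda>r. r + h) has_derivative (\<lambda>y. y)) (at r within {a..b})"
    by (auto intro!: derivative_eq_intros)
  moreover have "(z has_derivative (\<lambda>y. y *\<^sub>R z')) (at (r + h) within (\<lambda>r. r + h) ` {a..b})"
    using assms by (simp add: has_vector_derivative_def image_add_atLeastAtMost' add.commute)
  ultimately show ?thesis
    unfolding has_vector_derivative_def by (rule has_derivative_in_compose)
qed

lemma eventually_small:
  fixes e :: real
  assumes "0 < e"
  shows "\<forall>\<^sub>F h in at_right 0. h < e \<and> 0 < h"
  using eventually_at_right_less[of 0] eventually_at_right[of 0 e "\<lambda>h. h < e"] assms
  unfolding eventually_at_right_field by (intro exI[of _ e]) auto

text \<open>The norm is not differentiable where \<open>w\<close> vanishes, so \<open>sqrt (|w|\<^sup>2 + \<epsilon>\<^sup>2)\<close> is differentiated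
  instead; its derivative is at most \<open>c + \<kappa> / \<epsilon>\<close>. The parameter \<open>\<epsilon>\<close> stays free because \<open>\<kappa>\<close> will tend to
  \<open>0\<close>, and then \<open>\<epsilon> = sqrt \<kappa>\<close> makes both error terms vanish.\<close>

lemma norm_growth_regularized:
  fixes w w' :: "real \<Rightarrow> 'a::real_inner"
  assumes "a \<le> b" "0 < \<epsilon>" "0 \<le> c" "0 \<le> \<kappa>"
    and der: "\<And>t. t \<in> {a..b} \<Longrightarrow> (w has_vector_derivative w' t) (at t within {a..b})"
    and le: "\<And>t. t \<in> {a..b} \<Longrightarrow> inner (w' t) (w t) \<le> c * norm (w t) + \<kappa>"
  shows "norm (w b) \<le> norm (w a) + \<epsilon> + (c + \<kappa> / \<epsilon>) * (b - a)"
proof -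
  define r where "r t = sqrt (inner (w t) (w t) + \<epsilon>\<^sup>2)" for t
  have pos: "inner (w t) (w t) + \<epsilon>\<^sup>2 > 0" for t
    using \<open>0 < \<epsilon>\<close> by (simp add: add_nonneg_pos)
  have rw: "norm (w t) \<le> r t" and re: "\<epsilon> \<le> r t" for t
    unfolding r_def norm_eq_sqrt_inner using \<open>0 < \<epsilon>\<close> 
    by (simp, intro real_le_rsqrt, simp)
  have "r b - r a \<le> (c + \<kappa> / \<epsilon>) * (b - a)"
  proof (rule increment_le_of_deriv_le[OF \<open>a \<le> b\<close>])
    fix t assume t: "t \<in> {a..b}"
    have D: "((\<lambda>t. inner (w t) (w t) + \<epsilon>\<^sup>2) has_real_derivative 2 * inner (w' t) (w t)) (at t within {a..b})"
      using has_real_derivative_inner_self[OF der[OF t]] by (auto intro!: derivative_eq_intros)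
    show "(r has_real_derivative inner (w' t) (w t) / r t) (at t within {a..b})"
      using DERIV_chain2[OF DERIV_real_sqrt[OF pos[of t]] D]
      by (simp add: r_def[abs_def] divide_simps)
    have r0: "r t > 0" using re[of t] \<open>0 < \<epsilon>\<close> by linarith
    have "\<kappa> \<le> \<kappa> / \<epsilon> * r t"
      using mult_left_mono[OF re[of t] assms(4)] assms(2) by (simp add: field_simps)
    then have "inner (w' t) (w t) \<le> (c + \<kappa> / \<epsilon>) * r t"
      using le[OF t] mult_left_mono[OF rw[of t] \<open>0 \<le> c\<close>] by (simp add: algebra_simps)
    then show "inner (w' t) (w t) / r t \<le> c + \<kappa> / \<epsilon>"
      using r0 by (simp add: field_simps)
  qed
  moreover have "r a \<le> norm (w a) + \<epsilon>"
    unfolding r_def norm_eq_sqrt_inner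
    by (rule order_trans[OF sqrt_add_le_add_sqrt]) (use \<open>0 < \<epsilon>\<close> in auto)
  ultimately show ?thesis using rw[of b] by linarith
qed

lemma norm_growth:
  fixes w w' :: "real \<Rightarrow> 'a::real_inner"
  assumes "a \<le> b" "0 \<le> c"
    and "\<And>t. t \<in> {a..b} \<Longrightarrow> (w has_vector_derivative w' t) (at t within {a..b})"
    and "\<And>t. t \<in> {a..b} \<Longrightarrow> inner (w' t) (w t) \<le> c * norm (w t)"
  shows "norm (w b) \<le> norm (w a) + c * (b - a)"
proof (rule field_le_epsilon)
  fix e :: real assume "0 < e"
  from norm_growth_regularized[OF assms(1) this assms(2) order_refl assms(3)] assms(4)
  show "norm (w b) \<le> norm (w a) + c * (b - a) + e" by simp
qed

lemma gronwall_forced: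
  fixes e e' :: "real \<Rightarrow> real"
  assumes "0 \<le> t" "0 < K"
    and der: "\<And>s. s \<in> {0..t} \<Longrightarrow> (e has_real_derivative e' s) (at s within {0..t})"
    and le: "\<And>s. s \<in> {0..t} \<Longrightarrow> e' s \<le> K * e s + \<kappa>"
    and "e 0 = 0"
  shows "e t \<le> \<kappa> / K * exp (K * t) - \<kappa> / K"
proof -
  define q where "q s = exp (- K * s) * (e s + \<kappa> / K)" for s
  have "q t - q 0 \<le> 0 * (t - 0)"
  proof (rule increment_le_of_deriv_le[OF \<open>0 \<le> t\<close>])
    fix s assume s: "s \<in> {0..t}"
    show "(q has_real_derivative exp (- K * s) * (e' s - K * e s - \<kappa>)) (at s within {0..t})"
      unfolding q_def using \<open>0 < K\<close>
      by (auto intro!: derivative_eq_intros der[OF s] simp: field_simps)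
    show "exp (- K * s) * (e' s - K * e s - \<kappa>) \<le> 0"
      using le[OF s] by (simp add: mult_nonneg_nonpos)
  qed
  then have "exp (- K * t) * (e t + \<kappa> / K) \<le> \<kappa> / K"
    unfolding q_def using \<open>e 0 = 0\<close> by simp
  then have "exp (K * t) * (exp (- K * t) * (e t + \<kappa> / K)) \<le> exp (K * t) * (\<kappa> / K)"
    by (intro mult_left_mono) auto
  then show ?thesis
    by (simp add: mult.assoc[symmetric] exp_add[symmetric]) (simp add: algebra_simps)
qed

text \<open>After subtracting a small slope the derivative is strictly negative off \<open>N\<close>. A Lipschitz map
  sends the null set \<open>N\<close> to a null set, so if the function rose from \<open>a\<close> to \<open>b\<close>, some intermediate
  level would be attained only outside \<open>N\<close>; at the last time below that level the derivative would
  have to be nonnegative.\<close>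

lemma lipschitz_nonincreasing:
  fixes g :: "real \<Rightarrow> real"
  assumes "a \<le> b" and L: "L-lipschitz_on {a..b} g" and N: "negligible N"
    and der: "\<And>t. t \<in> {a<..<b} - N \<Longrightarrow> \<exists>D\<le>0. (g has_real_derivative D) (at t)"
  shows "g b \<le> g a"
proof (rule ccontr)
  assume "\<not> g b \<le> g a"
  then have gab: "g a < g b" and ab: "a < b" using \<open>a \<le> b\<close> by (auto simp: order.order_iff_strict)
  \<comment> \<open>half of the mean slope, so that the tilted function still rises from \<open>a\<close> to \<open>b\<close>\<close>
  define \<epsilon> where "\<epsilon> = (g b - g a) / (2 * (b - a))"
  have eps: "\<epsilon> > 0" using gab ab by (simp add: \<epsilon>_def)
  define q where "q t = g t - \<epsilon> * (t - a)" for t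
  have "\<epsilon> * (b - a) = (g b - g a) / 2"
    using ab by (simp add: \<epsilon>_def divide_simps)
  then have qab: "q a < q b" using gab unfolding q_def by auto
  have qL: "(L + \<epsilon>)-lipschitz_on {a..b} q"
    unfolding q_def using eps
    by (intro lipschitz_on_diff L)
       (auto intro!: lipschitz_onI simp: dist_real_def abs_mult right_diff_distrib[symmetric])
  have cont: "continuous_on {a..b} q"
    using qL by (rule lipschitz_on_continuous_on)
  have "negligible (q ` (N \<inter> {a..b}))"
  proof (rule negligible_locally_Lipschitz_image)
    show "DIM(real) \<le> DIM(real)" by simp
    show "negligible (N \<inter> {a..b})" using N by (rule negligible_subset) auto
    fix x assume "x \<in> N \<inter> {a..b}"
    then show "\<exists>T B. open T \<and> x \<in> T \<and> (\<forall>y\<in>N \<inter> {a..b} \<inter> T. norm (q y - q x) \<le> B * norm (y - x))"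
      using lipschitz_on_normD[OF qL] by (intro exI[of _ UNIV] exI[of _ "L + \<epsilon>"]) auto
  qed
  moreover have "\<not> negligible {q a<..<q b}"
    using qab negligible_interval(2)[of "q a" "q b"] by simp
  ultimately obtain y where y: "q a < y" "y < q b" "y \<notin> q ` (N \<inter> {a..b})"
    by (metis greaterThanLessThan_iff negligible_subset subsetI)
  \<comment> \<open>the last time at which the value is at most \<open>y\<close>; there the derivative cannot be negative\<close>
  define S where "S = {t \<in> {a..b}. q t \<le> y}"
  have "S = {a..b} \<inter> q -` {..y}" unfolding S_def by auto
  then have "closed S" using cont by (auto intro!: continuous_closed_preimage)
  have "a \<in> S" unfolding S_def using y \<open>a \<le> b\<close> by auto
  have bdd: "bdd_above S" unfolding S_def by (rule bdd_aboveI[of _ b]) auto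
  define t where "t = Sup S"
  have tS: "t \<in> S" unfolding t_def using \<open>a \<in> S\<close> bdd \<open>closed S\<close> closed_contains_Sup by blast
  have after: "q s > y" if "t < s" "s \<le> b" for s
  proof (rule ccontr)
    assume "\<not> q s > y"
    then have "s \<in> S" using that tS unfolding S_def by auto
    then show False using cSup_upper[OF _ bdd, of s] that unfolding t_def by auto
  qed
  have tb: "t < b" using tS y unfolding S_def by (metis (mono_tags, lifting) atLeastAtMost_iff mem_Collect_eq not_le order_le_less)
  have "q t \<ge> y"
  proof (rule tendsto_lowerbound)
    have "(q \<longlongrightarrow> q t) (at t within {a..b})"
      using cont tS unfolding S_def continuous_on_def by auto
    then show "(q \<longlongrightarrow> q t) (at t within {t<..b})"
      by (rule tendsto_within_subset) (use tS S_def in auto)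
    show "\<forall>\<^sub>F s in at t within {t<..b}. y \<le> q s"
      using after by (auto simp: eventually_at_filter less_imp_le)
    show "at t within {t<..b} \<noteq> bot"
      using tb by (simp add: at_within_eq_bot_iff islimpt_Ioc)
  qed
  then have qt: "q t = y" using tS unfolding S_def by auto
  have "t \<noteq> a" using qt y by auto
  then have tin: "t \<in> {a<..<b} - N" using tS tb qt y unfolding S_def by auto
  then obtain D where D: "D \<le> 0" "(g has_real_derivative D) (at t)" using der by auto
  have "(q has_real_derivative D - \<epsilon>) (at t)"
    unfolding q_def using D(2) by (auto intro!: derivative_eq_intros)
  moreover have "D - \<epsilon> < 0" using D eps by auto
  ultimately obtain d where d: "d > 0" "\<And>h. 0 < h \<Longrightarrow> h < d \<Longrightarrow> q (t + h) < q t"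
    using DERIV_neg_dec_right by blast
  define h where "h = min (d/2) (b - t)"
  have "0 < h" "h < d" "t + h \<le> b" using d tb by (auto simp: h_def)
  then show False using d(2)[of h] after[of "t + h"] qt by auto
qed

lemma lipschitz_on_mult_bounded:
  fixes f g :: "real \<Rightarrow> real"
  assumes "L-lipschitz_on S f" "M-lipschitz_on S g" "\<And>x. x \<in> S \<Longrightarrow> \<bar>f x\<bar> \<le> A" "\<And>x. x \<in> S \<Longrightarrow> \<bar>g x\<bar> \<le> B"
    and "0 \<le> A" "0 \<le> B"
  shows "(A * M + B * L)-lipschitz_on S (\<lambda>x. f x * g x)"
proof (rule lipschitz_onI)
  have LM: "0 \<le> L" "0 \<le> M" using assms(1,2) lipschitz_on_nonneg by auto
  fix x y assume xy: "x \<in> S" "y \<in> S"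
  have "f x * g x - f y * g y = f x * (g x - g y) + g y * (f x - f y)" by (simp add: algebra_simps)
  then have "\<bar>f x * g x - f y * g y\<bar> \<le> \<bar>f x\<bar> * \<bar>g x - g y\<bar> + \<bar>g y\<bar> * \<bar>f x - f y\<bar>"
    by (metis abs_mult abs_triangle_ineq)
  also have "\<dots> \<le> A * (M * \<bar>x - y\<bar>) + B * (L * \<bar>x - y\<bar>)"
    using assms xy LM lipschitz_on_normD[OF assms(1)] lipschitz_on_normD[OF assms(2)]
    by (intro add_mono mult_mono) auto
  finally show "dist (f x * g x) (f y * g y) \<le> (A * M + B * L) * dist x y"
    by (simp add: dist_real_def algebra_simps)
qed (use assms lipschitz_on_nonneg[of L S f] lipschitz_on_nonneg[of M S g] in auto)

lemma gronwall_lipschitz: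
  fixes e :: "real \<Rightarrow> real"
  assumes "a \<le> b" "0 \<le> K" and L: "L-lipschitz_on {a..b} e" and N: "negligible N"
    and der: "\<And>t. t \<in> {a<..<b} - N \<Longrightarrow> \<exists>D \<le> K * e t. (e has_real_derivative D) (at t)"
  shows "e b \<le> exp (K * (b - a)) * e a"
proof -
  let ?w = "\<lambda>t. exp (- K * (t - a))"
  have bnd: "\<bar>e x\<bar> \<le> \<bar>e a\<bar> + L * (b - a)" if "x \<in> {a..b}" for x
  proof -
    have "\<bar>e x - e a\<bar> \<le> L * \<bar>x - a\<bar>"
      using lipschitz_on_normD[OF L, of x a] that by auto
    also have "\<dots> \<le> L * (b - a)"
      using that lipschitz_on_nonneg[OF L] by (intro mult_left_mono) auto
    finally show ?thesis by linarith
  qed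
  have wle: "?w x \<le> 1" if "x \<in> {a..b}" for x
    using that \<open>0 \<le> K\<close> by (simp add: mult_nonneg_nonneg)
  have "K-lipschitz_on {a..b} ?w"
  proof (rule bounded_derivative_imp_lipschitz)
    fix x assume "x \<in> {a..b}"
    show "(?w has_derivative (*) (- K * ?w x)) (at x within {a..b})"
      unfolding has_field_derivative_def[symmetric]
      by (auto intro!: derivative_eq_intros)
    have "onorm (\<lambda>h. (- K * ?w x) * h) \<le> \<bar>- K * ?w x\<bar>"
      by (rule onorm_le) (simp add: abs_mult)
    also have "\<dots> \<le> K" using wle[OF \<open>x \<in> {a..b}\<close>] \<open>0 \<le> K\<close>
      by (simp add: abs_mult mult_left_le)
    finally show "onorm ((*) (- K * ?w x)) \<le> K" .
  qed (use \<open>0 \<le> K\<close> in auto)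
  then have "(1 * L + (\<bar>e a\<bar> + L * (b - a)) * K)-lipschitz_on {a..b} (\<lambda>t. ?w t * e t)"
    using wle bnd L lipschitz_on_nonneg[OF L] \<open>a \<le> b\<close>
    by (intro lipschitz_on_mult_bounded) (auto simp del: exp_le_one_iff)
  then have "?w b * e b \<le> ?w a * e a"
  proof (rule lipschitz_nonincreasing[OF \<open>a \<le> b\<close> _ N])
    fix t assume "t \<in> {a<..<b} - N"
    from der[OF this] obtain D where D: "D \<le> K * e t" "(e has_real_derivative D) (at t)" by auto
    have "((\<lambda>t. ?w t * e t) has_real_derivative ?w t * (D - K * e t)) (at t)"
      by (auto intro!: derivative_eq_intros D(2) simp: algebra_simps)
    moreover have "?w t * (D - K * e t) \<le> 0" using D by (simp add: mult_nonneg_nonpos)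
    ultimately show "\<exists>D\<le>0. ((\<lambda>t. ?w t * e t) has_real_derivative D) (at t)" by blast
  qed
  then have "exp (K * (b - a)) * (?w b * e b) \<le> exp (K * (b - a)) * e a"
    by (intro mult_left_mono) auto
  then show ?thesis by (simp add: mult.assoc[symmetric] exp_add[symmetric])
qed

section \<open>Global solutions of Lipschitz differential equations\<close>

lemma exponential_integral_bound:
  fixes k :: "real \<Rightarrow> 'b::banach"
  assumes "0 < c" "0 \<le> t" "continuous_on {0..t} k"
    and bound: "\<And>s. s \<in> {0..t} \<Longrightarrow> norm (k s) \<le> D * exp (c * s)" and "0 \<le> D"
  shows "norm (integral {0..t} k) \<le> D / c * exp (c * t)"
proof -
  have "((\<lambda>s. D * exp (c * s)) has_integral (D / c * exp (c * t) - D / c * exp (c * 0))) {0..t}"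
    using \<open>0 \<le> t\<close> \<open>0 < c\<close>
    by (intro fundamental_theorem_of_calculus)
       (auto intro!: derivative_eq_intros simp: has_real_derivative_iff_has_vector_derivative[symmetric])
  then have "norm (integral {0..t} k) \<le> D / c * exp (c * t) - D / c * exp (c * 0)"
    using integral_norm_bound_integral[of k "{0..t}" "\<lambda>s. D * exp (c * s)"] bound
    by (auto simp: integrable_continuous_real assms dest: has_integral_integrable_integral[THEN iffD1])
  moreover have "0 \<le> D / c" using assms by simp
  ultimately show ?thesis by simp
qed

lemma integral_from_0_has_vector_derivative:
  fixes k :: "real \<Rightarrow> 'b::banach"
  assumes "continuous_on {0..} k" "0 \<le> t"
  shows "((\<lambda>t. integral {0..t} k) has_vector_derivative k t) (at t within {0..})"
proof -
  have "((\<lambda>t. integral {0..t} k) has_vector_derivative k t) (at t within {0..t+1})"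
    using assms by (intro integral_has_vector_derivative continuous_on_subset[OF assms(1)]) auto
  moreover have "at t within {0..t+1} = at t within {0..}"
    by (rule at_within_nhd[of _ "{..<t+1}"]) auto
  ultimately show ?thesis by simp
qed

text \<open>Picard's fixed point argument, for the unknown \<open>exp (- c t) (z t - z0)\<close> with \<open>c\<close> twice the Lipschitz
  constant. In this weighted form it is a contraction on the bounded continuous functions on the
  whole half-line, so that no continuation of local solutions is needed. Functions on the half-line
  are represented by functions on the line that are constant for negative times.\<close>

lemma ode_global_banach:
  fixes G :: "'b::banach \<Rightarrow> 'b"
  assumes "K-lipschitz_on UNIV G"
  shows "\<exists>z. z 0 = z0 \<and> (\<forall>t\<ge>0. (z has_vector_derivative G (z t)) (at t within {0..}))"
proof -
  \<comment> \<open>a positive Lipschitz constant, since \<open>K\<close> may be \<open>0\<close>\<close>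
  define M where "M = K + 1"
  have M: "M > 0" "M-lipschitz_on UNIV G"
    using lipschitz_on_nonneg[OF assms] lipschitz_on_mono[OF assms] by (auto simp: M_def)
  define c where "c = 2 * M"
  have c: "c > 0" using M by (simp add: c_def)
  define k where "k y s = G (z0 + exp (c * s) *\<^sub>R y s)" for y :: "real \<Rightarrow> 'b" and s
  define \<Phi> where "\<Phi> y t = exp (- c * max 0 t) *\<^sub>R integral {0..max 0 t} (k y)" for y t
  have Gc: "continuous_on UNIV G" using M(2) by (rule lipschitz_on_continuous_on)
  have kc: "continuous_on S (k y)" if "continuous_on UNIV y" for S y
    unfolding k_def using that
    by (intro continuous_on_compose2[OF Gc] continuous_intros) (auto intro: continuous_on_subset)
  have Icont: "continuous_on {0..} (\<lambda>t. integral {0..t} (k y))" if "continuous_on UNIV y" for y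
    using integral_from_0_has_vector_derivative[OF kc[OF that]]
    by (intro continuous_on_vector_derivative) auto
  have cont: "continuous_on UNIV (\<Phi> y)" if "continuous_on UNIV y" for y
    unfolding \<Phi>_def
    by (intro continuous_intros continuous_on_compose2[OF Icont[OF that], of _ "max 0"]) auto
  have scaled: "norm (exp (- c * max 0 t) *\<^sub>R v) \<le> D" if "norm v \<le> D * exp (c * max 0 t)" for v :: 'b and D t
  proof -
    have "exp (- c * max 0 t) * norm v \<le> exp (- c * max 0 t) * (D * exp (c * max 0 t))"
      using that by (intro mult_left_mono) auto
    also have "\<dots> = D" by (simp add: exp_minus)
    finally show ?thesis by simp
  qed
  have bdd: "bounded (range (\<Phi> y))" if y: "continuous_on UNIV y" and b: "\<And>s. norm (y s) \<le> B" for y B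
  proof -
    have B: "0 \<le> B" using b[of 0] norm_ge_zero order_trans by blast
    have "norm (\<Phi> y t) \<le> (norm (G z0) + M * B) / c" for t
      unfolding \<Phi>_def
    proof (intro scaled exponential_integral_bound c kc[OF y])
      fix s assume s: "s \<in> {0..max 0 t}"
      have "norm (k y s - G z0) \<le> M * norm (exp (c * s) *\<^sub>R y s)"
        using lipschitz_on_normD[OF M(2), of "z0 + exp (c * s) *\<^sub>R y s" z0] by (simp add: k_def)
      also have "\<dots> \<le> M * (exp (c * s) * B)" using M b by (simp add: mult_left_mono)
      finally have "norm (k y s) \<le> norm (G z0) + M * (exp (c * s) * B)"
        using norm_triangle_sub[of "k y s" "G z0"] by linarith
      also have "\<dots> \<le> norm (G z0) * exp (c * s) + M * (exp (c * s) * B)"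
        using s c by (simp add: mult_le_cancel_left1)
      finally show "norm (k y s) \<le> (norm (G z0) + M * B) * exp (c * s)" by (simp add: algebra_simps)
    qed (use M B in auto)
    then show ?thesis by (auto simp: bounded_iff)
  qed
  have in_bc: "\<Phi> (apply_bcontfun y) \<in> bcontfun" for y :: "real \<Rightarrow>\<^sub>C 'b"
  proof -
    from bounded_apply_bcontfun[of y] obtain B where B: "\<And>s. norm (apply_bcontfun y s) \<le> B"
      by (auto simp: bounded_iff)
    show ?thesis using cont bdd[OF _ B] by (simp add: bcontfun_def)
  qed
  define \<Psi> where "\<Psi> y = Bcontfun (\<Phi> (apply_bcontfun y))" for y :: "real \<Rightarrow>\<^sub>C 'b"
  have app: "apply_bcontfun (\<Psi> y) = \<Phi> (apply_bcontfun y)" for y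
    unfolding \<Psi>_def using in_bc by (rule Bcontfun_inverse)
  have "\<exists>!y. \<Psi> y = y"
  proof (rule banach_fix_type[of "1/2"]; (intro allI)?)
    fix x y :: "real \<Rightarrow>\<^sub>C 'b"
    show "dist (\<Psi> x) (\<Psi> y) \<le> 1/2 * dist x y"
    proof (rule dist_bound)
      fix t :: real
      let ?T = "{0..max 0 t}"
      have "integral ?T (\<lambda>s. k x s - k y s) = integral ?T (k x) - integral ?T (k y)"
        by (intro integral_diff integrable_continuous_real kc) auto
      then have "\<Phi> x t - \<Phi> y t = exp (- c * max 0 t) *\<^sub>R integral ?T (\<lambda>s. k x s - k y s)"
        by (simp add: \<Phi>_def scaleR_diff_right)
      also have "norm \<dots> \<le> M * dist x y / c"
      proof (intro scaled exponential_integral_bound c continuous_on_diff kc)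
        fix s
        have "norm (k x s - k y s) \<le> M * norm (exp (c * s) *\<^sub>R (apply_bcontfun x s - apply_bcontfun y s))"
          using lipschitz_on_normD[OF M(2), of "z0 + exp (c * s) *\<^sub>R x s" "z0 + exp (c * s) *\<^sub>R y s"]
          by (simp add: k_def scaleR_diff_right)
        also have "\<dots> \<le> M * (exp (c * s) * dist x y)"
          using M dist_bounded[of x s y] by (simp add: dist_norm mult_left_mono)
        finally show "norm (k x s - k y s) \<le> M * dist x y * exp (c * s)" by (simp add: algebra_simps)
      qed (use M in auto)
      finally show "dist (\<Psi> x t) (\<Psi> y t) \<le> 1/2 * dist x y"
        using M by (simp add: app dist_norm c_def)
    qed
  qed auto
  then obtain y where y: "\<Psi> y = y" by blast
  define z where "z t = z0 + integral {0..t} (k y)" for t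
  have z_eq: "z t = z0 + exp (c * t) *\<^sub>R y t" if "t \<ge> 0" for t
  proof -
    have "apply_bcontfun y t = exp (- c * t) *\<^sub>R integral {0..t} (k y)"
      using arg_cong[OF y, of apply_bcontfun, unfolded app] that
      by (metis (no_types, lifting) \<Phi>_def max.absorb2)
    then show ?thesis by (simp add: z_def exp_minus)
  qed
  have "(z has_vector_derivative G (z t)) (at t within {0..})" if "t \<ge> 0" for t
  proof -
    have "(z has_vector_derivative k y t) (at t within {0..})"
      unfolding z_def using integral_from_0_has_vector_derivative[OF kc that]
      by (auto intro!: derivative_eq_intros)
    then show ?thesis using z_eq[OF that] by (simp add: k_def)
  qed
  moreover have "z 0 = z0" by (simp add: z_def)
  ultimately show ?thesis by blast
qed

text \<open>A type of sort \<open>{real_normed_vector, complete_space}\<close> need not be of sort \<^class>\<open>banach\<close>,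
  although the two have the same axioms. An isometric copy of it is, which makes vector-valued
  integration available.\<close>

typedef (overloaded) 'a banach_copy = "UNIV :: 'a::{real_normed_vector, complete_space} set"
  morphisms of_copy to_copy by auto

lemmas copy_inverses [simp] = of_copy_inverse to_copy_inverse[OF UNIV_I]
lemmas copy_eq_iff = of_copy_inject[symmetric]

instantiation banach_copy :: ("{real_normed_vector, complete_space}") real_vector
begin

definition "0 = to_copy 0"
definition "x + y = to_copy (of_copy x + of_copy y)"
definition "x - y = to_copy (of_copy x - of_copy y)"
definition "- x = to_copy (- of_copy x)"
definition "r *\<^sub>R x = to_copy (r *\<^sub>R of_copy x)"

lemmas copy_linear_defs = zero_banach_copy_def plus_banach_copy_def minus_banach_copy_def
  uminus_banach_copy_def scaleR_banach_copy_def

instance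
  by standard (auto simp: copy_linear_defs copy_eq_iff algebra_simps)

end

instantiation banach_copy :: ("{real_normed_vector, complete_space}") real_normed_vector
begin

definition "norm x = norm (of_copy x)"
definition "dist x y = dist (of_copy x) (of_copy y)"
definition "sgn (x :: 'a banach_copy) = x /\<^sub>R norm x"
definition "(uniformity :: ('a banach_copy \<times> 'a banach_copy) filter)
  = (INF e\<in>{0<..}. principal {(x, y). dist x y < e})"
definition "open (S :: 'a banach_copy set)
  \<longleftrightarrow> (\<forall>x\<in>S. \<forall>\<^sub>F (x', y) in uniformity. x' = x \<longrightarrow> y \<in> S)"

lemmas copy_defs = copy_linear_defs norm_banach_copy_def dist_banach_copy_def

instance
  by standard (auto simp: copy_defs copy_eq_iff sgn_banach_copy_def uniformity_banach_copy_def
    open_banach_copy_def algebra_simps norm_triangle_ineq dist_norm)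

end

instance banach_copy :: ("{real_normed_vector, complete_space}") banach
proof
  fix X :: "nat \<Rightarrow> 'a banach_copy"
  assume "Cauchy X"
  then have "Cauchy (\<lambda>n. of_copy (X n))" by (simp add: Cauchy_def dist_banach_copy_def)
  then obtain l where "(\<lambda>n. of_copy (X n)) \<longlonglongrightarrow> l" using Cauchy_convergent convergent_def by blast
  then have "X \<longlonglongrightarrow> to_copy l" by (simp add: LIMSEQ_def dist_banach_copy_def)
  then show "convergent X" by (auto simp: convergent_def)
qed

lemma bounded_linear_of_copy: "bounded_linear of_copy"
  by (rule bounded_linear_intro[of _ 1]) (simp_all add: copy_defs)

lemma ode_global:
  fixes G :: "'a::{real_normed_vector, complete_space} \<Rightarrow> 'a"
  assumes "K-lipschitz_on UNIV G"
  obtains z where "z 0 = z0" "\<And>t. t \<ge> 0 \<Longrightarrow> (z has_vector_derivative G (z t)) (at t within {0..})"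
proof -
  have "K-lipschitz_on UNIV (\<lambda>y. to_copy (G (of_copy y)))"
    using assms by (simp add: lipschitz_on_def dist_banach_copy_def)
  from ode_global_banach[OF this] obtain y where y: "y 0 = to_copy z0"
    "\<And>t. t \<ge> 0 \<Longrightarrow> (y has_vector_derivative to_copy (G (of_copy (y t)))) (at t within {0..})"
    by blast
  show thesis
  proof
    show "of_copy (y 0) = z0" using y(1) by simp
    show "((\<lambda>t. of_copy (y t)) has_vector_derivative G (of_copy (y t))) (at t within {0..})" if "t \<ge> 0" for t
      using bounded_linear.has_vector_derivative[OF bounded_linear_of_copy y(2)[OF that]] by simp
  qed
qed

section \<open>Monotone operators and their resolvents\<close>

text \<open>By Minty's theorem the range condition says that the monotone operator is maximal. The operator
  meant here is the subdifferential of a damping potential, but only these three properties of it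
  enter the analysis of the evolution equation.\<close>

locale m_accretive =
  fixes A :: "'a::{real_inner, complete_space} \<Rightarrow> 'a set"
  assumes monotone: "\<xi> \<in> A u \<Longrightarrow> \<eta> \<in> A v \<Longrightarrow> 0 \<le> inner (\<xi> - \<eta>) (u - v)"
    and range_condition: "0 < l \<Longrightarrow> \<exists>v. (u - v) /\<^sub>R l \<in> A v"
    and zero_mem: "0 \<in> A 0"
begin

definition resolvent :: "real \<Rightarrow> 'a \<Rightarrow> 'a" where
  "resolvent l u = (SOME v. (u - v) /\<^sub>R l \<in> A v)"

definition yosida :: "real \<Rightarrow> 'a \<Rightarrow> 'a" where
  "yosida l u = (u - resolvent l u) /\<^sub>R l"

lemma yosida_mem: "0 < l \<Longrightarrow> yosida l u \<in> A (resolvent l u)"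
  unfolding yosida_def resolvent_def using range_condition by (rule someI_ex)

lemma resolvent_eq: "0 < l \<Longrightarrow> resolvent l u = u - l *\<^sub>R yosida l u"
  by (simp add: yosida_def)

lemma resolvent_nonexpansive:
  assumes "0 < l" shows "norm (resolvent l u - resolvent l v) \<le> norm (u - v)"
proof -
  let ?d = "resolvent l u - resolvent l v"
  have "0 \<le> inner (yosida l u - yosida l v) ?d"
    using assms by (intro monotone yosida_mem)
  then have "0 \<le> l * inner (yosida l u - yosida l v) ?d" using assms by simp
  also have "\<dots> = inner ((u - v) - ?d) ?d"
    using assms
    by (simp add: yosida_def scaleR_diff_right[symmetric] inner_scaleR_left[symmetric] del: inner_scaleR_left)
      (simp add: algebra_simps)
  finally have "(norm ?d)\<^sup>2 \<le> inner (u - v) ?d"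
    by (simp add: power2_norm_eq_inner inner_diff_left)
  also have "\<dots> \<le> norm (u - v) * norm ?d" by (rule norm_cauchy_schwarz)
  finally show ?thesis
    by (cases "norm ?d = 0") (auto simp: power2_eq_square)
qed

lemma resolvent_zero: assumes "0 < l" shows "resolvent l 0 = 0"
proof -
  have "0 \<le> inner (yosida l 0 - 0) (resolvent l 0 - 0)"
    using assms by (intro monotone yosida_mem zero_mem)
  then have "inner (resolvent l 0) (resolvent l 0) \<le> 0"
    using assms by (simp add: yosida_def mult_le_0_iff)
  then show ?thesis by (metis inner_eq_zero_iff inner_ge_zero antisym)
qed

lemma norm_resolvent_le: "0 < l \<Longrightarrow> norm (resolvent l u) \<le> norm u"
  using resolvent_nonexpansive[of l u 0] by (simp add: resolvent_zero)

lemma yosida_zero: "0 < l \<Longrightarrow> yosida l 0 = 0"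
  by (simp add: yosida_def resolvent_zero)

lemma yosida_monotone:
  assumes "0 < l" shows "0 \<le> inner (yosida l u - yosida l v) (u - v)"
proof -
  have "u - v = (resolvent l u - resolvent l v) + l *\<^sub>R (yosida l u - yosida l v)"
    using assms by (simp add: resolvent_eq algebra_simps)
  then have "inner (yosida l u - yosida l v) (u - v)
      = inner (yosida l u - yosida l v) (resolvent l u - resolvent l v)
        + l * inner (yosida l u - yosida l v) (yosida l u - yosida l v)"
    by (metis inner_add_right inner_scaleR_right)
  then show ?thesis using monotone[OF yosida_mem yosida_mem, OF assms assms, of u v] assms by simp
qed

lemma yosida_lipschitz: assumes "0 < l" shows "(2 / l)-lipschitz_on S (yosida l)"
proof (rule lipschitz_onI)
  fix u v
  have "norm (yosida l u - yosida l v) = norm ((u - v) - (resolvent l u - resolvent l v)) / l"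
  proof -
    have "yosida l u - yosida l v = ((u - v) - (resolvent l u - resolvent l v)) /\<^sub>R l"
      by (simp add: yosida_def algebra_simps)
    then show ?thesis using assms by (simp add: divide_inverse)
  qed
  also have "\<dots> \<le> (norm (u - v) + norm (u - v)) / l"
    using assms resolvent_nonexpansive[OF assms, of u v]
    by (intro divide_right_mono order_trans[OF norm_triangle_ineq4]) auto
  finally show "dist (yosida l u) (yosida l v) \<le> 2 / l * dist u v" by (simp add: dist_norm)
qed (use assms in auto)

text \<open>The resolvent at \<open>u + \<zeta>\<close> yields a point \<open>w\<close> with \<open>u + \<zeta> - w \<in> A w\<close>. Monotonicity against the
  approximating pairs gives \<open>- |w - u|\<^sup>2 \<ge> 0\<close> in the limit, hence \<open>w = u\<close>.\<close>

lemma graph_closed: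
  fixes v \<eta> :: "nat \<Rightarrow> 'a"
  assumes "v \<longlonglongrightarrow> u" "\<eta> \<longlonglongrightarrow> \<zeta>" "\<And>n. \<eta> n \<in> A (v n)"
  shows "\<zeta> \<in> A u"
proof -
  let ?w = "resolvent 1 (u + \<zeta>)" and ?y = "yosida 1 (u + \<zeta>)"
  have "(\<lambda>n. inner (?y - \<eta> n) (?w - v n)) \<longlonglongrightarrow> inner (?y - \<zeta>) (?w - u)"
    by (intro tendsto_intros assms)
  then have "0 \<le> inner (?y - \<zeta>) (?w - u)"
    by (rule LIMSEQ_le_const) (use assms(3) in \<open>auto intro!: exI[of _ 0] monotone yosida_mem\<close>)
  also have "?y - \<zeta> = - (?w - u)" by (simp add: yosida_def)
  finally have "inner (?w - u) (?w - u) \<le> 0" by (simp only: inner_minus_left)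
  then have "?w = u" by (metis inner_eq_zero_iff inner_ge_zero antisym right_minus_eq)
  then show ?thesis using yosida_mem[of 1 "u + \<zeta>"] by (simp add: yosida_def)
qed

text \<open>The vectors \<open>\<eta>\<close> below are Yosida approximations of the shifted operator \<open>A + p\<close> at \<open>u\<close>. As the
  parameter decreases, monotonicity makes their norms increase and bounds the squared distance of two
  of them by the difference of the squared norms; so a bound on the norms makes them converge
  strongly. The limit is the least element of \<open>A u + p\<close>. The last conclusion keeps the
  approximants together with their base points \<open>v\<close>: since \<open>u - v\<close> is a positive multiple of \<open>\<eta>\<close>,
  testing an evolution inequality with \<open>v\<close> controls a velocity in the direction \<open>\<eta>\<close>.\<close>

lemma minimal_selection_approx:
  fixes u p :: 'a
  assumes "0 < l0" and bdd: "\<And>l. 0 < l \<Longrightarrow> l < l0 \<Longrightarrow> norm (yosida l (u - l *\<^sub>R p)) \<le> C"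
  obtains \<zeta> where "\<zeta> - p \<in> A u" "\<And>\<xi>. \<xi> \<in> A u \<Longrightarrow> norm \<zeta> \<le> norm (\<xi> + p)"
    "\<And>e. 0 < e \<Longrightarrow> \<exists>l v \<eta>. 0 < l \<and> u - v = l *\<^sub>R \<eta> \<and> \<eta> - p \<in> A v \<and> norm (\<eta> - \<zeta>) < e"
proof -
  define l where "l n = l0 / (real n + 2)" for n
  have l: "0 < l n" "l n < l0" for n
    using \<open>0 < l0\<close> by (auto simp: l_def pos_divide_less_eq mult_less_cancel_left2 add_pos_nonneg)
  have l_anti: "l n \<le> l m" if "m \<le> n" for m n
    using that \<open>0 < l0\<close> by (simp add: l_def frac_le)
  have l_lim: "l \<longlonglongrightarrow> 0" unfolding l_def by real_asymp
  define \<eta> where "\<eta> n = yosida (l n) (u - l n *\<^sub>R p) + p" for n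
  define v where "v n = u - l n *\<^sub>R \<eta> n" for n
  have mem: "\<eta> n - p \<in> A (v n)" for n
  proof -
    have "v n = resolvent (l n) (u - l n *\<^sub>R p)"
      using l[of n] by (simp add: v_def \<eta>_def resolvent_eq algebra_simps)
    then show ?thesis using yosida_mem[OF l(1)[of n]] by (simp add: \<eta>_def)
  qed
  have bd: "norm (\<eta> n) \<le> C + norm p" for n
    unfolding \<eta>_def using bdd[OF l, of n] by (rule_tac norm_triangle_le) simp
  have key: "(norm (\<eta> m - \<eta> n))\<^sup>2 \<le> (norm (\<eta> n))\<^sup>2 - (norm (\<eta> m))\<^sup>2" if "m \<le> n" for m n
  proof -
    let ?a = "\<eta> m" and ?b = "\<eta> n"
    have "0 \<le> inner ((?a - p) - (?b - p)) (v m - v n)" by (intro monotone mem)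
    then have "0 \<le> - (l m * inner (?a - ?b) ?a - l n * inner (?a - ?b) ?b)"
      by (simp add: v_def inner_diff_right algebra_simps)
    also have "l m * inner (?a - ?b) ?a - l n * inner (?a - ?b) ?b
      = ((l m + l n) * (norm (?a - ?b))\<^sup>2 + (l m - l n) * ((norm ?a)\<^sup>2 - (norm ?b)\<^sup>2)) / 2"
      unfolding power2_norm_eq_inner
      by (simp add: inner_diff_left inner_diff_right inner_commute algebra_simps)
    finally have *: "(l m + l n) * (norm (?a - ?b))\<^sup>2 \<le> (l m - l n) * ((norm ?b)\<^sup>2 - (norm ?a)\<^sup>2)"
      by (simp add: algebra_simps)
    have lmn: "0 \<le> l m - l n" "0 < l m + l n" "l m - l n \<le> l m + l n"
      using l_anti[OF that] l[of m] l[of n] by auto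
    show ?thesis
    proof (cases "(norm ?b)\<^sup>2 - (norm ?a)\<^sup>2 \<ge> 0")
      case True
      then have "(l m + l n) * (norm (?a - ?b))\<^sup>2 \<le> (l m + l n) * ((norm ?b)\<^sup>2 - (norm ?a)\<^sup>2)"
        using * mult_right_mono[OF lmn(3) True] by linarith
      then show ?thesis using lmn(2) by simp
    next
      case False
      then have "(l m - l n) * ((norm ?b)\<^sup>2 - (norm ?a)\<^sup>2) \<le> 0"
        using lmn(1) by (simp add: mult_nonneg_nonpos)
      then have "(l m + l n) * (norm (?a - ?b))\<^sup>2 \<le> 0" using * by linarith
      then have "?a = ?b" using lmn(2) by (auto simp: mult_le_0_iff)
      then show ?thesis by simp
    qed
  qed
  have inc: "incseq (\<lambda>n. (norm (\<eta> n))\<^sup>2)"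
    unfolding incseq_def using key by (meson diff_ge_0_iff_ge order_trans zero_le_power2)
  have "(norm (\<eta> n))\<^sup>2 \<le> (C + norm p)\<^sup>2" for n using bd[of n] by (simp add: power_mono)
  then obtain L where "(\<lambda>n. (norm (\<eta> n))\<^sup>2) \<longlonglongrightarrow> L"
    using incseq_convergent[OF inc] by metis
  then have "Cauchy (\<lambda>n. (norm (\<eta> n))\<^sup>2)" by (rule LIMSEQ_imp_Cauchy)
  have "Cauchy \<eta>"
  proof (rule CauchyI)
    fix e :: real assume "0 < e"
    with CauchyD[OF \<open>Cauchy (\<lambda>n. (norm (\<eta> n))\<^sup>2)\<close>, of "e\<^sup>2"] obtain N where
      N: "\<And>m n. m \<ge> N \<Longrightarrow> n \<ge> N \<Longrightarrow> \<bar>(norm (\<eta> m))\<^sup>2 - (norm (\<eta> n))\<^sup>2\<bar> < e\<^sup>2" by auto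
    have le: "norm (\<eta> m - \<eta> n) < e" if "m \<ge> N" "n \<ge> N" "m \<le> n" for m n
    proof -
      have "(norm (\<eta> m - \<eta> n))\<^sup>2 < e\<^sup>2" using key[OF that(3)] N[OF that(1,2)] by linarith
      then show ?thesis using \<open>0 < e\<close> by (simp add: power2_less_imp_less)
    qed
    show "\<exists>M. \<forall>m\<ge>M. \<forall>n\<ge>M. norm (\<eta> m - \<eta> n) < e"
      by (metis le linorder_le_cases norm_minus_commute)
  qed
  then obtain \<zeta> where \<zeta>: "\<eta> \<longlonglongrightarrow> \<zeta>" using Cauchy_convergent convergent_def by blast
  have "v \<longlonglongrightarrow> u - 0 *\<^sub>R \<zeta>"
    unfolding v_def by (intro tendsto_intros l_lim \<zeta>)
  then have vu: "v \<longlonglongrightarrow> u" by simp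
  show thesis
  proof
    show "\<zeta> - p \<in> A u"
      by (rule graph_closed[OF vu _ mem]) (intro tendsto_intros \<zeta>)
    show "norm \<zeta> \<le> norm (\<xi> + p)" if "\<xi> \<in> A u" for \<xi>
    proof (rule LIMSEQ_le_const2[OF tendsto_norm[OF \<zeta>]], intro exI allI impI)
      fix n
      have "0 \<le> inner ((\<eta> n - p) - \<xi>) (v n - u)" by (intro monotone mem that)
      also have "\<dots> = l n * (inner (\<xi> + p) (\<eta> n) - inner (\<eta> n) (\<eta> n))"
        by (simp add: v_def inner_diff_left inner_add_left algebra_simps)
      finally have "(norm (\<eta> n))\<^sup>2 \<le> inner (\<xi> + p) (\<eta> n)"
        using l[of n] by (simp add: zero_le_mult_iff power2_norm_eq_inner)
      also have "\<dots> \<le> norm (\<xi> + p) * norm (\<eta> n)" by (rule norm_cauchy_schwarz)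
      finally show "norm (\<eta> n) \<le> norm (\<xi> + p)"
        by (cases "norm (\<eta> n) = 0") (auto simp: power2_eq_square)
    qed
    fix e :: real assume "0 < e"
    then obtain n where "norm (\<eta> n - \<zeta>) < e" using LIMSEQ_D[OF \<zeta>] by blast
    then show "\<exists>l v \<eta>. 0 < l \<and> u - v = l *\<^sub>R \<eta> \<and> \<eta> - p \<in> A v \<and> norm (\<eta> - \<zeta>) < e"
      using mem[of n] l(1)[of n] by (intro exI[of _ "l n"] exI[of _ "v n"] exI[of _ "\<eta> n"]) (simp add: v_def)
  qed
qed

end

locale bounded_m_accretive = m_accretive +
  assumes bounded_on_balls: "\<exists>C. \<forall>u\<in>cball 0 R. \<forall>\<xi>\<in>A u. norm \<xi> \<le> C"
begin

lemma yosida_bounded: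
  obtains C where "0 \<le> C" "\<And>l u. 0 < l \<Longrightarrow> norm u \<le> R \<Longrightarrow> norm (yosida l u) \<le> C"
proof -
  from bounded_on_balls[of R] obtain C where C: "\<And>u \<xi>. norm u \<le> R \<Longrightarrow> \<xi> \<in> A u \<Longrightarrow> norm \<xi> \<le> C"
    by (metis mem_cball_0)
  show thesis
  proof
    show "norm (yosida l u) \<le> max 0 C" if "0 < l" "norm u \<le> R" for l u
      using C[OF _ yosida_mem[OF that(1)], of u] norm_resolvent_le[OF that(1), of u] that by auto
  qed auto
qed

lemma shifted_selection:
  obtains \<zeta> where "\<zeta> - p \<in> A u"
    "\<And>e. 0 < e \<Longrightarrow> \<exists>l v \<eta>. 0 < l \<and> u - v = l *\<^sub>R \<eta> \<and> \<eta> - p \<in> A v \<and> norm (\<eta> - \<zeta>) < e"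
proof -
  obtain C where C: "\<And>l w. 0 < l \<Longrightarrow> norm w \<le> norm u + norm p \<Longrightarrow> norm (yosida l w) \<le> C"
    using yosida_bounded by blast
  show thesis
  proof (rule minimal_selection_approx[where ?l0.0 = 1 and C = C and u = u and p = p])
    fix l :: real assume l: "0 < l" "l < 1"
    have "norm (u - l *\<^sub>R p) \<le> norm u + l * norm p"
      using l norm_triangle_ineq4[of u "l *\<^sub>R p"] by simp
    also have "\<dots> \<le> norm u + norm p" using l by (simp add: mult_left_le_one_le)
    finally show "norm (yosida l (u - l *\<^sub>R p)) \<le> C" using C l by auto
  qed (use that in auto)
qed

text \<open>Monotonicity holds exactly between the two resolvents, which differ from \<open>a\<close> and \<open>b\<close> by the
  parameters times the Yosida approximations.\<close>

lemma yosida_almost_monotone: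
  assumes "0 < l" "0 < m" "norm (yosida l a) \<le> C" "norm (yosida m b) \<le> C"
  shows "- 2 * C\<^sup>2 * (l + m) \<le> inner (yosida l a - yosida m b) (a - b)"
proof -
  let ?\<alpha> = "yosida l a" and ?\<beta> = "yosida m b"
  have C: "0 \<le> C" using assms(3) norm_ge_zero order_trans by blast
  have "a - b = (resolvent l a - resolvent m b) + (l *\<^sub>R ?\<alpha> - m *\<^sub>R ?\<beta>)"
    using assms by (simp add: resolvent_eq)
  then have "inner (?\<alpha> - ?\<beta>) (a - b) = inner (?\<alpha> - ?\<beta>) (resolvent l a - resolvent m b)
      + inner (?\<alpha> - ?\<beta>) (l *\<^sub>R ?\<alpha> - m *\<^sub>R ?\<beta>)" by (metis inner_add_right)
  moreover have "0 \<le> inner (?\<alpha> - ?\<beta>) (resolvent l a - resolvent m b)"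
    using assms by (intro monotone yosida_mem)
  moreover have "\<bar>inner (?\<alpha> - ?\<beta>) (l *\<^sub>R ?\<alpha> - m *\<^sub>R ?\<beta>)\<bar> \<le> (C + C) * (l * C + m * C)"
  proof (rule order_trans[OF Cauchy_Schwarz_ineq2] mult_mono)+
    show "norm (?\<alpha> - ?\<beta>) \<le> C + C" using assms by (intro norm_triangle_le_diff) auto
    show "norm (l *\<^sub>R ?\<alpha> - m *\<^sub>R ?\<beta>) \<le> l * C + m * C"
      using assms by (intro norm_triangle_le_diff add_mono) (auto intro!: mult_left_mono)
  qed (use C in auto)
  ultimately show ?thesis by (simp add: power2_eq_square algebra_simps)
qed

lemma yosida_vs_graph:
  assumes "0 < l" "\<xi> \<in> A v" "norm (yosida l a) \<le> C"
  shows "- l * norm \<xi> * C \<le> inner (yosida l a - \<xi>) (a - v)"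
proof -
  let ?\<alpha> = "yosida l a"
  have "a - v = (resolvent l a - v) + l *\<^sub>R ?\<alpha>" using assms by (simp add: resolvent_eq)
  then have "inner (?\<alpha> - \<xi>) (a - v) = inner (?\<alpha> - \<xi>) (resolvent l a - v)
      + l * (inner ?\<alpha> ?\<alpha> - inner \<xi> ?\<alpha>)" by (metis inner_add_right inner_scaleR_right inner_diff_left)
  moreover have "0 \<le> inner (?\<alpha> - \<xi>) (resolvent l a - v)"
    using assms by (intro monotone yosida_mem)
  moreover have "inner \<xi> ?\<alpha> \<le> norm \<xi> * C"
    using norm_cauchy_schwarz[of \<xi> ?\<alpha>] mult_left_mono[OF assms(3) norm_ge_zero[of \<xi>]] by linarith
  then have "l * (inner \<xi> ?\<alpha>) \<le> l * (norm \<xi> * C)" using assms by simp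
  moreover have "0 \<le> l * inner ?\<alpha> ?\<alpha>" using assms by simp
  ultimately show ?thesis by (simp add: algebra_simps)
qed

end

section \<open>Regularized trajectories\<close>

text \<open>The radial retraction. The constant \<open>2\<close> is not optimal in a Hilbert space, but it is valid in every
  normed space and any constant serves to make a truncated vector field globally Lipschitz.\<close>

lemma ball_retraction:
  fixes R :: real
  assumes "0 < R"
  obtains P :: "'a::real_normed_vector \<Rightarrow> 'a"
  where "2-lipschitz_on UNIV P" "\<And>z. norm (P z) \<le> R" "\<And>z. norm z \<le> R \<Longrightarrow> P z = z"
proof
  let ?\<rho> = "\<lambda>z::'a. R / max R (norm z)"
  let ?P = "\<lambda>z::'a. ?\<rho> z *\<^sub>R z"
  show "norm (?P z) \<le> R" for z :: 'a
    using assms by (auto simp: max_def field_simps)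
  show "?P z = z" if "norm z \<le> R" for z :: 'a
    using assms that by (auto simp: max_def)
  show "2-lipschitz_on UNIV ?P"
  proof (rule lipschitz_onI)
    fix z w :: 'a
    let ?a = "max R (norm z)" and ?b = "max R (norm w)"
    have ab: "0 < ?a" "0 < ?b" "R \<le> ?a" "norm w \<le> ?b" using assms by auto
    have "?P z - ?P w = ?\<rho> z *\<^sub>R (z - w) + (?\<rho> z - ?\<rho> w) *\<^sub>R w" by (simp add: algebra_simps)
    moreover have "norm (?\<rho> z *\<^sub>R (z - w)) \<le> norm (z - w)"
      using ab(1,3) assms mult_right_mono[OF ab(3) norm_ge_zero[of "z - w"]]
      by (simp add: pos_divide_le_eq mult.commute)
    moreover have "norm ((?\<rho> z - ?\<rho> w) *\<^sub>R w) \<le> norm (z - w)"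
    proof -
      have "?\<rho> z - ?\<rho> w = (R / ?a) * ((?b - ?a) / ?b)"
        using ab by (simp add: field_simps)
      then have "norm ((?\<rho> z - ?\<rho> w) *\<^sub>R w) = (R / ?a) * (norm w / ?b) * \<bar>?b - ?a\<bar>"
        using ab assms by (simp add: abs_mult)
      also have "\<dots> \<le> 1 * 1 * \<bar>?b - ?a\<bar>"
        using ab assms by (intro mult_right_mono mult_mono) auto
      also have "\<dots> \<le> norm (z - w)"
        using norm_triangle_ineq3[of z w] by (auto simp: max_def abs_if split: if_splits)
      finally show ?thesis .
    qed
    ultimately have "norm (?P z - ?P w) \<le> norm (z - w) + norm (z - w)"
      by (metis norm_triangle_mono)
    then show "dist (?P z) (?P w) \<le> 2 * dist z w" by (simp add: dist_norm)
  qed simp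
qed

text \<open>The first order form of the equation is \<open>x' = u\<close>, \<open>- u' \<in> A u + F (x, u)\<close>. The function \<open>V\<close> is the
  potential energy, and \<open>dissipative\<close> says that \<open>F\<close> takes at least as much power from the motion
  as the conservative force does.\<close>

locale damped_system = bounded_m_accretive A
  for A :: "'a::{real_inner, complete_space} \<Rightarrow> 'a set" +
  fixes F :: "'a \<times> 'a \<Rightarrow> 'a" and V :: "'a \<Rightarrow> real" and grad :: "'a \<Rightarrow> 'a" and V_min :: real
  assumes F_lipschitz: "\<exists>L. L-lipschitz_on (cball 0 R) F"
    and grad: "GDERIV V x :> grad x"
    and V_bound: "V_min \<le> V x"
    and dissipative: "inner (grad x) u \<le> inner (F (x, u)) u"
begin

definition regularized_flow :: "real \<Rightarrow> real \<Rightarrow> (real \<Rightarrow> 'a \<times> 'a) \<Rightarrow> bool" where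
  "regularized_flow l T z \<longleftrightarrow> (\<forall>t\<in>{0..T}.
     (z has_vector_derivative (snd (z t), - yosida l (snd (z t)) - F (z t))) (at t within {0..T}))"

definition speed_bound :: "'a \<times> 'a \<Rightarrow> real" where
  "speed_bound z0 = sqrt (2 * (V (fst z0) - V_min) + (norm (snd z0))\<^sup>2)"

definition phase_bound :: "'a \<times> 'a \<Rightarrow> real \<Rightarrow> real" where
  "phase_bound z0 T = norm (fst z0) + speed_bound z0 * T + speed_bound z0"

lemma speed_bound_nonneg: "0 \<le> speed_bound z0"
  unfolding speed_bound_def using V_bound by simp

lemma phase_bound_mono: "s \<le> t \<Longrightarrow> phase_bound z0 s \<le> phase_bound z0 t"
  unfolding phase_bound_def using speed_bound_nonneg by (simp add: mult_left_mono)

lemma norm_le_phase_bound: assumes "0 \<le> T" shows "norm z0 \<le> phase_bound z0 T"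
proof -
  have "norm (snd z0) \<le> speed_bound z0"
    unfolding speed_bound_def using V_bound by (intro real_le_rsqrt) simp
  moreover have "norm z0 \<le> norm (fst z0) + norm (snd z0)"
    using norm_Pair_le[of "fst z0" "snd z0"] by simp
  moreover have "0 \<le> speed_bound z0 * T" using assms speed_bound_nonneg by simp
  ultimately show ?thesis unfolding phase_bound_def by linarith
qed

lemma regularized_flow_subset:
  assumes "regularized_flow l T z" "t \<in> {a..b}" "0 \<le> a" "b \<le> T"
  shows "(z has_vector_derivative (snd (z t), - yosida l (snd (z t)) - F (z t))) (at t within {a..b})"
  using assms unfolding regularized_flow_def
  by (auto intro: has_vector_derivative_within_subset[of z _ t "{0..T}"])

text \<open>The energy \<open>V x + |u|\<^sup>2 / 2\<close> does not increase, so the speed is bounded by a constant that depends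
  neither on the regularization nor on time.\<close>

lemma regularized_speed_le:
  assumes flow: "regularized_flow l T z" and "0 < l" and t: "t \<in> {0..T}"
  shows "norm (snd (z t)) \<le> speed_bound (z 0)"
proof -
  define E where "E t = V (fst (z t)) + (inner (snd (z t)) (snd (z t))) / 2" for t
  have "E t - E 0 \<le> 0 * (t - 0)"
  proof (rule increment_le_of_deriv_le)
    fix s assume s: "s \<in> {0..t}"
    define x u where "x = fst (z s)" and "u = snd (z s)"
    have zs: "z s = (x, u)" by (simp add: x_def u_def)
    have "(z has_vector_derivative (u, - yosida l u - F (x, u))) (at s within {0..t})"
      using regularized_flow_subset[OF flow s] t by (simp add: zs)
    from has_vector_derivative_fst[OF this] has_vector_derivative_snd[OF this]
    have x': "((\<lambda>t. fst (z t)) has_derivative (\<lambda>h. h *\<^sub>R u)) (at s within {0..t})"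
      and u': "((\<lambda>t. snd (z t)) has_vector_derivative (- yosida l u - F (x, u))) (at s within {0..t})"
      by (simp_all add: has_vector_derivative_def)
    have "(V has_derivative (\<lambda>h. inner h (grad (fst (z s))))) (at (fst (z s)))"
      using grad by (simp add: gderiv_def)
    from has_derivative_compose[OF x' this]
    have "((\<lambda>t. V (fst (z t))) has_real_derivative inner u (grad x)) (at s within {0..t})"
      by (rule has_derivative_imp_has_field_derivative) (simp add: x_def)
    from DERIV_add[OF this DERIV_cdivide[OF has_real_derivative_inner_self[OF u'], of 2]]
    show "(E has_real_derivative (inner u (grad x) + inner (- yosida l u - F (x, u)) u)) (at s within {0..t})"
      unfolding E_def by (simp add: u_def[symmetric])
    have "0 \<le> inner (yosida l u - yosida l 0) (u - 0)" by (rule yosida_monotone) fact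
    then show "inner u (grad x) + inner (- yosida l u - F (x, u)) u \<le> 0"
      using dissipative[of x u] \<open>0 < l\<close> by (simp add: yosida_zero inner_diff_left inner_diff_right inner_commute)
  qed (use t in auto)
  then have "(norm (snd (z t)))\<^sup>2 \<le> 2 * (V (fst (z 0)) - V (fst (z t))) + (norm (snd (z 0)))\<^sup>2"
    unfolding E_def power2_norm_eq_inner by simp
  also have "\<dots> \<le> 2 * (V (fst (z 0)) - V_min) + (norm (snd (z 0)))\<^sup>2" using V_bound by simp
  finally show ?thesis unfolding speed_bound_def by (rule real_le_rsqrt)
qed

lemma regularized_norm_le:
  assumes flow: "regularized_flow l T z" and "0 < l" and t: "t \<in> {0..T}"
  shows "norm (z t) \<le> phase_bound (z 0) T"
proof -
  have "norm (fst (z t)) \<le> norm (fst (z 0)) + speed_bound (z 0) * (t - 0)"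
  proof (rule norm_growth)
    fix s assume s: "s \<in> {0..t}"
    show "((\<lambda>t. fst (z t)) has_vector_derivative snd (z s)) (at s within {0..t})"
      using has_vector_derivative_fst[OF regularized_flow_subset[OF flow s]] t by simp
    have "inner (snd (z s)) (fst (z s)) \<le> norm (snd (z s)) * norm (fst (z s))"
      by (rule norm_cauchy_schwarz)
    also have "\<dots> \<le> speed_bound (z 0) * norm (fst (z s))"
      using regularized_speed_le[OF flow \<open>0 < l\<close>, of s] s t by (intro mult_right_mono) auto
    finally show "inner (snd (z s)) (fst (z s)) \<le> speed_bound (z 0) * norm (fst (z s))" .
  qed (use t speed_bound_nonneg in auto)
  also have "\<dots> \<le> norm (fst (z 0)) + speed_bound (z 0) * T"
    using t speed_bound_nonneg[of "z 0"] by (auto intro: mult_left_mono)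
  finally have "norm (fst (z t)) + norm (snd (z t)) \<le> phase_bound (z 0) T"
    unfolding phase_bound_def using regularized_speed_le[OF assms] by simp
  then show ?thesis using norm_Pair_le[of "fst (z t)" "snd (z t)"] by simp
qed

text \<open>Retracting the argument of \<open>F\<close> to a ball makes the vector field globally Lipschitz. The radius
  exceeds the a priori bound \<open>phase_bound\<close>, which applies up to the first time at which the solution
  reaches the sphere; so it never does, and the retraction is not felt.\<close>

lemma regularized_flow_exists:
  assumes "0 < l" "0 \<le> T"
  obtains z where "z 0 = z0" "regularized_flow l T z"
proof -
  define R where "R = phase_bound z0 T + 1"
  have R: "0 < R" unfolding R_def phase_bound_def using speed_bound_nonneg[of z0] assms
    by (simp add: add_nonneg_pos)
  obtain P :: "'a \<times> 'a \<Rightarrow> 'a \<times> 'a" where P: "2-lipschitz_on UNIV P" "\<And>z. norm (P z) \<le> R" "\<And>z. norm z \<le> R \<Longrightarrow> P z = z"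
    using ball_retraction[OF R] by blast
  obtain L where L: "L-lipschitz_on (cball 0 R) F" using F_lipschitz by blast
  define G where "G z = (snd z, - yosida l (snd z) - F (P z))" for z
  have "L-lipschitz_on (P ` UNIV) F"
    using L by (rule lipschitz_on_subset) (use P(2) in auto)
  then have FP: "(L * 2)-lipschitz_on UNIV (\<lambda>z. F (P z))"
    using lipschitz_on_compose2[OF P(1)] by simp
  have sndL: "1-lipschitz_on UNIV (snd :: 'a \<times> 'a \<Rightarrow> 'a)"
    by (rule lipschitz_onI) (auto simp: dist_snd_le)
  have "(2 / l * 1)-lipschitz_on UNIV (\<lambda>z :: 'a \<times> 'a. yosida l (snd z))"
    by (rule lipschitz_on_compose2[OF sndL yosida_lipschitz]) fact
  then have "(sqrt (1\<^sup>2 + (2 / l * 1 + L * 2)\<^sup>2))-lipschitz_on UNIV G"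
    unfolding G_def by (intro lipschitz_on_Pair sndL lipschitz_on_diff lipschitz_on_minus FP)
  then obtain z where z0: "z 0 = z0"
    and z: "\<And>t. t \<ge> 0 \<Longrightarrow> (z has_vector_derivative G (z t)) (at t within {0..})"
    using ode_global by blast
  have cont: "continuous_on {0..T} z"
    by (rule continuous_on_vector_derivative, rule has_vector_derivative_within_subset[OF z]) auto
  have flow: "regularized_flow l \<tau> z" if "\<And>t. t \<in> {0..\<tau>} \<Longrightarrow> norm (z t) \<le> R" for \<tau>
    unfolding regularized_flow_def
  proof
    fix t assume t: "t \<in> {0..\<tau>}"
    have "(z has_vector_derivative G (z t)) (at t within {0..\<tau>})"
      by (rule has_vector_derivative_within_subset[OF z]) (use t in auto)
    then show "(z has_vector_derivative (snd (z t), - yosida l (snd (z t)) - F (z t))) (at t within {0..\<tau>})"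
      using P(3)[OF that[OF t]] by (simp add: G_def)
  qed
  have "norm (z t) < R" if "t \<in> {0..T}" for t
  proof (rule ccontr)
    assume "\<not> norm (z t) < R"
    define S where "S = {t \<in> {0..T}. R \<le> norm (z t)}"
    have "S = {0..T} \<inter> (\<lambda>t. norm (z t)) -` {R..}" unfolding S_def by auto
    then have "closed S"
      using cont by (auto intro!: continuous_closed_preimage continuous_on_norm)
    moreover have "S \<noteq> {}" using that \<open>\<not> norm (z t) < R\<close> unfolding S_def by auto
    moreover have bdd: "bdd_below S" unfolding S_def by (rule bdd_belowI[of _ 0]) auto
    ultimately have \<tau>: "Inf S \<in> S" by (intro closed_contains_Inf)
    define \<tau> where "\<tau> = Inf S"
    have less: "norm (z s) < R" if "0 \<le> s" "s < \<tau>" for s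
    proof (rule ccontr)
      assume "\<not> norm (z s) < R"
      then have "s \<in> S" using that \<tau> unfolding S_def \<tau>_def by auto
      then show False using cInf_lower[OF _ bdd] that unfolding \<tau>_def by force
    qed
    have \<tau>T: "\<tau> \<in> {0..T}" "R \<le> norm (z \<tau>)" using \<tau> unfolding S_def \<tau>_def by auto
    have "norm (z 0) < R"
      using norm_le_phase_bound[OF \<open>0 \<le> T\<close>, of z0] z0 by (simp add: R_def)
    then have "0 < \<tau>" using \<tau>T by (cases "\<tau> = 0") auto
    have "norm (z \<tau>) \<le> R"
    proof (rule tendsto_upperbound)
      have "((\<lambda>t. norm (z t)) \<longlongrightarrow> norm (z \<tau>)) (at \<tau> within {0..T})"
        using cont \<tau>T by (auto simp: continuous_on_def intro!: tendsto_norm)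
      then show "((\<lambda>t. norm (z t)) \<longlongrightarrow> norm (z \<tau>)) (at \<tau> within {0..<\<tau>})"
        by (rule tendsto_within_subset) (use \<tau>T in auto)
      show "\<forall>\<^sub>F s in at \<tau> within {0..<\<tau>}. norm (z s) \<le> R"
        using less by (auto simp: eventually_at_filter less_imp_le)
      show "at \<tau> within {0..<\<tau>} \<noteq> bot"
        using \<open>0 < \<tau>\<close> by (simp add: at_within_eq_bot_iff islimpt_Ico)
    qed
    then have "norm (z s) \<le> R" if "s \<in> {0..\<tau>}" for s
      using less[of s] that by (cases "s = \<tau>") auto
    from regularized_norm_le[OF flow[OF this] \<open>0 < l\<close>, of \<tau> \<tau>]
    have "norm (z \<tau>) \<le> phase_bound z0 \<tau>" using \<open>0 < \<tau>\<close> z0 by simp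
    also have "\<dots> < R" using phase_bound_mono[of \<tau> T z0] \<tau>T by (simp add: R_def)
    finally show False using \<tau>T by simp
  qed
  then have "regularized_flow l T z" using flow by (auto intro: less_imp_le)
  then show thesis using z0 that by blast
qed

text \<open>The point of these bounds is that the constants do not depend on the regularization parameter,
  although the Lipschitz constant of the Yosida approximation blows up.\<close>

lemma regularized_flow_uniform:
  obtains C L D where "0 \<le> C" "0 \<le> L" "0 \<le> D"
    "L-lipschitz_on (cball 0 (phase_bound z0 T)) F"
    "\<And>l z t. 0 < l \<Longrightarrow> regularized_flow l T z \<Longrightarrow> z 0 = z0 \<Longrightarrow> t \<in> {0..T} \<Longrightarrow>
       norm (z t) \<le> phase_bound z0 T \<and> norm (yosida l (snd (z t))) \<le> C"
    "\<And>l z s t. 0 < l \<Longrightarrow> regularized_flow l T z \<Longrightarrow> z 0 = z0 \<Longrightarrow> 0 \<le> s \<Longrightarrow> s \<le> t \<Longrightarrow> t \<le> T \<Longrightarrow>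
       norm (z t - z s) \<le> D * (t - s)"
proof -
  let ?R = "phase_bound z0 T"
  obtain C where C: "0 \<le> C" "\<And>l u. 0 < l \<Longrightarrow> norm u \<le> speed_bound z0 \<Longrightarrow> norm (yosida l u) \<le> C"
    using yosida_bounded by blast
  obtain L where L: "L-lipschitz_on (cball 0 ?R) F" using F_lipschitz by blast
  have L0: "0 \<le> L" using L lipschitz_on_nonneg by blast
  define D where "D = speed_bound z0 + (C + (norm (F 0) + L * max 0 ?R))"
  have D0: "0 \<le> D" using speed_bound_nonneg C L0 by (simp add: D_def)
  have bd: "norm (z t) \<le> ?R \<and> norm (yosida l (snd (z t))) \<le> C"
    if "0 < l" "regularized_flow l T z" "z 0 = z0" "t \<in> {0..T}" for l z t
    using regularized_norm_le[OF that(2,1,4)] regularized_speed_le[OF that(2,1,4)] that C by auto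
  have "norm (z t - z s) \<le> D * (t - s)"
    if flow: "0 < l" "regularized_flow l T z" "z 0 = z0" and st: "0 \<le> s" "s \<le> t" "t \<le> T" for l z s t
  proof -
    have "norm (z t - z s) \<le> norm (z s - z s) + D * (t - s)"
    proof (rule norm_growth[where w = "\<lambda>r. z r - z s"])
      fix r assume r: "r \<in> {s..t}"
      let ?w = "(snd (z r), - yosida l (snd (z r)) - F (z r))"
      show "((\<lambda>r. z r - z s) has_vector_derivative ?w) (at r within {s..t})"
        using regularized_flow_subset[OF flow(2) r] st by (auto intro!: derivative_eq_intros)
      have rT: "r \<in> {0..T}" using r st by auto
      note b = bd[OF flow rT]
      have R0: "0 \<le> ?R" using b norm_ge_zero order_trans by blast
      have "norm (F (z r) - F 0) \<le> L * norm (z r - 0)"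
        using b R0 by (intro lipschitz_on_normD[OF L]) auto
      also have "\<dots> \<le> L * max 0 ?R" using b L0 by (auto intro!: mult_left_mono)
      finally have "norm (F (z r)) \<le> norm (F 0) + L * max 0 ?R"
        using norm_triangle_sub[of "F (z r)" "F 0"] by linarith
      moreover have "norm ?w \<le> norm (snd (z r)) + norm (- yosida l (snd (z r)) - F (z r))"
        by (rule norm_Pair_le)
      moreover have "norm (- yosida l (snd (z r)) - F (z r)) \<le> norm (yosida l (snd (z r))) + norm (F (z r))"
        using norm_triangle_ineq4[of "- yosida l (snd (z r))" "F (z r)"] by simp
      moreover have "norm (snd (z r)) \<le> speed_bound z0"
        using regularized_speed_le[OF flow(2,1) rT] flow(3) by simp
      ultimately have "norm ?w \<le> D" using b unfolding D_def by linarith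
      then have "norm ?w * norm (z r - z s) \<le> D * norm (z r - z s)" by (rule mult_right_mono) simp
      then show "inner ?w (z r - z s) \<le> D * norm (z r - z s)"
        using norm_cauchy_schwarz[of ?w "z r - z s"] by linarith
    qed (use st D0 in auto)
    then show ?thesis by simp
  qed
  then show thesis using that C(1) L0 D0 L bd by blast
qed

text \<open>Gronwall's inequality for \<open>|z - w|\<^sup>2\<close>: the two Yosida terms are monotone up to an error of
  order \<open>l + m\<close>, and the other terms are Lipschitz in \<open>z - w\<close>.\<close>

lemma regularized_flows_close:
  obtains M where "0 \<le> M"
    "\<And>l m z w t. 0 < l \<Longrightarrow> 0 < m \<Longrightarrow> regularized_flow l T z \<Longrightarrow> regularized_flow m T w \<Longrightarrow>
       z 0 = z0 \<Longrightarrow> w 0 = z0 \<Longrightarrow> t \<in> {0..T} \<Longrightarrow> (norm (z t - w t))\<^sup>2 \<le> M * (l + m)"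
proof -
  obtain C L D where C: "0 \<le> C" "0 \<le> L" and L: "L-lipschitz_on (cball 0 (phase_bound z0 T)) F"
    and bd: "\<And>l z t. 0 < l \<Longrightarrow> regularized_flow l T z \<Longrightarrow> z 0 = z0 \<Longrightarrow> t \<in> {0..T} \<Longrightarrow>
       norm (z t) \<le> phase_bound z0 T \<and> norm (yosida l (snd (z t))) \<le> C"
    using regularized_flow_uniform[of z0 T] by metis
  define K where "K = 2 + 2 * L"
  have K: "0 < K" using C by (simp add: K_def)
  define M where "M = 4 * C\<^sup>2 / K * exp (K * T)"
  have M0: "0 \<le> M" using C K by (simp add: M_def)
  have "(norm (z t - w t))\<^sup>2 \<le> M * (l + m)"
    if lm: "0 < l" "0 < m" and z: "regularized_flow l T z" "z 0 = z0"
      and w: "regularized_flow m T w" "w 0 = z0" and t: "t \<in> {0..T}" for l m z w t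
  proof -
    define e where "e t = inner (z t - w t) (z t - w t)" for t
    define e' where "e' t = 2 * inner ((snd (z t), - yosida l (snd (z t)) - F (z t)) - (snd (w t), - yosida m (snd (w t)) - F (w t))) (z t - w t)" for t
    let ?\<kappa> = "4 * C\<^sup>2 * (l + m)"
    have "e t \<le> ?\<kappa> / K * exp (K * t) - ?\<kappa> / K"
    proof (rule gronwall_forced[OF _ K])
      fix s assume s: "s \<in> {0..t}"
      then have sT: "s \<in> {0..T}" using t by auto
      have "((\<lambda>t. z t - w t) has_vector_derivative
         ((snd (z s), - yosida l (snd (z s)) - F (z s)) - (snd (w s), - yosida m (snd (w s)) - F (w s)))) (at s within {0..t})"
        using regularized_flow_subset[OF z(1) s] regularized_flow_subset[OF w(1) s] t
        by (intro derivative_intros) auto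
      then show "(e has_real_derivative e' s) (at s within {0..t})"
        unfolding e_def e'_def by (rule has_real_derivative_inner_self)
      let ?dx = "fst (z s) - fst (w s)" and ?du = "snd (z s) - snd (w s)"
      have "e' s = 2 * (inner ?du ?dx - inner (yosida l (snd (z s)) - yosida m (snd (w s))) ?du
          - inner (F (z s) - F (w s)) ?du)"
        unfolding e'_def inner_prod_def by (simp add: inner_diff_left algebra_simps)
      moreover have "- inner (yosida l (snd (z s)) - yosida m (snd (w s))) ?du \<le> 2 * C\<^sup>2 * (l + m)"
        using yosida_almost_monotone[OF lm] bd[OF lm(1) z sT] bd[OF lm(2) w sT] 
        by (metis minus_le_iff mult_minus_left)
      moreover have es: "e s = inner ?dx ?dx + inner ?du ?du"
        by (simp add: e_def inner_prod_def)
      moreover have "2 * inner ?du ?dx \<le> inner ?dx ?dx + inner ?du ?du"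
        using inner_ge_zero[of "?dx - ?du"] by (simp add: inner_diff_left inner_diff_right inner_commute)
      moreover have "- inner (F (z s) - F (w s)) ?du \<le> L * e s"
      proof -
        have "- inner (F (z s) - F (w s)) ?du \<le> norm (F (z s) - F (w s)) * norm ?du"
          using Cauchy_Schwarz_ineq2[of "F (z s) - F (w s)" ?du] by linarith
        also have "\<dots> \<le> (L * norm (z s - w s)) * norm (z s - w s)"
          using bd[OF lm(1) z sT] bd[OF lm(2) w sT] C norm_snd_le[of "?dx" "?du"]
          by (intro mult_mono lipschitz_on_normD[OF L]) (auto simp: norm_prod_def)
        also have "\<dots> = L * e s"
          by (simp add: e_def power2_norm_eq_inner[symmetric] power2_eq_square)
        finally show ?thesis .
      qed
      moreover have "0 \<le> e s" by (simp add: e_def)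
      ultimately show "e' s \<le> K * e s + ?\<kappa>" unfolding K_def by (simp add: algebra_simps)
    qed (use t z w in \<open>auto simp: e_def\<close>)
    also have "\<dots> \<le> ?\<kappa> / K * exp (K * t)" using lm K by simp
    also have "\<dots> \<le> ?\<kappa> / K * exp (K * T)"
      using t K lm by (intro mult_left_mono) auto
    finally show ?thesis by (simp add: e_def M_def power2_norm_eq_inner algebra_simps add_divide_distrib)
  qed
  then show thesis using that[OF M0] by blast
qed

end

section \<open>The limit of vanishing regularization\<close>

text \<open>The approximations with index \<open>n\<close> live on \<open>[0, n]\<close> only, since the truncation radius depends on the
  time horizon; every compact interval is covered by all but finitely many of them. Hence one
  sequence produces the limit on the half-line and no gluing is necessary.\<close>

locale vanishing_regularization = damped_system A F V grad V_min
  for A :: "'a::{real_inner, complete_space} \<Rightarrow> 'a set" and F V grad V_min +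
  fixes Z :: "nat \<Rightarrow> real \<Rightarrow> 'a \<times> 'a" and z0 :: "'a \<times> 'a"
  assumes flow: "regularized_flow (1 / (real n + 1)) (real n) (Z n)"
    and initial: "Z n 0 = z0"
begin

definition l :: "nat \<Rightarrow> real" where "l n = 1 / (real n + 1)"

lemma l_pos: "0 < l n" by (simp add: l_def)

lemma l_tendsto: "l \<longlonglongrightarrow> 0" unfolding l_def by real_asymp

definition limit :: "real \<Rightarrow> 'a \<times> 'a" where
  "limit t = lim (\<lambda>n. Z n t)"

definition x :: "real \<Rightarrow> 'a" where "x t = fst (limit t)"

definition u :: "real \<Rightarrow> 'a" where "u t = snd (limit t)"

lemma flow_restrict: "T \<le> real n \<Longrightarrow> regularized_flow (l n) T (Z n)"
  unfolding regularized_flow_def by (intro ballI regularized_flow_subset[OF flow[folded l_def]]) auto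

lemma uniform_convergence:
  obtains d where "d \<longlonglongrightarrow> 0" "\<And>n t. T \<le> real n \<Longrightarrow> t \<in> {0..T} \<Longrightarrow> norm (Z n t - limit t) \<le> d n"
    "\<And>t. t \<in> {0..T} \<Longrightarrow> (\<lambda>n. Z n t) \<longlonglongrightarrow> limit t"
proof -
  obtain M where "0 \<le> M" and M: "\<And>l m z w t. 0 < l \<Longrightarrow> 0 < m \<Longrightarrow> regularized_flow l T z \<Longrightarrow>
      regularized_flow m T w \<Longrightarrow> z 0 = z0 \<Longrightarrow> w 0 = z0 \<Longrightarrow> t \<in> {0..T} \<Longrightarrow> (norm (z t - w t))\<^sup>2 \<le> M * (l + m)"
    using regularized_flows_close[of T z0] by metis
  have close: "(norm (Z n t - Z m t))\<^sup>2 \<le> M * (l n + l m)"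
    if "T \<le> real n" "T \<le> real m" "t \<in> {0..T}" for n m t
    using M[OF l_pos l_pos flow_restrict flow_restrict] initial that by auto
  have conv: "(\<lambda>n. Z n t) \<longlonglongrightarrow> limit t" if t: "t \<in> {0..T}" for t
  proof -
    have "Cauchy (\<lambda>n. Z n t)"
    proof (rule CauchyI)
      fix e :: real assume "0 < e"
      have "(\<lambda>n. M * l n) \<longlonglongrightarrow> M * 0" by (intro tendsto_intros l_tendsto)
      then have "\<forall>\<^sub>F n in sequentially. M * l n < e\<^sup>2 / 2"
        by (rule order_tendstoD) (use \<open>0 < e\<close> in simp)
      moreover have "\<forall>\<^sub>F n in sequentially. T \<le> real n"
        using filterlim_real_sequentially by (simp add: filterlim_at_top)
      ultimately have "\<forall>\<^sub>F n in sequentially. M * l n < e\<^sup>2 / 2 \<and> T \<le> real n" by eventually_elim simp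
      then obtain N where N: "\<And>n. n \<ge> N \<Longrightarrow> M * l n < e\<^sup>2 / 2 \<and> T \<le> real n"
        by (auto simp: eventually_sequentially)
      have "norm (Z m t - Z n t) < e" if "m \<ge> N" "n \<ge> N" for m n
      proof -
        have "(norm (Z m t - Z n t))\<^sup>2 < e\<^sup>2"
          using close[of m n t] N[OF that(1)] N[OF that(2)] t by (simp add: distrib_left)
        then show ?thesis using \<open>0 < e\<close> by (simp add: power2_less_imp_less)
      qed
      then show "\<exists>N. \<forall>m\<ge>N. \<forall>n\<ge>N. norm (Z m t - Z n t) < e" by blast
    qed
    then show ?thesis by (simp add: limit_def Cauchy_convergent_iff convergent_LIMSEQ_iff)
  qed
  \<comment> \<open>let the second index tend to infinity in \<open>close\<close>\<close>
  define d where "d n = sqrt (M * l n)" for n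
  have "d \<longlonglongrightarrow> sqrt (M * 0)" unfolding d_def by (intro tendsto_intros l_tendsto)
  then have d0: "d \<longlonglongrightarrow> 0" by simp
  have "norm (Z n t - limit t) \<le> d n" if n: "T \<le> real n" and t: "t \<in> {0..T}" for n t
    unfolding d_def
  proof (rule real_le_rsqrt, rule LIMSEQ_le)
    show "(\<lambda>m. (norm (Z n t - Z m t))\<^sup>2) \<longlonglongrightarrow> (norm (Z n t - limit t))\<^sup>2"
      by (intro tendsto_intros conv t)
    have "(\<lambda>m. M * (l n + l m)) \<longlonglongrightarrow> M * (l n + 0)" by (intro tendsto_intros l_tendsto)
    then show "(\<lambda>m. M * (l n + l m)) \<longlonglongrightarrow> M * l n" by simp
    obtain N where "T \<le> real N" using real_arch_simple by blast
    then show "\<exists>N. \<forall>m\<ge>N. (norm (Z n t - Z m t))\<^sup>2 \<le> M * (l n + l m)"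
      by (intro exI[of _ N] allI impI close n t) auto
  qed
  then show thesis using that d0 conv by blast
qed

text \<open>Stated for all \<open>n\<close> beyond the horizon \<open>T\<close>, the form in which estimates for \<open>Z n\<close> are available.\<close>

lemma limit_pass:
  assumes "X \<longlonglongrightarrow> a" "Y \<longlonglongrightarrow> b" "\<And>n. T \<le> real n \<Longrightarrow> X n \<le> (Y n :: real)"
  shows "a \<le> b"
proof (rule LIMSEQ_le[OF assms(1,2)])
  obtain N where "T \<le> real N" using real_arch_simple by blast
  then show "\<exists>N. \<forall>n\<ge>N. X n \<le> Y n" by (intro exI[of _ N] allI impI assms) auto
qed

lemma Z_tendsto: "0 \<le> t \<Longrightarrow> (\<lambda>n. Z n t) \<longlonglongrightarrow> limit t"
  using uniform_convergence[of t] by (metis atLeastAtMost_iff order_refl)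

lemma limit_initial: "limit 0 = z0"
  using Z_tendsto[of 0] by (simp add: initial LIMSEQ_const_iff)

lemma Z_bounded: "T \<le> real n \<Longrightarrow> t \<in> {0..T} \<Longrightarrow> norm (Z n t) \<le> phase_bound z0 T"
  using regularized_norm_le[OF flow_restrict l_pos, of T n t] by (simp add: initial)

lemma limit_bounded: "t \<in> {0..T} \<Longrightarrow> norm (limit t) \<le> phase_bound z0 T"
  by (rule limit_pass[OF tendsto_norm[OF Z_tendsto] tendsto_const]) (use Z_bounded in auto)

lemma yosida_along_flow_bounded:
  obtains C where "0 \<le> C" "\<And>n t. T \<le> real n \<Longrightarrow> t \<in> {0..T} \<Longrightarrow> norm (yosida (l n) (snd (Z n t))) \<le> C"
proof -
  obtain C where "0 \<le> C" "\<And>l z t. 0 < l \<Longrightarrow> regularized_flow l T z \<Longrightarrow> z 0 = z0 \<Longrightarrow> t \<in> {0..T} \<Longrightarrow>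
       norm (z t) \<le> phase_bound z0 T \<and> norm (yosida l (snd (z t))) \<le> C"
    using regularized_flow_uniform[of z0 T] by metis
  with that show thesis using flow_restrict initial l_pos by blast
qed

lemma equilipschitz:
  obtains D where "0 \<le> D"
    "\<And>n s t. T \<le> real n \<Longrightarrow> 0 \<le> s \<Longrightarrow> s \<le> t \<Longrightarrow> t \<le> T \<Longrightarrow> norm (Z n t - Z n s) \<le> D * (t - s)"
    "\<And>s t. 0 \<le> s \<Longrightarrow> s \<le> t \<Longrightarrow> t \<le> T \<Longrightarrow> norm (limit t - limit s) \<le> D * (t - s)"
proof -
  obtain D where D0: "0 \<le> D" and D: "\<And>l z s t. 0 < l \<Longrightarrow> regularized_flow l T z \<Longrightarrow> z 0 = z0 \<Longrightarrow>
       0 \<le> s \<Longrightarrow> s \<le> t \<Longrightarrow> t \<le> T \<Longrightarrow> norm (z t - z s) \<le> D * (t - s)"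
    using regularized_flow_uniform[of z0 T] by metis
  have D': "norm (Z n t - Z n s) \<le> D * (t - s)" if "T \<le> real n" "0 \<le> s" "s \<le> t" "t \<le> T" for n s t
    using D[OF l_pos flow_restrict initial] that by blast
  have "norm (limit t - limit s) \<le> D * (t - s)" if "0 \<le> s" "s \<le> t" "t \<le> T" for s t
    by (rule limit_pass[OF tendsto_norm[OF tendsto_diff[OF Z_tendsto Z_tendsto]] tendsto_const])
       (use that D' in auto)
  then show thesis using that D0 D' by blast
qed

lemma position_increment:
  obtains D where "0 \<le> D"
    "\<And>s t. 0 \<le> s \<Longrightarrow> s \<le> t \<Longrightarrow> t \<le> T \<Longrightarrow> norm (x t - x s - (t - s) *\<^sub>R u s) \<le> D * (t - s)\<^sup>2"
proof -
  obtain D where D: "0 \<le> D"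
    and lip: "\<And>n s t. T \<le> real n \<Longrightarrow> 0 \<le> s \<Longrightarrow> s \<le> t \<Longrightarrow> t \<le> T \<Longrightarrow> norm (Z n t - Z n s) \<le> D * (t - s)"
    using equilipschitz[of T] by metis
  have "norm (x t - x s - (t - s) *\<^sub>R u s) \<le> D * (t - s)\<^sup>2" if st: "0 \<le> s" "s \<le> t" "t \<le> T" for s t
  proof (rule limit_pass[OF _ tendsto_const])
    show "(\<lambda>n. norm (fst (Z n t) - fst (Z n s) - (t - s) *\<^sub>R snd (Z n s))) \<longlonglongrightarrow> norm (x t - x s - (t - s) *\<^sub>R u s)"
      unfolding x_def u_def using st by (intro tendsto_intros Z_tendsto) auto
    fix n assume n: "T \<le> real n"
    define w where "w r = fst (Z n r) - fst (Z n s) - (r - s) *\<^sub>R snd (Z n s)" for r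
    have "norm (w t) \<le> norm (w s) + D * (t - s) * (t - s)"
    proof (rule norm_growth)
      fix r assume r: "r \<in> {s..t}"
      show "(w has_vector_derivative snd (Z n r) - snd (Z n s)) (at r within {s..t})"
        unfolding w_def
        using has_vector_derivative_fst[OF regularized_flow_subset[OF flow_restrict[OF n] r]] st
        by (auto intro!: derivative_eq_intros)
      have "norm (snd (Z n r - Z n s)) \<le> norm (Z n r - Z n s)"
        by (metis norm_snd_le prod.collapse)
      also have "\<dots> \<le> D * (r - s)" using lip[OF n, of s r] r st by auto
      also have "\<dots> \<le> D * (t - s)" using D r by (intro mult_left_mono) auto
      finally have "norm (snd (Z n r) - snd (Z n s)) * norm (w r) \<le> D * (t - s) * norm (w r)"
        by (intro mult_right_mono) auto
      then show "inner (snd (Z n r) - snd (Z n s)) (w r) \<le> D * (t - s) * norm (w r)"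
        using norm_cauchy_schwarz[of "snd (Z n r) - snd (Z n s)" "w r"] by linarith
    qed (use st D in auto)
    then show "norm (fst (Z n t) - fst (Z n s) - (t - s) *\<^sub>R snd (Z n s)) \<le> D * (t - s)\<^sup>2"
      by (simp add: w_def power2_eq_square mult.assoc)
  qed
  then show thesis using that D by blast
qed

lemma velocity_lipschitz: 
  obtains D where "D-lipschitz_on {0..T} u"
proof -
  obtain D where D: "0 \<le> D"
    and lip: "\<And>s t. 0 \<le> s \<Longrightarrow> s \<le> t \<Longrightarrow> t \<le> T \<Longrightarrow> norm (limit t - limit s) \<le> D * (t - s)"
    using equilipschitz[of T] by metis
  have le: "norm (u t - u s) \<le> D * (t - s)" if "0 \<le> s" "s \<le> t" "t \<le> T" for s t
    using lip[OF that] norm_snd_le[of "snd (limit t - limit s)" "fst (limit t - limit s)"] 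
    unfolding u_def by (metis norm_snd_le order_trans prod.collapse snd_diff)
  have "D-lipschitz_on {0..T} u"
  proof (rule lipschitz_onI[OF _ D])
    fix s t assume "s \<in> {0..T}" "t \<in> {0..T}"
    then show "dist (u s) (u t) \<le> D * dist s t"
      using le[of s t] le[of t s] by (cases "s \<le> t") (auto simp: dist_norm norm_minus_commute)
  qed
  then show thesis using that by blast
qed

lemma position_has_velocity:
  assumes "0 \<le> t"
  shows "(x has_vector_derivative u t) (at t within {0..})"
proof -
  obtain D where D: "0 \<le> D" and pos: "\<And>s r. 0 \<le> s \<Longrightarrow> s \<le> r \<Longrightarrow> r \<le> t + 1 \<Longrightarrow>
      norm (x r - x s - (r - s) *\<^sub>R u s) \<le> D * (r - s)\<^sup>2"
    using position_increment[of "t + 1"] by metis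
  obtain B where B: "B-lipschitz_on {0..t + 1} u" using velocity_lipschitz by blast
  have B0: "0 \<le> B" using B lipschitz_on_nonneg by blast
  have est: "norm (x r - x t - (r - t) *\<^sub>R u t) \<le> (D + B) * \<bar>r - t\<bar> * \<bar>r - t\<bar>" if r: "0 \<le> r" "r \<le> t + 1" for r
  proof (cases "t \<le> r")
    case True
    have "norm (x r - x t - (r - t) *\<^sub>R u t) \<le> D * (r - t)\<^sup>2" using pos[of t r] True r assms by auto
    also have "\<dots> \<le> (D + B) * (r - t)\<^sup>2" using B0 by (intro mult_right_mono) auto
    finally show ?thesis by (simp add: power2_eq_square mult.assoc[symmetric] abs_mult[symmetric])
  next
    case False
    have "x r - x t - (r - t) *\<^sub>R u t = - (x t - x r - (t - r) *\<^sub>R u r) + (t - r) *\<^sub>R (u t - u r)"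
      by (simp add: algebra_simps)
    then have "norm (x r - x t - (r - t) *\<^sub>R u t) \<le> norm (x t - x r - (t - r) *\<^sub>R u r) + norm ((t - r) *\<^sub>R (u t - u r))"
      by (metis norm_minus_cancel norm_triangle_ineq)
    also have "\<dots> \<le> D * (t - r)\<^sup>2 + (t - r) * (B * (t - r))"
      using pos[of r t] False r lipschitz_on_normD[OF B, of t r] by (intro add_mono) (auto intro!: mult_left_mono)
    also have "\<dots> = (D + B) * \<bar>r - t\<bar> * \<bar>r - t\<bar>" using False by (simp add: power2_eq_square algebra_simps)
    finally show ?thesis .
  qed
  show ?thesis
    unfolding has_vector_derivative_def has_derivative_within_alt
  proof (intro conjI allI impI)
    show "bounded_linear (\<lambda>h. h *\<^sub>R u t)" by (rule bounded_linear_scaleR_left)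
    fix e :: real assume "0 < e"
    define \<delta> where "\<delta> = min 1 (e / (D + B + 1))"
    have "0 < \<delta>" using \<open>0 < e\<close> D B0 by (simp add: \<delta>_def)
    moreover have "norm (x r - x t - (r - t) *\<^sub>R u t) \<le> e * norm (r - t)"
      if "r \<in> {0..}" "norm (r - t) < \<delta>" for r
    proof -
      have "(D + B) * \<bar>r - t\<bar> \<le> (D + B + 1) * (e / (D + B + 1))"
        using that D B0 by (intro mult_mono) (auto simp: \<delta>_def)
      also have "\<dots> = e" using D B0 by simp
      finally have "(D + B) * \<bar>r - t\<bar> * \<bar>r - t\<bar> \<le> e * \<bar>r - t\<bar>" by (rule mult_right_mono) simp
      then show ?thesis using est[of r] that by (simp add: \<delta>_def) linarith
    qed
    ultimately show "\<exists>d>0. \<forall>y\<in>{0..}. norm (y - t) < d \<longrightarrow> norm (x y - x t - (y - t) *\<^sub>R u t) \<le> e * norm (y - t)"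
      by blast
  qed
qed

text \<open>The trajectory and its translate by \<open>h\<close> solve the same equation. The monotone term does not let
  their velocities drift apart, so only the variation of \<open>F\<close> contributes, which is of order \<open>h\<close>.\<close>

lemma increments_almost_decrease:
  obtains B where "0 \<le> B"
    "\<And>s t h. 0 \<le> s \<Longrightarrow> s \<le> t \<Longrightarrow> 0 \<le> h \<Longrightarrow> t + h \<le> T \<Longrightarrow>
       norm (u (t + h) - u t) \<le> norm (u (s + h) - u s) + B * h * (t - s)"
proof -
  obtain L where L: "L-lipschitz_on (cball 0 (phase_bound z0 T)) F" using F_lipschitz by blast
  obtain D where "0 \<le> D" and lip: "\<And>n s t. T \<le> real n \<Longrightarrow> 0 \<le> s \<Longrightarrow> s \<le> t \<Longrightarrow> t \<le> T \<Longrightarrow> norm (Z n t - Z n s) \<le> D * (t - s)"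
    using equilipschitz[of T] by metis
  with L have LD: "0 \<le> L" "0 \<le> D" using lipschitz_on_nonneg by auto
  define B where "B = L * D"
  have B: "0 \<le> B" using LD by (simp add: B_def)
  have "norm (u (t + h) - u t) \<le> norm (u (s + h) - u s) + B * h * (t - s)"
    if st: "0 \<le> s" "s \<le> t" "0 \<le> h" "t + h \<le> T" for s t h
  proof (rule limit_pass)
    show "(\<lambda>n. norm (snd (Z n (t + h)) - snd (Z n t))) \<longlonglongrightarrow> norm (u (t + h) - u t)"
      unfolding u_def using st by (intro tendsto_intros Z_tendsto) auto
    show "(\<lambda>n. norm (snd (Z n (s + h)) - snd (Z n s)) + B * h * (t - s)) \<longlonglongrightarrow> norm (u (s + h) - u s) + B * h * (t - s)"
      unfolding u_def using st by (intro tendsto_intros Z_tendsto) auto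
    fix n assume n: "T \<le> real n"
    let ?f = "\<lambda>r. - yosida (l n) (snd (Z n r)) - F (Z n r)"
    show "norm (snd (Z n (t + h)) - snd (Z n t)) \<le> norm (snd (Z n (s + h)) - snd (Z n s)) + B * h * (t - s)"
    proof (rule norm_growth[where w = "\<lambda>r. snd (Z n (r + h)) - snd (Z n r)"])
      fix r assume r: "r \<in> {s..t}"
      then have "r + h \<in> {s + h..t + h}" by auto
      from has_vector_derivative_shift_within[OF has_vector_derivative_snd[OF regularized_flow_subset[OF flow_restrict[OF n] this]]]
        has_vector_derivative_snd[OF regularized_flow_subset[OF flow_restrict[OF n] r]]
      show "((\<lambda>r. snd (Z n (r + h)) - snd (Z n r)) has_vector_derivative (?f (r + h) - ?f r)) (at r within {s..t})"
        using st by (intro derivative_intros) auto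
      let ?w = "snd (Z n (r + h)) - snd (Z n r)"
      have "inner (?f (r + h) - ?f r) ?w
          = - inner (yosida (l n) (snd (Z n (r + h))) - yosida (l n) (snd (Z n r))) ?w
            - inner (F (Z n (r + h)) - F (Z n r)) ?w"
        by (simp add: inner_diff_left)
      also have "\<dots> \<le> norm (F (Z n (r + h)) - F (Z n r)) * norm ?w"
        using yosida_monotone[OF l_pos, of n "snd (Z n (r + h))" "snd (Z n r)"]
          Cauchy_Schwarz_ineq2[of "F (Z n (r + h)) - F (Z n r)" ?w] by linarith
      also have "\<dots> \<le> B * h * norm ?w"
      proof (rule mult_right_mono)
        have "norm (F (Z n (r + h)) - F (Z n r)) \<le> L * norm (Z n (r + h) - Z n r)"
          using r st by (intro lipschitz_on_normD[OF L]) (auto intro!: Z_bounded[OF n])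
        also have "\<dots> \<le> L * (D * h)"
          using lip[OF n, of r "r + h"] r st LD by (intro mult_left_mono) auto
        finally show "norm (F (Z n (r + h)) - F (Z n r)) \<le> B * h" by (simp add: B_def mult.assoc)
      qed simp
      finally show "inner (?f (r + h) - ?f r) ?w \<le> B * h * norm ?w" .
    qed (use st B in auto)
  qed
  then show thesis using that B by blast
qed

text \<open>Trades the Yosida term, which has no strong limit at hand, for a fixed element of the graph of
  \<open>A\<close>; every term on the right passes to the limit.\<close>

lemma minty_inequality:
  assumes n: "T \<le> real n" and t: "t \<in> {0..T}" and "\<xi> \<in> A v"
    and C: "norm (yosida (l n) (snd (Z n t))) \<le> C"
  shows "inner (- yosida (l n) (snd (Z n t)) - F (Z n t)) (snd (Z n t) - v)
    \<le> - inner (\<xi> + F (Z n t)) (snd (Z n t) - v) + l n * norm \<xi> * C"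
  using yosida_vs_graph[OF l_pos \<open>\<xi> \<in> A v\<close> C]
  by (simp add: inner_diff_left inner_add_left)

text \<open>The constant \<open>u s\<close> solves the equation in which \<open>- \<xi>\<close> takes the place of the force \<open>F\<close>. By
  monotonicity the velocity moves away from it at a rate of at most the difference \<open>|\<xi> + F|\<close> of the
  forces, and \<open>F\<close> changes by \<open>O(t - s)\<close> along the trajectory.\<close>

lemma forward_increment:
  obtains B where "0 \<le> B"
    "\<And>s t \<xi>. 0 \<le> s \<Longrightarrow> s \<le> t \<Longrightarrow> t \<le> T \<Longrightarrow> \<xi> \<in> A (u s) \<Longrightarrow>
       norm (u t - u s) \<le> (norm (\<xi> + F (limit s)) + B * (t - s)) * (t - s)"
proof -
  obtain L where L: "L-lipschitz_on (cball 0 (phase_bound z0 T)) F" using F_lipschitz by blast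
  obtain C where "0 \<le> C"
    and yos: "\<And>n t. T \<le> real n \<Longrightarrow> t \<in> {0..T} \<Longrightarrow> norm (yosida (l n) (snd (Z n t))) \<le> C"
    using yosida_along_flow_bounded[of T] by metis
  obtain D where "0 \<le> D"
    and lip: "\<And>n s t. T \<le> real n \<Longrightarrow> 0 \<le> s \<Longrightarrow> s \<le> t \<Longrightarrow> t \<le> T \<Longrightarrow> norm (Z n t - Z n s) \<le> D * (t - s)"
    using equilipschitz[of T] by metis
  obtain d where d: "d \<longlonglongrightarrow> 0" "\<And>n t. T \<le> real n \<Longrightarrow> t \<in> {0..T} \<Longrightarrow> norm (Z n t - limit t) \<le> d n"
    using uniform_convergence[of T] by metis
  have CLD: "0 \<le> C" "0 \<le> L" "0 \<le> D" using \<open>0 \<le> C\<close> \<open>0 \<le> D\<close> L lipschitz_on_nonneg by auto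
  define B where "B = L * D"
  have B: "0 \<le> B" using CLD by (simp add: B_def)
  have "norm (u t - u s) \<le> (norm (\<xi> + F (limit s)) + B * (t - s)) * (t - s)"
    if st: "0 \<le> s" "s \<le> t" "t \<le> T" and \<xi>: "\<xi> \<in> A (u s)" for s t \<xi>
  proof (rule limit_pass)
    define c where "c n = norm (\<xi> + F (limit s)) + B * (t - s) + L * d n" for n
    define Y where "Y n = norm (snd (Z n s) - u s) + sqrt (l n) + (c n + sqrt (l n) * (norm \<xi> * C)) * (t - s)" for n
    show "(\<lambda>n. norm (snd (Z n t) - u s)) \<longlonglongrightarrow> norm (u t - u s)"
      unfolding u_def using st by (intro tendsto_intros Z_tendsto) auto
    have "Y \<longlonglongrightarrow> norm (u s - u s) + sqrt 0 + (norm (\<xi> + F (limit s)) + B * (t - s) + L * 0 + sqrt 0 * (norm \<xi> * C)) * (t - s)"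
      unfolding Y_def c_def u_def using st by (intro tendsto_intros Z_tendsto d l_tendsto) auto
    then show "Y \<longlonglongrightarrow> (norm (\<xi> + F (limit s)) + B * (t - s)) * (t - s)" by simp
    fix n assume n: "T \<le> real n"
    let ?f = "\<lambda>r. - yosida (l n) (snd (Z n r)) - F (Z n r)"
    have d0: "0 \<le> d n" by (rule order_trans[OF norm_ge_zero d(2)[OF n, of s]]) (use st in auto)
    \<comment> \<open>the regularization of the norm is \<open>sqrt (l n)\<close>, against an error of order \<open>l n\<close>\<close>
    have "norm (snd (Z n t) - u s) \<le> norm (snd (Z n s) - u s) + sqrt (l n) + (c n + (l n * norm \<xi> * C) / sqrt (l n)) * (t - s)"
    proof (rule norm_growth_regularized[where w = "\<lambda>r. snd (Z n r) - u s"])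
      fix r assume r: "r \<in> {s..t}"
      then have rT: "r \<in> {0..T}" using st by auto
      show "((\<lambda>r. snd (Z n r) - u s) has_vector_derivative ?f r) (at r within {s..t})"
        using has_vector_derivative_snd[OF regularized_flow_subset[OF flow_restrict[OF n] r]] st
        by (auto intro!: derivative_eq_intros)
      have "norm (F (Z n r) - F (limit s)) \<le> L * norm (Z n r - limit s)"
        using r st by (intro lipschitz_on_normD[OF L]) (auto intro!: Z_bounded[OF n] limit_bounded)
      also have "\<dots> \<le> L * (D * (t - s) + d n)"
      proof (rule mult_left_mono)
        have "norm (Z n r - limit s) \<le> norm (Z n r - Z n s) + norm (Z n s - limit s)"
          using norm_triangle_ineq[of "Z n r - Z n s" "Z n s - limit s"] by simp
        also have "norm (Z n r - Z n s) \<le> D * (r - s)" using lip[OF n, of s r] r st by auto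
        also have "D * (r - s) \<le> D * (t - s)" using r CLD by (intro mult_left_mono) auto
        also have "norm (Z n s - limit s) \<le> d n" using d(2)[OF n, of s] st by auto
        finally show "norm (Z n r - limit s) \<le> D * (t - s) + d n" by simp
      qed (use CLD in auto)
      finally have F: "norm (F (Z n r) - F (limit s)) \<le> B * (t - s) + L * d n"
        by (simp add: B_def algebra_simps)
      have "norm (\<xi> + F (Z n r)) \<le> norm (\<xi> + F (limit s)) + norm (F (Z n r) - F (limit s))"
        using norm_triangle_ineq[of "\<xi> + F (limit s)" "F (Z n r) - F (limit s)"] by simp
      then have cn: "norm (\<xi> + F (Z n r)) \<le> c n" using F unfolding c_def by linarith
      have "- inner (\<xi> + F (Z n r)) (snd (Z n r) - u s) \<le> norm (\<xi> + F (Z n r)) * norm (snd (Z n r) - u s)"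
        using Cauchy_Schwarz_ineq2[of "\<xi> + F (Z n r)" "snd (Z n r) - u s"] by linarith
      also have "\<dots> \<le> c n * norm (snd (Z n r) - u s)" using cn by (rule mult_right_mono) simp
      finally show "inner (?f r) (snd (Z n r) - u s) \<le> c n * norm (snd (Z n r) - u s) + l n * norm \<xi> * C"
        using minty_inequality[OF n rT \<xi> yos[OF n rT]] by linarith
    qed (use st B CLD d0 l_pos[of n] in \<open>auto simp: c_def\<close>)
    also have "(l n * norm \<xi> * C) / sqrt (l n) = sqrt (l n) * (norm \<xi> * C)"
      using real_div_sqrt[OF less_imp_le[OF l_pos[of n]]] by (metis times_divide_eq_left mult.assoc)
    finally show "norm (snd (Z n t) - u s) \<le> Y n" by (simp add: Y_def)
  qed
  then show thesis using that B by blast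
qed

lemma F_continuous: "isCont F z"
proof -
  obtain L where L: "L-lipschitz_on (cball 0 (norm z + 1)) F" using F_lipschitz by blast
  have "continuous_on (ball 0 (norm z + 1)) F"
    using lipschitz_on_continuous_on[OF L] by (rule continuous_on_subset) auto
  then show ?thesis by (simp add: continuous_on_eq_continuous_at)
qed

text \<open>A local form of the integral formulation of the inclusion. It survives the limit because it mentions
  increments of \<open>u\<close> only, and dividing it by \<open>t - s\<close> recovers the inclusion wherever \<open>u\<close> has a
  derivative.\<close>

lemma local_minty:
  assumes "0 \<le> t0" "\<xi> \<in> A v" "0 < e"
  obtains \<delta> where "0 < \<delta>"
    "\<And>s t. 0 \<le> s \<Longrightarrow> s \<le> t \<Longrightarrow> \<bar>s - t0\<bar> < \<delta> \<Longrightarrow> \<bar>t - t0\<bar> < \<delta> \<Longrightarrow>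
       (norm (u t - v))\<^sup>2 - (norm (u s - v))\<^sup>2
         \<le> 2 * (t - s) * (e - inner (\<xi> + F (limit t0)) (u t0 - v))"
proof -
  define T where "T = t0 + 1"
  obtain C where "0 \<le> C"
    and yos: "\<And>n t. T \<le> real n \<Longrightarrow> t \<in> {0..T} \<Longrightarrow> norm (yosida (l n) (snd (Z n t))) \<le> C"
    using yosida_along_flow_bounded[of T] by metis
  obtain D where CD: "0 \<le> D"
    and lip: "\<And>s t. 0 \<le> s \<Longrightarrow> s \<le> t \<Longrightarrow> t \<le> T \<Longrightarrow> norm (limit t - limit s) \<le> D * (t - s)"
    using equilipschitz[of T] by metis
  obtain d where d: "d \<longlonglongrightarrow> 0" "\<And>n t. T \<le> real n \<Longrightarrow> t \<in> {0..T} \<Longrightarrow> norm (Z n t - limit t) \<le> d n"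
    using uniform_convergence[of T] by metis
  define Q where "Q y = - inner (\<xi> + F y) (snd y - v)" for y
  have "isCont Q (limit t0)"
    unfolding Q_def by (intro continuous_intros F_continuous)
  then obtain \<rho> where \<rho>: "0 < \<rho>" "\<And>y. norm (y - limit t0) < \<rho> \<Longrightarrow> norm (Q y - Q (limit t0)) < e / 2"
    using \<open>0 < e\<close> unfolding continuous_at_eps_delta dist_norm by (metis half_gt_zero)
  define \<delta> where "\<delta> = min 1 (\<rho> / (2 * (D + 1)))"
  have \<delta>: "0 < \<delta>" "\<delta> \<le> 1" "D * \<delta> < \<rho>"
  proof -
    show "0 < \<delta>" "\<delta> \<le> 1" using \<rho> CD by (auto simp: \<delta>_def)
    have "D * \<delta> \<le> D * (\<rho> / (2 * (D + 1)))" using CD by (intro mult_left_mono) (auto simp: \<delta>_def)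
    also have "\<dots> < \<rho>"
    proof -
      have "D * \<rho> < \<rho> * (2 * (D + 1))"
        using mult_nonneg_nonneg[OF CD less_imp_le[OF \<rho>(1)]] \<rho>(1) by (simp add: algebra_simps)
      then show ?thesis using CD by (simp add: pos_divide_less_eq)
    qed
    finally show "D * \<delta> < \<rho>" .
  qed
  define \<sigma> where "\<sigma> = \<rho> - D * \<delta>"
  have \<sigma>: "0 < \<sigma>" using \<delta> by (simp add: \<sigma>_def)
  have "(\<lambda>n. l n * norm \<xi> * C) \<longlonglongrightarrow> 0 * norm \<xi> * C" by (intro tendsto_intros l_tendsto)
  then have "\<forall>\<^sub>F n in sequentially. l n * norm \<xi> * C < e / 2"
    by (rule order_tendstoD) (use \<open>0 < e\<close> in simp)
  moreover have "\<forall>\<^sub>F n in sequentially. d n < \<sigma>" by (rule order_tendstoD(2)[OF d(1) \<sigma>])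
  ultimately have "\<forall>\<^sub>F n in sequentially. l n * norm \<xi> * C < e / 2 \<and> d n < \<sigma>" by eventually_elim simp
  then obtain N where N: "\<And>n. n \<ge> N \<Longrightarrow> l n * norm \<xi> * C < e / 2 \<and> d n < \<sigma>"
    by (auto simp: eventually_sequentially)
  have "(norm (u t - v))\<^sup>2 - (norm (u s - v))\<^sup>2 \<le> 2 * (t - s) * (e + Q (limit t0))"
    if st: "0 \<le> s" "s \<le> t" "\<bar>s - t0\<bar> < \<delta>" "\<bar>t - t0\<bar> < \<delta>" for s t
  proof (rule limit_pass[OF _ tendsto_const, where T = "max T (real N)"])
    have tT: "t \<le> T" using st \<delta> by (auto simp: T_def)
    show "(\<lambda>n. (norm (snd (Z n t) - v))\<^sup>2 - (norm (snd (Z n s) - v))\<^sup>2) \<longlonglongrightarrow> (norm (u t - v))\<^sup>2 - (norm (u s - v))\<^sup>2"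
      unfolding u_def using st by (intro tendsto_intros Z_tendsto) auto
    fix n assume "max T (real N) \<le> real n"
    then have n: "T \<le> real n" "n \<ge> N" by auto
    let ?f = "\<lambda>r. - yosida (l n) (snd (Z n r)) - F (Z n r)"
    let ?q = "\<lambda>r. inner (snd (Z n r) - v) (snd (Z n r) - v)"
    have "?q t - ?q s \<le> 2 * (e + Q (limit t0)) * (t - s)"
    proof (rule increment_le_of_deriv_le[OF st(2)])
      fix r assume r: "r \<in> {s..t}"
      then have rT: "r \<in> {0..T}" using st tT by auto
      have "((\<lambda>r. snd (Z n r) - v) has_vector_derivative ?f r) (at r within {s..t})"
        using has_vector_derivative_snd[OF regularized_flow_subset[OF flow_restrict[OF n(1)] r]] st tT
        by (auto intro!: derivative_eq_intros)
      then show "(?q has_real_derivative 2 * inner (?f r) (snd (Z n r) - v)) (at r within {s..t})"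
        by (rule has_real_derivative_inner_self)
      have "norm (limit r - limit t0) \<le> D * \<bar>r - t0\<bar>"
        using lip[of r t0] lip[of t0 r] rT assms(1) by (cases "r \<le> t0") (auto simp: norm_minus_commute T_def)
      also have "\<dots> \<le> D * \<delta>" using r st CD by (intro mult_left_mono) auto
      finally have "norm (Z n r - limit t0) < \<rho>"
        using norm_triangle_ineq[of "Z n r - limit r" "limit r - limit t0"] d(2)[OF n(1) rT] N[OF n(2)]
        unfolding \<sigma>_def by simp
      from \<rho>(2)[OF this] have "Q (Z n r) < Q (limit t0) + e / 2" unfolding real_norm_def by linarith
      note Q = this
      have "inner (?f r) (snd (Z n r) - v) \<le> Q (Z n r) + l n * norm \<xi> * C"
        unfolding Q_def by (rule minty_inequality[OF n(1) rT \<open>\<xi> \<in> A v\<close> yos[OF n(1) rT]])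
      also have "\<dots> \<le> (Q (limit t0) + e / 2) + e / 2"
        using Q N[OF n(2)] by (intro add_mono) auto
      finally show "2 * inner (?f r) (snd (Z n r) - v) \<le> 2 * (e + Q (limit t0))" by simp
    qed
    then show "(norm (snd (Z n t) - v))\<^sup>2 - (norm (snd (Z n s) - v))\<^sup>2 \<le> 2 * (t - s) * (e + Q (limit t0))"
      by (simp add: power2_norm_eq_inner algebra_simps)
  qed
  then show thesis using that[OF \<delta>(1)] by (simp add: Q_def u_def)
qed

end

section \<open>Differentiability of the limit velocity\<close>

text \<open>In a Hilbert space the vector \<open>- \<zeta>\<close> is the only one of norm at most \<open>|\<zeta>|\<close> whose inner product with
  \<open>\<zeta>\<close> is at most \<open>- |\<zeta>|\<^sup>2\<close>, and this characterization is stable. It gives strong convergence of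
  difference quotients without weak compactness.\<close>

lemma tendsto_neg_by_projection:
  fixes q :: "'i \<Rightarrow> 'a::real_inner"
  assumes len: "\<And>e. 0 < e \<Longrightarrow> \<forall>\<^sub>F i in G. norm (q i) \<le> norm \<zeta> + e"
    and proj: "\<And>e. 0 < e \<Longrightarrow> \<exists>\<eta>. norm (\<eta> - \<zeta>) \<le> e \<and> (\<forall>\<^sub>F i in G. inner (q i) \<eta> \<le> e - (norm \<eta>)\<^sup>2)"
  shows "(q \<longlongrightarrow> - \<zeta>) G"
proof (rule tendstoI)
  fix E :: real assume "0 < E"
  define z where "z = norm \<zeta>"
  have z: "0 \<le> z" by (simp add: z_def)
  \<comment> \<open>the errors below add up to at most \<open>s (8 z + 5)\<close>\<close>
  define s where "s = min 1 (E\<^sup>2 / (8 * z + 6))"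
  have s: "0 < s" "s \<le> 1" using \<open>0 < E\<close> z by (auto simp: s_def)
  have "s * (8 * z + 5) < s * (8 * z + 6)" using s by simp
  also have "\<dots> \<le> E\<^sup>2 / (8 * z + 6) * (8 * z + 6)"
    using z by (intro mult_right_mono) (auto simp: s_def)
  also have "\<dots> = E\<^sup>2" using z by simp
  finally have sE: "s * (8 * z + 5) < E\<^sup>2" .
  obtain \<eta> where \<eta>: "norm (\<eta> - \<zeta>) \<le> s" and "\<forall>\<^sub>F i in G. inner (q i) \<eta> \<le> s - (norm \<eta>)\<^sup>2"
    using proj[OF s(1)] by blast
  from this(2) len[OF s(1)] show "\<forall>\<^sub>F i in G. dist (q i) (- \<zeta>) < E"
  proof eventually_elim
    case (elim i)
    let ?n = "norm (q i)"
    have "z - s \<le> norm \<eta>" using \<eta> norm_triangle_ineq2[of \<zeta> \<eta>] by (simp add: z_def norm_minus_commute)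
    have sq: "z\<^sup>2 - 2 * s * z \<le> (norm \<eta>)\<^sup>2"
    proof -
      have "(norm \<eta>)\<^sup>2 - z\<^sup>2 + 2 * s * z = (norm \<eta> - z)\<^sup>2 + 2 * z * (norm \<eta> - (z - s))"
        by (simp add: power2_eq_square algebra_simps)
      also have "\<dots> \<ge> 0" using z \<open>z - s \<le> norm \<eta>\<close> by (intro add_nonneg_nonneg mult_nonneg_nonneg) auto
      finally show ?thesis by simp
    qed
    have "inner (q i) (\<zeta> - \<eta>) \<le> ?n * norm (\<eta> - \<zeta>)"
      using norm_cauchy_schwarz[of "q i" "\<zeta> - \<eta>"] by (simp add: norm_minus_commute)
    also have "\<dots> \<le> (z + s) * s" using elim(2) \<eta> z s by (intro mult_mono) (auto simp: z_def)
    finally have a: "inner (q i) \<zeta> \<le> s - (z\<^sup>2 - 2 * s * z) + (z + s) * s"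
      using elim(1) sq by (simp add: inner_diff_right)
    have b: "?n\<^sup>2 \<le> (z + s)\<^sup>2" using elim(2) by (intro power_mono) (auto simp: z_def)
    have "(norm (q i + \<zeta>))\<^sup>2 = ?n\<^sup>2 + 2 * inner (q i) \<zeta> + z\<^sup>2"
      by (simp add: z_def power2_norm_eq_inner inner_add_left inner_add_right inner_commute)
    also have "\<dots> \<le> (z + s)\<^sup>2 + 2 * (s - (z\<^sup>2 - 2 * s * z) + (z + s) * s) + z\<^sup>2"
      by (intro add_mono mult_left_mono a b order_refl) simp
    also have "\<dots> = s * (8 * z + 2) + 3 * s * s" by (simp add: power2_eq_square algebra_simps)
    also have "\<dots> \<le> s * (8 * z + 5)" using s by (simp add: algebra_simps mult_left_le)
    also have "\<dots> < E\<^sup>2" by (rule sE)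
    finally show ?case using \<open>0 < E\<close> by (simp add: dist_norm power2_less_imp_less)
  qed
qed

lemma has_vector_derivative_of_one_sided_quotients:
  fixes f :: "real \<Rightarrow> 'a::real_normed_vector"
  assumes right: "((\<lambda>h. (f (t + h) - f t) /\<^sub>R h) \<longlongrightarrow> D) (at_right 0)"
    and left: "((\<lambda>h. (f t - f (t - h)) /\<^sub>R h) \<longlongrightarrow> D) (at_right 0)"
  shows "(f has_vector_derivative D) (at t)"
  unfolding has_vector_derivative_def has_derivative_at_alt
proof (intro conjI allI impI)
  show "bounded_linear (\<lambda>h. h *\<^sub>R D)" by (rule bounded_linear_scaleR_left)
  fix e :: real assume "0 < e"
  obtain d1 where d1: "0 < d1" "\<And>h. 0 < h \<Longrightarrow> h < d1 \<Longrightarrow> dist ((f (t + h) - f t) /\<^sub>R h) D < e"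
    using tendstoD[OF right \<open>0 < e\<close>] unfolding eventually_at_right_field by auto
  obtain d2 where d2: "0 < d2" "\<And>h. 0 < h \<Longrightarrow> h < d2 \<Longrightarrow> dist ((f t - f (t - h)) /\<^sub>R h) D < e"
    using tendstoD[OF left \<open>0 < e\<close>] unfolding eventually_at_right_field by auto
  have scale: "norm (v - h *\<^sub>R D) \<le> e * h" if "0 < h" "dist (v /\<^sub>R h) D < e" for v h
  proof -
    have "v - h *\<^sub>R D = h *\<^sub>R (v /\<^sub>R h - D)" using that by (simp add: scaleR_diff_right)
    then have "norm (v - h *\<^sub>R D) = h * norm (v /\<^sub>R h - D)"
      using that by (metis abs_of_pos norm_scaleR)
    then show ?thesis using that by (simp add: dist_norm mult.commute)
  qed
  have "norm (f y - f t - (y - t) *\<^sub>R D) \<le> e * norm (y - t)" if y: "norm (y - t) < min d1 d2" for y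
  proof (rule linorder_cases[of y t])
    assume "y < t"
    then have "norm ((f t - f y) - (t - y) *\<^sub>R D) \<le> e * (t - y)"
      using scale[of "t - y" "f t - f y"] d2(2)[of "t - y"] y by auto
    moreover have "f y - f t - (y - t) *\<^sub>R D = - ((f t - f y) - (t - y) *\<^sub>R D)" by (simp add: algebra_simps)
    ultimately show ?thesis using \<open>y < t\<close> by (simp only: norm_minus_cancel) simp
  next
    assume "t < y"
    then show ?thesis using scale[of "y - t" "f y - f t"] d1(2)[of "y - t"] y by auto
  qed simp
  then show "\<exists>d>0. \<forall>y. norm (y - t) < d \<longrightarrow> norm (f y - f t - (y - t) *\<^sub>R D) \<le> e * norm (y - t)"
    using d1(1) d2(1) by (intro exI[of _ "min d1 d2"]) auto
qed

context vanishing_regularization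
begin

text \<open>The least element of \<open>A (u t) + F\<close>, characterized by the approximants along which
  it is tested; \<open>u' = - resistance\<close> is the claim to be proved.\<close>

definition resistance :: "real \<Rightarrow> 'a" where
  "resistance t = (SOME \<zeta>. \<zeta> - F (limit t) \<in> A (u t) \<and>
     (\<forall>e>0. \<exists>l v \<eta>. 0 < l \<and> u t - v = l *\<^sub>R \<eta> \<and> \<eta> - F (limit t) \<in> A v \<and> norm (\<eta> - \<zeta>) < e))"

lemma resistance_mem: "resistance t - F (limit t) \<in> A (u t)"
  and resistance_approx: "0 < e \<Longrightarrow>
    \<exists>l v \<eta>. 0 < l \<and> u t - v = l *\<^sub>R \<eta> \<and> \<eta> - F (limit t) \<in> A v \<and> norm (\<eta> - resistance t) < e"
proof -
  have "\<exists>\<zeta>. \<zeta> - F (limit t) \<in> A (u t) \<and>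
     (\<forall>e>0. \<exists>l v \<eta>. 0 < l \<and> u t - v = l *\<^sub>R \<eta> \<and> \<eta> - F (limit t) \<in> A v \<and> norm (\<eta> - \<zeta>) < e)"
    by (rule shifted_selection[of "F (limit t)" "u t"]) blast
  from someI_ex[OF this, folded resistance_def]
  show "resistance t - F (limit t) \<in> A (u t)"
    and "0 < e \<Longrightarrow> \<exists>l v \<eta>. 0 < l \<and> u t - v = l *\<^sub>R \<eta> \<and> \<eta> - F (limit t) \<in> A v \<and> norm (\<eta> - resistance t) < e"
    by blast+
qed

lemma forward_increment_resistance:
  obtains B where "0 \<le> B" "\<And>s t. 0 \<le> s \<Longrightarrow> s \<le> t \<Longrightarrow> t \<le> T \<Longrightarrow>
       norm (u t - u s) \<le> (norm (resistance s) + B * (t - s)) * (t - s)"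
proof -
  obtain B where B: "0 \<le> B" "\<And>s t \<xi>. 0 \<le> s \<Longrightarrow> s \<le> t \<Longrightarrow> t \<le> T \<Longrightarrow> \<xi> \<in> A (u s) \<Longrightarrow>
       norm (u t - u s) \<le> (norm (\<xi> + F (limit s)) + B * (t - s)) * (t - s)"
    using forward_increment[of T] by metis
  show thesis
  proof (rule that[OF B(1)])
    show "norm (u t - u s) \<le> (norm (resistance s) + B * (t - s)) * (t - s)" if "0 \<le> s" "s \<le> t" "t \<le> T" for s t
      using B(2)[OF that resistance_mem] by simp
  qed
qed

text \<open>The norm of the quotient is controlled by \<open>forward_increment\<close>, and its component along the
  approximants \<open>\<eta>\<close> by \<open>local_minty\<close>.\<close>

lemma right_derivative:
  assumes "0 \<le> t"
  shows "((\<lambda>h. (u (t + h) - u t) /\<^sub>R h) \<longlongrightarrow> - resistance t) (at_right 0)"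
proof (rule tendsto_neg_by_projection)
  obtain B where B: "0 \<le> B" "\<And>s r. 0 \<le> s \<Longrightarrow> s \<le> r \<Longrightarrow> r \<le> t + 1 \<Longrightarrow>
       norm (u r - u s) \<le> (norm (resistance s) + B * (r - s)) * (r - s)"
    using forward_increment_resistance[of "t + 1"] by metis
  fix e :: real assume e: "0 < e"
  have "0 < min 1 (e / (B + 1))" using B e by simp
  from eventually_small[OF this]
  show "\<forall>\<^sub>F h in at_right 0. norm ((u (t + h) - u t) /\<^sub>R h) \<le> norm (resistance t) + e"
  proof eventually_elim
    case (elim h)
    have "B * h \<le> (B + 1) * (e / (B + 1))" using elim B by (intro mult_mono) auto
    also have "\<dots> = e" using B by simp
    finally have "norm (resistance t) + B * h \<le> norm (resistance t) + e" by simp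
    moreover have "norm (u (t + h) - u t) / h \<le> norm (resistance t) + B * h"
      using B(2)[of t "t + h"] elim assms by (simp add: pos_divide_le_eq)
    ultimately show ?case using elim by (simp add: divide_inverse mult.commute)
  qed
  obtain l v \<eta> where l: "0 < l" "u t - v = l *\<^sub>R \<eta>" "\<eta> - F (limit t) \<in> A v" and \<eta>: "norm (\<eta> - resistance t) < e"
    using resistance_approx[OF e] by blast
  have "0 < l * e" using l e by simp
  from local_minty[OF assms l(3) this] obtain \<delta> where \<delta>: "0 < \<delta>"
    "\<And>s r. 0 \<le> s \<Longrightarrow> s \<le> r \<Longrightarrow> \<bar>s - t\<bar> < \<delta> \<Longrightarrow> \<bar>r - t\<bar> < \<delta> \<Longrightarrow>
       (norm (u r - v))\<^sup>2 - (norm (u s - v))\<^sup>2 \<le> 2 * (r - s) * (l * e - inner (\<eta> - F (limit t) + F (limit t)) (u t - v))"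
    by metis
  from eventually_small[OF \<delta>(1)]
  have "\<forall>\<^sub>F h in at_right 0. inner ((u (t + h) - u t) /\<^sub>R h) \<eta> \<le> e - (norm \<eta>)\<^sup>2"
  proof eventually_elim
    case (elim h)
    define q where "q = (u (t + h) - u t) /\<^sub>R h"
    have uq: "u (t + h) - v = l *\<^sub>R \<eta> + h *\<^sub>R q" using elim l(2) by (simp add: q_def algebra_simps)
    have "2 * h * (l * inner q \<eta>) \<le> 2 * h * (l * inner q \<eta>) + (norm (h *\<^sub>R q))\<^sup>2" by simp
    also have "\<dots> = (norm (u (t + h) - v))\<^sup>2 - (norm (u t - v))\<^sup>2"
      unfolding uq l(2) power2_norm_eq_inner by (simp add: inner_add_left inner_add_right inner_commute algebra_simps)
    also have "\<dots> \<le> 2 * h * (l * e - l * (norm \<eta>)\<^sup>2)"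
      using \<delta>(2)[of t "t + h"] elim assms \<delta>(1) by (simp add: l(2) power2_norm_eq_inner)
    finally have "2 * h * (l * inner q \<eta>) \<le> 2 * h * (l * (e - (norm \<eta>)\<^sup>2))"
      by (simp only: right_diff_distrib)
    then show ?case using elim l(1) by (simp add: q_def[symmetric])
  qed
  then show "\<exists>\<eta>. norm (\<eta> - resistance t) \<le> e \<and> (\<forall>\<^sub>F h in at_right 0. inner ((u (t + h) - u t) /\<^sub>R h) \<eta> \<le> e - (norm \<eta>)\<^sup>2)"
    using \<eta> by (intro exI[of _ \<eta>]) auto
qed

text \<open>The component along \<open>\<eta>\<close> is controlled as for the right derivative, because \<open>local_minty\<close> is symmetric
  about its base time. The norm of the quotient is controlled by the resistance at the earlier time
  \<open>t - h\<close>, whence the continuity assumption.\<close>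

lemma left_derivative:
  assumes "0 < t" and cont: "isCont (\<lambda>s. norm (resistance s)) t"
  shows "((\<lambda>h. (u t - u (t - h)) /\<^sub>R h) \<longlongrightarrow> - resistance t) (at_right 0)"
proof (rule tendsto_neg_by_projection)
  obtain B where B: "0 \<le> B" "\<And>s r. 0 \<le> s \<Longrightarrow> s \<le> r \<Longrightarrow> r \<le> t \<Longrightarrow>
       norm (u r - u s) \<le> (norm (resistance s) + B * (r - s)) * (r - s)"
    using forward_increment_resistance[of t] by metis
  obtain D where D: "D-lipschitz_on {0..t} u" using velocity_lipschitz by blast
  fix e :: real assume e: "0 < e"
  then obtain d where d: "0 < d"
      "\<And>s. dist s t < d \<Longrightarrow> dist (norm (resistance s)) (norm (resistance t)) < e / 2"
    using cont[unfolded continuous_at_eps_delta, rule_format, of "e / 2"] by auto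
  have "0 < min (min d t) (e / (2 * (B + 1)))" using B e d \<open>0 < t\<close> by simp
  from eventually_small[OF this]
  show "\<forall>\<^sub>F h in at_right 0. norm ((u t - u (t - h)) /\<^sub>R h) \<le> norm (resistance t) + e"
  proof eventually_elim
    case (elim h)
    have "B * h \<le> (B + 1) * (e / (2 * (B + 1)))" using elim B by (intro mult_mono) auto
    also have "\<dots> = e / 2" using B by (simp add: field_simps)
    finally have "norm (resistance (t - h)) + B * h \<le> norm (resistance t) + e"
      using abs_ge_self[of "norm (resistance (t - h)) - norm (resistance t)"] d(2)[of "t - h"] elim
      by (simp add: dist_real_def)
    moreover have "norm (u t - u (t - h)) / h \<le> norm (resistance (t - h)) + B * h"
      using B(2)[of "t - h" t] elim by (simp add: pos_divide_le_eq)
    ultimately show ?case using elim by (simp add: divide_inverse mult.commute)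
  qed
  obtain l v \<eta> where l: "0 < l" "u t - v = l *\<^sub>R \<eta>" "\<eta> - F (limit t) \<in> A v" and \<eta>: "norm (\<eta> - resistance t) < e"
    using resistance_approx[OF e] by blast
  have "0 < l * (e / 2)" using l e by simp
  from local_minty[OF less_imp_le[OF \<open>0 < t\<close>] l(3) this] obtain \<delta> where \<delta>: "0 < \<delta>"
    "\<And>s r. 0 \<le> s \<Longrightarrow> s \<le> r \<Longrightarrow> \<bar>s - t\<bar> < \<delta> \<Longrightarrow> \<bar>r - t\<bar> < \<delta> \<Longrightarrow>
       (norm (u r - v))\<^sup>2 - (norm (u s - v))\<^sup>2 \<le> 2 * (r - s) * (l * (e / 2) - inner (\<eta> - F (limit t) + F (limit t)) (u t - v))"
    by metis
  have "0 < min (min \<delta> t) (l * e / (D\<^sup>2 + 1))" using \<delta>(1) assms(1) l e by (simp add: add_nonneg_pos)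
  from eventually_small[OF this]
  have "\<forall>\<^sub>F h in at_right 0. inner ((u t - u (t - h)) /\<^sub>R h) \<eta> \<le> e - (norm \<eta>)\<^sup>2"
  proof eventually_elim
    case (elim h)
    define q where "q = (u t - u (t - h)) /\<^sub>R h"
    have uq: "u (t - h) - v = l *\<^sub>R \<eta> - h *\<^sub>R q" using elim l(2) by (simp add: q_def algebra_simps)
    have "norm q \<le> D"
      using lipschitz_on_normD[OF D, of t "t - h"] elim
      by (simp add: q_def divide_inverse[symmetric] pos_divide_le_eq mult.commute[of "inverse h"])
    then have "h * (norm q)\<^sup>2 \<le> h * (D\<^sup>2 + 1)" using elim by (intro mult_left_mono) (auto intro: order_trans[OF power_mono])
    also have "\<dots> \<le> l * e"
    proof -
      have "h * (D\<^sup>2 + 1) \<le> l * e / (D\<^sup>2 + 1) * (D\<^sup>2 + 1)" using elim by (intro mult_right_mono) auto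
      also have "\<dots> = l * e" by (simp add: add_nonneg_eq_0_iff)
      finally show ?thesis .
    qed
    finally have q: "h * (h * (norm q)\<^sup>2) \<le> h * (l * e)" using elim by (intro mult_left_mono) auto
    have "(norm (u t - v))\<^sup>2 - (norm (u (t - h) - v))\<^sup>2 \<le> 2 * h * (l * (e / 2) - l * (norm \<eta>)\<^sup>2)"
      using \<delta>(2)[of "t - h" t] elim assms \<delta>(1) by (simp add: l(2) power2_norm_eq_inner)
    moreover have "(norm (u t - v))\<^sup>2 - (norm (u (t - h) - v))\<^sup>2 = 2 * h * (l * inner q \<eta>) - h * (h * (norm q)\<^sup>2)"
      unfolding uq l(2) power2_norm_eq_inner
      by (simp add: inner_diff_left inner_diff_right inner_commute algebra_simps)
    ultimately have "2 * h * (l * inner q \<eta>) \<le> 2 * h * (l * (e / 2) - l * (norm \<eta>)\<^sup>2) + h * (l * e)"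
      using q by linarith
    also have "\<dots> = 2 * h * (l * (e - (norm \<eta>)\<^sup>2))" by (simp add: algebra_simps)
    finally show ?case using elim l(1) by (simp add: q_def[symmetric])
  qed
  then show "\<exists>\<eta>. norm (\<eta> - resistance t) \<le> e \<and> (\<forall>\<^sub>F h in at_right 0. inner ((u t - u (t - h)) /\<^sub>R h) \<eta> \<le> e - (norm \<eta>)\<^sup>2)"
    using \<eta> by (intro exI[of _ \<eta>]) auto
qed

lemma resistance_almost_decreasing:
  obtains B where "\<And>s t. 0 \<le> s \<Longrightarrow> s \<le> t \<Longrightarrow> t < T \<Longrightarrow>
    norm (resistance t) \<le> norm (resistance s) + B * (t - s)"
proof -
  obtain B where B: "0 \<le> B"
    "\<And>s t h. 0 \<le> s \<Longrightarrow> s \<le> t \<Longrightarrow> 0 \<le> h \<Longrightarrow> t + h \<le> T \<Longrightarrow>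
       norm (u (t + h) - u t) \<le> norm (u (s + h) - u s) + B * h * (t - s)"
    using increments_almost_decrease[of T] by metis
  have "norm (- resistance t) \<le> norm (- resistance s) + B * (t - s)" if st: "0 \<le> s" "s \<le> t" "t < T" for s t
  proof (rule tendsto_le)
    show "((\<lambda>h. norm ((u (t + h) - u t) /\<^sub>R h)) \<longlongrightarrow> norm (- resistance t)) (at_right 0)"
      using st by (intro tendsto_norm right_derivative) auto
    show "((\<lambda>h. norm ((u (s + h) - u s) /\<^sub>R h) + B * (t - s)) \<longlongrightarrow> norm (- resistance s) + B * (t - s)) (at_right 0)"
      using st by (intro tendsto_intros right_derivative) auto
    have "0 < T - t" using st by simp
    from eventually_small[OF this]
    show "\<forall>\<^sub>F h in at_right 0. norm ((u (t + h) - u t) /\<^sub>R h) \<le> norm ((u (s + h) - u s) /\<^sub>R h) + B * (t - s)"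
    proof eventually_elim
      case (elim h)
      then have "norm (u (t + h) - u t) \<le> norm (u (s + h) - u s) + B * h * (t - s)"
        using B(2)[of s t h] st by simp
      then have "norm (u (t + h) - u t) / h \<le> (norm (u (s + h) - u s) + B * h * (t - s)) / h"
        using elim by (intro divide_right_mono) auto
      also have "\<dots> = norm (u (s + h) - u s) / h + B * (t - s)"
        using elim by (simp add: add_divide_distrib)
      finally show ?case using elim by (simp add: divide_inverse mult.commute[of "inverse h"])
    qed
  qed simp
  then show thesis using that[of B] by simp
qed

text \<open>Up to a linear term the norm of the resistance is monotone. This replaces a theorem of Rademacher
  type for functions with values in a Hilbert space.\<close>

lemma resistance_continuous_off_countable:
  "countable {t. 0 < t \<and> \<not> isCont (\<lambda>s. norm (resistance s)) t}"
proof -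
  have "countable {t \<in> {0<..<real n}. \<not> isCont (\<lambda>s. norm (resistance s)) t}" for n
  proof -
    obtain B where B: "\<And>s t. 0 \<le> s \<Longrightarrow> s \<le> t \<Longrightarrow> t < real n \<Longrightarrow>
      norm (resistance t) \<le> norm (resistance s) + B * (t - s)"
      using resistance_almost_decreasing[of "real n"] by metis
    let ?m = "\<lambda>t. B * t - norm (resistance t)"
    have "mono_on {0<..<real n} ?m"
    proof (rule mono_onI)
      fix r s assume "r \<in> {0<..<real n}" "s \<in> {0<..<real n}" "r \<le> s"
      then show "?m r \<le> ?m s" using B[of r s] by (simp add: right_diff_distrib)
    qed
    then have "countable {t \<in> {0<..<real n}. \<not> isCont ?m t}"
      by (intro mono_on_ctble_discont_open) auto
    moreover have "isCont (\<lambda>s. norm (resistance s)) t" if "isCont ?m t" for t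
      using continuous_diff[OF _ that, of "\<lambda>t. B * t"] by (simp add: continuous_intros)
    ultimately show ?thesis by (rule_tac countable_subset) auto
  qed
  then have "countable (\<Union>n. {t \<in> {0<..<real n}. \<not> isCont (\<lambda>s. norm (resistance s)) t})" by simp
  moreover have "{t. 0 < t \<and> \<not> isCont (\<lambda>s. norm (resistance s)) t}
    \<subseteq> (\<Union>n. {t \<in> {0<..<real n}. \<not> isCont (\<lambda>s. norm (resistance s)) t})"
    using reals_Archimedean2 by fastforce
  ultimately show ?thesis by (rule countable_subset[rotated])
qed

lemma velocity_derivative:
  assumes "0 < t" "isCont (\<lambda>s. norm (resistance s)) t"
  shows "(u has_vector_derivative - resistance t) (at t)"
  using assms
  by (intro has_vector_derivative_of_one_sided_quotients right_derivative left_derivative) auto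

end

text \<open>The exceptional set is explicit, which avoids handling almost everywhere statements in the
  uniqueness proof.\<close>

definition trajectory :: "('a::real_inner \<Rightarrow> 'a set) \<Rightarrow> ('a \<times> 'a \<Rightarrow> 'a) \<Rightarrow> (real \<Rightarrow> 'a) \<Rightarrow> (real \<Rightarrow> 'a) \<Rightarrow> real set \<Rightarrow> bool" where
  "trajectory A F x u N \<longleftrightarrow>
     (\<forall>t\<ge>0. (x has_vector_derivative u t) (at t within {0..})) \<and>
     (\<forall>T. \<exists>L. L-lipschitz_on {0..T} u) \<and> negligible N \<and>
     (\<forall>t>0. t \<notin> N \<longrightarrow> (\<exists>\<xi>\<in>A (u t). (u has_vector_derivative (- \<xi> - F (x t, u t))) (at t)))"

context damped_system
begin

theorem trajectory_exists:
  obtains x u N where "x 0 = x0" "u 0 = u0" "trajectory A F x u N"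
proof -
  have "\<exists>z. z 0 = (x0, u0) \<and> regularized_flow (1 / (real n + 1)) (real n) z" for n
    by (rule regularized_flow_exists[of "1 / (real n + 1)" "real n" "(x0, u0)"]) auto
  then obtain Z where Z: "\<And>n. Z n 0 = (x0, u0)" "\<And>n. regularized_flow (1 / (real n + 1)) (real n) (Z n)"
    by metis
  interpret vanishing_regularization A F V grad V_min Z "(x0, u0)"
    by unfold_locales (use Z in auto)
  let ?N = "{t. 0 < t \<and> \<not> isCont (\<lambda>s. norm (resistance s)) t}"
  have "\<exists>\<xi>\<in>A (u t). (u has_vector_derivative (- \<xi> - F (x t, u t))) (at t)" if "0 < t" "t \<notin> ?N" for t
    using resistance_mem[of t] velocity_derivative[of t] that
    by (intro bexI[of _ "resistance t - F (limit t)"]) (auto simp: x_def u_def)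
  moreover have "\<exists>L. L-lipschitz_on {0..T} u" for T using velocity_lipschitz by blast
  ultimately have "trajectory A F x u ?N"
    unfolding trajectory_def
    using position_has_velocity countable_imp_null_set_lborel[OF resistance_continuous_off_countable]
    by (auto simp: negligible_iff_null_sets null_sets_completionI)
  then show thesis using limit_initial by (intro that) (auto simp: x_def u_def)
qed

end

section \<open>Uniqueness\<close>

context damped_system
begin

text \<open>Gronwall's inequality for the squared distance in phase space, which is Lipschitz in time: the
  elements of \<open>A\<close> contribute with the good sign, and \<open>F\<close> is Lipschitz on the bounded set that both
  trajectories visit.\<close>

lemma trajectory_unique:
  assumes X: "trajectory A F x u N" and Y: "trajectory A F y v M"
    and init: "x 0 = y 0" "u 0 = v 0" and "0 \<le> t"
  shows "x t = y t"
proof -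
  define T where "T = max t 1"
  have T: "0 < T" "t \<in> {0..T}" using \<open>0 \<le> t\<close> by (auto simp: T_def)
  have phase: "\<exists>B D. D-lipschitz_on {0..T} (\<lambda>t. (x t, u t)) \<and> (\<forall>t\<in>{0..T}. norm (x t, u t) \<le> B)"
    if tr: "trajectory A F x u N" for x u N
  proof -
    from tr obtain L where L: "L-lipschitz_on {0..T} u" unfolding trajectory_def by blast
    from L have L0: "0 \<le> L" by (rule lipschitz_on_nonneg)
    have ub: "norm (u t) \<le> norm (u 0) + L * T" if "t \<in> {0..T}" for t
    proof -
      have "norm (u t - u 0) \<le> L * norm (t - 0)" using that by (intro lipschitz_on_normD[OF L]) auto
      also have "\<dots> \<le> L * T" using that L0 by (auto intro: mult_left_mono)
      finally show ?thesis using norm_triangle_sub[of "u t" "u 0"] by linarith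
    qed
    have "(norm (u 0) + L * T)-lipschitz_on {0..T} x"
    proof (rule bounded_derivative_imp_lipschitz)
      fix t assume t: "t \<in> {0..T}"
      with tr have "(x has_vector_derivative u t) (at t within {0..})" unfolding trajectory_def by auto
      then have "(x has_vector_derivative u t) (at t within {0..T})"
        by (rule has_vector_derivative_within_subset) auto
      then show "(x has_derivative (\<lambda>h. h *\<^sub>R u t)) (at t within {0..T})"
        by (simp add: has_vector_derivative_def)
      have "onorm (\<lambda>h. h *\<^sub>R u t) \<le> norm (u t)"
        by (rule onorm_le) (simp add: mult.commute)
      then show "onorm (\<lambda>h. h *\<^sub>R u t) \<le> norm (u 0) + L * T" using ub[OF t] by linarith
    qed (use L0 T in auto)
    from lipschitz_on_Pair[OF this L] obtain D where D: "D-lipschitz_on {0..T} (\<lambda>t. (x t, u t))" by blast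
    then have "compact ((\<lambda>t. (x t, u t)) ` {0..T})"
      by (intro compact_continuous_image lipschitz_on_continuous_on) auto
    then obtain B where "\<forall>t\<in>{0..T}. norm (x t, u t) \<le> B"
      by (auto dest!: compact_imp_bounded simp: bounded_iff)
    with D show ?thesis by blast
  qed
  obtain Bx Dx where x: "Dx-lipschitz_on {0..T} (\<lambda>t. (x t, u t))" "\<forall>t\<in>{0..T}. norm (x t, u t) \<le> Bx"
    using phase[OF X] by blast
  obtain By Dy where y: "Dy-lipschitz_on {0..T} (\<lambda>t. (y t, v t))" "\<forall>t\<in>{0..T}. norm (y t, v t) \<le> By"
    using phase[OF Y] by blast
  obtain L where L: "L-lipschitz_on (cball 0 (max Bx By)) F" using F_lipschitz by blast
  have L0: "0 \<le> L" using L by (rule lipschitz_on_nonneg)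
  define W where "W t = (x t, u t) - (y t, v t)" for t
  define e where "e t = inner (W t) (W t)" for t
  have WL: "(Dx + Dy)-lipschitz_on {0..T} W" unfolding W_def by (intro lipschitz_on_diff x y)
  have Wb: "norm (W t) \<le> Bx + By" if "t \<in> {0..T}" for t
    unfolding W_def using x(2) y(2) that by (intro norm_triangle_le_diff add_mono) auto
  have B0: "0 \<le> Bx + By" using Wb[OF T(2)] norm_ge_zero order_trans by blast
  have eL: "(2 * (Bx + By) * (Dx + Dy))-lipschitz_on {0..T} e"
  proof (rule lipschitz_onI)
    fix s r assume sr: "s \<in> {0..T}" "r \<in> {0..T}"
    have "e s - e r = inner (W s + W r) (W s - W r)"
      by (simp add: e_def inner_add_left inner_diff_right inner_commute[of "W r" "W s"])
    then have "\<bar>e s - e r\<bar> \<le> norm (W s + W r) * norm (W s - W r)"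
      by (simp add: Cauchy_Schwarz_ineq2)
    also have "\<dots> \<le> (2 * (Bx + By)) * ((Dx + Dy) * norm (s - r))"
    proof (intro mult_mono lipschitz_on_normD[OF WL] sr)
      show "norm (W s + W r) \<le> 2 * (Bx + By)"
        using Wb[OF sr(1)] Wb[OF sr(2)] by (intro norm_triangle_le) simp
    qed (use B0 in auto)
    finally show "dist (e s) (e r) \<le> 2 * (Bx + By) * (Dx + Dy) * dist s r"
      by (simp add: dist_real_def mult.assoc)
  qed (use B0 lipschitz_on_nonneg[OF WL] in auto)
  have "e t \<le> exp ((1 + 2 * L) * (t - 0)) * e 0"
  proof (rule gronwall_lipschitz)
    show "(2 * (Bx + By) * (Dx + Dy))-lipschitz_on {0..t} e"
      using eL by (rule lipschitz_on_subset) (use T in auto)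
    show "negligible (N \<union> M)" using X Y unfolding trajectory_def by auto
    fix s assume s: "s \<in> {0<..<t} - (N \<union> M)"
    then have sT: "s \<in> {0..T}" using T by auto
    from X s obtain \<xi> where \<xi>: "\<xi> \<in> A (u s)" "(u has_vector_derivative (- \<xi> - F (x s, u s))) (at s)"
      unfolding trajectory_def by auto
    from Y s obtain \<eta> where \<eta>: "\<eta> \<in> A (v s)" "(v has_vector_derivative (- \<eta> - F (y s, v s))) (at s)"
      unfolding trajectory_def by auto
    have nhd: "at s within {0..} = at s" using s by (intro at_within_interior) (auto simp: interior_Ici)
    have xy: "(x has_vector_derivative u s) (at s)" "(y has_vector_derivative v s) (at s)"
      using X Y s unfolding trajectory_def nhd[symmetric] by auto
    let ?dF = "F (x s, u s) - F (y s, v s)"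
    have "(W has_vector_derivative ((u s, - \<xi> - F (x s, u s)) - (v s, - \<eta> - F (y s, v s)))) (at s)"
      unfolding W_def by (intro has_vector_derivative_diff has_vector_derivative_Pair xy \<xi> \<eta>)
    from has_real_derivative_inner_self[OF this]
    have der: "(e has_real_derivative
        2 * inner ((u s, - \<xi> - F (x s, u s)) - (v s, - \<eta> - F (y s, v s))) (W s)) (at s)"
      by (simp add: e_def[abs_def])
    let ?dx = "x s - y s" and ?du = "u s - v s"
    have W: "W s = (?dx, ?du)" by (simp add: W_def)
    have "inner ((u s, - \<xi> - F (x s, u s)) - (v s, - \<eta> - F (y s, v s))) (W s)
       = inner ?du ?dx - inner (\<xi> - \<eta>) ?du - inner ?dF ?du"
      unfolding W by (simp add: inner_diff_left)
    moreover have "0 \<le> inner (\<xi> - \<eta>) ?du" by (rule monotone[OF \<xi>(1) \<eta>(1)])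
    moreover have "2 * inner ?du ?dx \<le> e s"
      using inner_ge_zero[of "?dx - ?du"]
      by (simp add: e_def W inner_diff_left inner_diff_right inner_commute)
    moreover have "- inner ?dF ?du \<le> L * e s"
    proof -
      have "- inner ?dF ?du \<le> norm ?dF * norm ?du"
        using Cauchy_Schwarz_ineq2[of ?dF ?du] by linarith
      also have "\<dots> \<le> (L * norm (W s)) * norm (W s)"
      proof (rule mult_mono)
        show "norm ?dF \<le> L * norm (W s)"
          unfolding W_def using x(2) y(2) sT by (intro lipschitz_on_normD[OF L]) force+
        show "norm ?du \<le> norm (W s)" unfolding W by (rule norm_snd_le)
      qed (use L0 in auto)
      also have "\<dots> = L * e s" by (simp add: e_def power2_norm_eq_inner[symmetric] power2_eq_square)
      finally show ?thesis .
    qed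
    ultimately have "2 * inner ((u s, - \<xi> - F (x s, u s)) - (v s, - \<eta> - F (y s, v s))) (W s)
      \<le> (1 + 2 * L) * e s" by (simp add: distrib_right)
    with der show "\<exists>D\<le>(1 + 2 * L) * e s. (e has_real_derivative D) (at s)" by blast
  qed (use L0 \<open>0 \<le> t\<close> in auto)
  moreover have "e 0 = 0" by (simp add: e_def W_def init)
  ultimately have "inner (W t) (W t) \<le> 0" by (simp add: e_def)
  then have "W t = 0" by (metis inner_eq_zero_iff inner_ge_zero antisym)
  then show ?thesis by (simp add: W_def zero_prod_def)
qed

end

section \<open>Almost everywhere statements and strong measurability\<close>

lemma AE_lebesgue_on_iff_negligible:
  assumes "S \<in> sets lebesgue"
  shows "(AE t in lebesgue_on S. P t) \<longleftrightarrow> (\<exists>N. negligible N \<and> (\<forall>t\<in>S - N. P (t::real)))"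
proof
  assume "AE t in lebesgue_on S. P t"
  then have "AE t in lebesgue. t \<in> S \<longrightarrow> P t" using assms by (simp add: AE_restrict_space_iff)
  then obtain N where "N \<in> null_sets lebesgue" "{t \<in> space lebesgue. \<not> (t \<in> S \<longrightarrow> P t)} \<subseteq> N"
    by (auto simp: eventually_ae_filter)
  then show "\<exists>N. negligible N \<and> (\<forall>t\<in>S - N. P t)"
    by (intro exI[of _ N]) (auto simp: negligible_iff_null_sets)
next
  assume "\<exists>N. negligible N \<and> (\<forall>t\<in>S - N. P t)"
  then obtain N where "N \<in> null_sets lebesgue" "\<forall>t\<in>S - N. P t" by (auto simp: negligible_iff_null_sets)
  then have "AE t in lebesgue. t \<in> S \<longrightarrow> P t" by (intro AE_I'[of N]) auto
  then show "AE t in lebesgue_on S. P t" using assms by (simp add: AE_restrict_space_iff)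
qed

lemma difference_quotients_tendsto:
  fixes u :: "real \<Rightarrow> 'a::real_normed_vector"
  assumes "(u has_vector_derivative a) (at t)"
  shows "(\<lambda>n. (real n + 1) *\<^sub>R (u (t + 1 / (real n + 1)) - u t)) \<longlonglongrightarrow> a"
proof -
  have "((\<lambda>h. norm (u (t + h) - u t - h *\<^sub>R a) / norm h) \<longlongrightarrow> 0) (at 0)"
    using assms by (simp add: has_vector_derivative_def has_derivative_at)
  moreover have "filterlim (\<lambda>n. 1 / (real n + 1)) (at 0) sequentially"
    by (intro filterlim_atI) (real_asymp, simp)
  ultimately have *: "((\<lambda>n. norm (u (t + 1 / (real n + 1)) - u t - (1 / (real n + 1)) *\<^sub>R a) / norm (1 / (real n + 1))) \<longlongrightarrow> 0) sequentially"
    by (rule filterlim_compose)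
  have "norm (u (t + 1 / (real n + 1)) - u t - (1 / (real n + 1)) *\<^sub>R a) / norm (1 / (real n + 1))
     = norm ((real n + 1) *\<^sub>R (u (t + 1 / (real n + 1)) - u t) - a)" for n
  proof -
    have "(real n + 1) *\<^sub>R (u (t + 1 / (real n + 1)) - u t) - a
      = (real n + 1) *\<^sub>R (u (t + 1 / (real n + 1)) - u t - (1 / (real n + 1)) *\<^sub>R a)"
      by (simp add: scaleR_diff_right)
    then show ?thesis by (simp add: mult.commute)
  qed
  with * show ?thesis by (simp add: tendsto_norm_zero_iff LIM_zero_iff)
qed

lemma simple_function_floor:
  assumes "0 < c"
  shows "simple_function (lebesgue_on {0<..<T}) (\<lambda>t::real. \<lfloor>c * t\<rfloor>)"
  unfolding simple_function_def
proof
  have "(\<lambda>t. \<lfloor>c * t\<rfloor>) ` space (lebesgue_on {0<..<T}) \<subseteq> {0..\<lfloor>c * T\<rfloor>}"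
    using assms by (auto intro!: floor_mono mult_left_mono)
  then show "finite ((\<lambda>t. \<lfloor>c * t\<rfloor>) ` space (lebesgue_on {0<..<T}))"
    by (rule finite_subset) simp
  show "\<forall>k\<in>(\<lambda>t. \<lfloor>c * t\<rfloor>) ` space (lebesgue_on {0<..<T}).
      (\<lambda>t. \<lfloor>c * t\<rfloor>) -` {k} \<inter> space (lebesgue_on {0<..<T}) \<in> sets (lebesgue_on {0<..<T})"
  proof
    fix k
    have "(\<lambda>t. \<lfloor>c * t\<rfloor>) -` {k} = {of_int k / c..<(of_int k + 1) / c}"
      using assms by (auto simp: floor_eq_iff field_simps) linarith
    then show "(\<lambda>t. \<lfloor>c * t\<rfloor>) -` {k} \<inter> space (lebesgue_on {0<..<T}) \<in> sets (lebesgue_on {0<..<T})"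
      by (simp add: sets_restrict_space_iff Int_commute)
  qed
qed

text \<open>Difference quotients with step \<open>1 / p\<close> converge to the derivative. Sampling them on the grid of
  width \<open>1 / p\<^sup>2\<close> makes them simple functions, at the price of an error of \<open>2 L / p\<close>, which is small
  because the grid is finer than the step.\<close>

lemma derivative_of_lipschitz_in_Linfty:
  fixes u a :: "real \<Rightarrow> 'a::real_normed_vector"
  assumes "0 < T" and L: "L-lipschitz_on {0..T + 1} u" and N: "negligible N"
    and der: "\<And>t. t \<in> {0<..<T} - N \<Longrightarrow> (u has_vector_derivative a t) (at t)"
  shows "in_Linfty (lebesgue_on {0<..<T}) a"
proof -
  define p where "p n = real n + 1" for n
  have p: "0 < p n" "1 \<le> p n" "p n \<noteq> 0" for n by (auto simp: p_def)
  define q where "q n t = p n *\<^sub>R (u (t + 1 / p n) - u t)" for n t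
  define s where "s n t = q n (of_int \<lfloor>(p n)\<^sup>2 * t\<rfloor> / (p n)\<^sup>2)" for n t
  have L0: "0 \<le> L" using L by (rule lipschitz_on_nonneg)
  have q_lim: "(\<lambda>n. q n t) \<longlonglongrightarrow> a t" if "t \<in> {0<..<T} - N" for t
    using difference_quotients_tendsto[OF der[OF that]] by (simp add: q_def p_def)
  have q_bound: "norm (q n t) \<le> L" if "t \<in> {0<..<T}" for n t
  proof -
    have "norm (u (t + 1 / p n) - u t) \<le> L * norm ((t + 1 / p n) - t)"
      using that p[of n] by (intro lipschitz_on_normD[OF L]) (auto intro!: add_mono)
    then have "p n * norm (u (t + 1 / p n) - u t) \<le> p n * (L * (1 / p n))"
      using p[of n] by (intro mult_left_mono) auto
    then show ?thesis using p[of n] by (simp add: q_def)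
  qed
  have s_close: "norm (s n t - q n t) \<le> 2 * L / p n" if t: "t \<in> {0<..<T}" for n t
  proof -
    define \<tau> where "\<tau> = of_int \<lfloor>(p n)\<^sup>2 * t\<rfloor> / (p n)\<^sup>2"
    have p2: "0 < (p n)\<^sup>2" using p by simp
    have \<tau>t: "\<tau> \<le> t" using p2 by (simp add: \<tau>_def pos_divide_le_eq mult.commute)
    have "(p n)\<^sup>2 * t \<le> of_int \<lfloor>(p n)\<^sup>2 * t\<rfloor> + 1" by linarith
    also have "\<dots> = (p n)\<^sup>2 * (\<tau> + 1 / (p n)\<^sup>2)"
      unfolding \<tau>_def add_divide_distrib[symmetric] using p[of n] by simp
    finally have \<tau>: "t - \<tau> \<le> 1 / (p n)\<^sup>2" using p2 by simp
    have \<tau>0: "0 \<le> \<tau>" using t by (simp add: \<tau>_def)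
    have le1: "1 / p n \<le> 1" using p[of n] by simp
    have 1: "norm (u (\<tau> + 1 / p n) - u (t + 1 / p n)) \<le> L * norm ((\<tau> + 1 / p n) - (t + 1 / p n))"
      using t \<tau>t \<tau>0 le1 p[of n] by (intro lipschitz_on_normD[OF L]) (auto intro!: add_mono)
    have 2: "norm (u \<tau> - u t) \<le> L * norm (\<tau> - t)"
      using t \<tau>t \<tau>0 by (intro lipschitz_on_normD[OF L]) auto
    have "s n t = q n \<tau>" by (simp only: s_def \<tau>_def)
    then have "s n t - q n t = p n *\<^sub>R ((u (\<tau> + 1 / p n) - u (t + 1 / p n)) - (u \<tau> - u t))"
      by (simp add: q_def algebra_simps)
    then have "norm (s n t - q n t) = p n * norm ((u (\<tau> + 1 / p n) - u (t + 1 / p n)) - (u \<tau> - u t))"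
      using p[of n] by simp
    also have "\<dots> \<le> p n * (2 * (L * (t - \<tau>)))"
    proof (rule mult_left_mono)
      show "norm ((u (\<tau> + 1 / p n) - u (t + 1 / p n)) - (u \<tau> - u t)) \<le> 2 * (L * (t - \<tau>))"
        using norm_triangle_ineq4[of "u (\<tau> + 1 / p n) - u (t + 1 / p n)" "u \<tau> - u t"] 1 2 \<tau>t by simp
    qed (use p[of n] in simp)
    also have "\<dots> \<le> p n * (2 * (L * (1 / (p n)\<^sup>2)))"
      using p[of n] L0 \<tau> by (intro mult_left_mono) auto
    also have "\<dots> = 2 * L / p n" using p[of n] by (simp add: power2_eq_square)
    finally show ?thesis .
  qed
  have S: "{0<..<T} \<in> sets lebesgue" by simp
  have "simple_function (lebesgue_on {0<..<T}) (s n)" for n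
    unfolding s_def using p[of n] by (intro simple_function_compose1[OF simple_function_floor]) simp
  moreover have "(\<lambda>n. s n t) \<longlonglongrightarrow> a t" if t: "t \<in> {0<..<T} - N" for t
  proof -
    have "(\<lambda>n. 2 * L / p n) \<longlonglongrightarrow> 0" unfolding p_def by real_asymp
    then have "(\<lambda>n. s n t - q n t) \<longlonglongrightarrow> 0"
      by (rule Lim_null_comparison[rotated]) (use s_close t in auto)
    from tendsto_add[OF this q_lim[OF t]] show ?thesis by simp
  qed
  then have "AE t in lebesgue_on {0<..<T}. (\<lambda>n. s n t) \<longlonglongrightarrow> a t"
    using N unfolding AE_lebesgue_on_iff_negligible[OF S] by blast
  moreover have "norm (a t) \<le> L" if "t \<in> {0<..<T} - N" for t
    by (rule LIMSEQ_le_const2[OF tendsto_norm[OF q_lim[OF that]]]) (use q_bound that in auto)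
  then have "AE t in lebesgue_on {0<..<T}. norm (a t) \<le> L"
    using N unfolding AE_lebesgue_on_iff_negligible[OF S] by blast
  ultimately show ?thesis unfolding in_Linfty_def strongly_measurable_def by blast
qed

section \<open>Subdifferentials of damping potentials\<close>

lemma subdifferentialD: "\<xi> \<in> subdifferential \<phi> u \<Longrightarrow> \<phi> u + inner \<xi> (v - u) \<le> \<phi> v"
  by (simp add: subdifferential_def)

lemma subdifferential_monotone:
  assumes "\<xi> \<in> subdifferential \<phi> u" "\<eta> \<in> subdifferential \<phi> v"
  shows "0 \<le> inner (\<xi> - \<eta>) (u - v)"
  using subdifferentialD[OF assms(1), of v] subdifferentialD[OF assms(2), of u]
  by (simp add: inner_diff_left inner_diff_right)

lemma subdifferential_minimizer:
  assumes "\<And>w. \<phi> v \<le> \<phi> w" shows "0 \<in> subdifferential \<phi> v"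
  using assms by (simp add: subdifferential_def)

lemma norm_midpoint_identity:
  fixes a b u :: "'a::real_inner"
  shows "(norm (a - b))\<^sup>2 = 2 * (norm (a - u))\<^sup>2 + 2 * (norm (b - u))\<^sup>2 - 4 * (norm ((1/2) *\<^sub>R a + (1/2) *\<^sub>R b - u))\<^sup>2"
proof -
  have "2 *\<^sub>R ((1/2) *\<^sub>R a + (1/2) *\<^sub>R b - u) = (a - u) + (b - u)" by (simp add: algebra_simps scaleR_2)
  then have "4 * (norm ((1/2) *\<^sub>R a + (1/2) *\<^sub>R b - u))\<^sup>2 = (norm ((a - u) + (b - u)))\<^sup>2"
    by (metis abs_numeral norm_scaleR power_mult_distrib numeral_Bit0 power2_eq_square numeral_times_numeral mult_2 numeral_plus_numeral numeral_code(2))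
  moreover have "(norm (a - b))\<^sup>2 + (norm ((a - u) + (b - u)))\<^sup>2 = 2 * (norm (a - u))\<^sup>2 + 2 * (norm (b - u))\<^sup>2"
    unfolding power2_norm_eq_inner
    by (simp add: inner_add_left inner_add_right inner_diff_left inner_diff_right inner_commute)
  ultimately show ?thesis by simp
qed

text \<open>The point \<open>v\<close> minimizes \<open>\<phi> v + |v - u|\<^sup>2 / (2 l)\<close>. Minimizing sequences are Cauchy by the parallelogram
  identity applied to midpoints, and the first order condition along segments is the subgradient
  inequality.\<close>

lemma proximal_point_exists:
  fixes \<phi> :: "'a::{real_inner, complete_space} \<Rightarrow> real"
  assumes convex: "convex_on UNIV \<phi>" and cont: "continuous_on UNIV \<phi>"
    and nonneg: "\<And>u. 0 \<le> \<phi> u" and l: "0 < l"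
  shows "\<exists>v. (u - v) /\<^sub>R l \<in> subdifferential \<phi> v"
proof -
  \<comment> \<open>the functional to be minimized, times \<open>2 l\<close>\<close>
  define \<psi> where "\<psi> v = 2 * l * \<phi> v + (norm (v - u))\<^sup>2" for v
  have \<psi>0: "0 \<le> \<psi> v" for v using nonneg l by (simp add: \<psi>_def)
  have bdd: "bdd_below (range \<psi>)" using \<psi>0 by (auto intro: bdd_belowI[of _ 0])
  define I where "I = Inf (range \<psi>)"
  have I: "I \<le> \<psi> v" for v unfolding I_def by (rule cInf_lower[OF _ bdd]) auto
  have "\<exists>v. \<psi> v < I + 1 / (real n + 1)" for n
    using cInf_lessD[of "range \<psi>" "I + 1 / (real n + 1)"] unfolding I_def by auto
  then obtain V where V: "\<And>n. \<psi> (V n) < I + 1 / (real n + 1)" by metis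
  have gap: "(norm (V m - V n))\<^sup>2 \<le> 2 * (1 / (real m + 1)) + 2 * (1 / (real n + 1))" for m n
  proof -
    let ?c = "(1/2) *\<^sub>R V m + (1/2) *\<^sub>R V n"
    have "\<phi> ?c \<le> (1/2) * \<phi> (V m) + (1/2) * \<phi> (V n)"
      using convex_onD[OF convex, of "1/2" "V m" "V n"] by simp
    then have "2 * l * \<phi> ?c \<le> 2 * l * ((1/2) * \<phi> (V m) + (1/2) * \<phi> (V n))"
      using l by (intro mult_left_mono) auto
    also have "\<dots> = l * \<phi> (V m) + l * \<phi> (V n)" by (simp add: algebra_simps)
    finally have "2 * l * \<phi> ?c \<le> l * \<phi> (V m) + l * \<phi> (V n)" .
    then have "(norm (V m - V n))\<^sup>2 \<le> 2 * \<psi> (V m) + 2 * \<psi> (V n) - 4 * \<psi> ?c"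
      unfolding norm_midpoint_identity[of "V m" "V n" u] \<psi>_def by (simp add: algebra_simps)
    then show ?thesis using V[of m] V[of n] I[of ?c] by linarith
  qed
  have "Cauchy V"
  proof (rule CauchyI)
    fix e :: real assume "0 < e"
    have "(\<lambda>n. 2 * (1 / (real n + 1))) \<longlonglongrightarrow> 0" by real_asymp
    then have "\<forall>\<^sub>F n in sequentially. 2 * (1 / (real n + 1)) < e\<^sup>2 / 2"
      by (rule order_tendstoD) (use \<open>0 < e\<close> in simp)
    then obtain N where N: "\<And>n. n \<ge> N \<Longrightarrow> 2 * (1 / (real n + 1)) < e\<^sup>2 / 2"
      unfolding eventually_sequentially by blast
    have "norm (V m - V n) < e" if "m \<ge> N" "n \<ge> N" for m n
    proof -
      have "(norm (V m - V n))\<^sup>2 < e\<^sup>2" using gap[of m n] N[OF that(1)] N[OF that(2)] by linarith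
      then show ?thesis using \<open>0 < e\<close> by (simp add: power2_less_imp_less)
    qed
    then show "\<exists>N. \<forall>m\<ge>N. \<forall>n\<ge>N. norm (V m - V n) < e" by blast
  qed
  then obtain v where v: "V \<longlonglongrightarrow> v" using Cauchy_convergent convergent_def by blast
  have "(\<lambda>n. \<phi> (V n)) \<longlonglongrightarrow> \<phi> v"
    using cont v continuous_on_tendsto_compose by fastforce
  then have "(\<lambda>n. \<psi> (V n)) \<longlonglongrightarrow> \<psi> v" unfolding \<psi>_def by (intro tendsto_intros v)
  moreover have "(\<lambda>n. I + 1 / (real n + 1)) \<longlonglongrightarrow> I" by real_asymp
  ultimately have "\<psi> v \<le> I" by (rule LIMSEQ_le) (use V in \<open>auto intro: less_imp_le\<close>)
  then have min: "\<psi> v \<le> \<psi> w" for w using I[of w] by simp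
  have "\<phi> v + inner ((u - v) /\<^sub>R l) (w - v) \<le> \<phi> w" for w
  proof -
    have ineq: "2 * inner (u - v) (w - v) \<le> 2 * l * (\<phi> w - \<phi> v) + s * (norm (w - v))\<^sup>2"
      if s: "0 < s" "s \<le> 1" for s
    proof -
      have "v + s *\<^sub>R (w - v) = (1 - s) *\<^sub>R v + s *\<^sub>R w" by (simp add: algebra_simps)
      then have "\<phi> (v + s *\<^sub>R (w - v)) \<le> (1 - s) * \<phi> v + s * \<phi> w"
        using convex_onD[OF convex, of s v w] s by simp
      then have 1: "2 * l * \<phi> (v + s *\<^sub>R (w - v)) \<le> 2 * l * ((1 - s) * \<phi> v + s * \<phi> w)"
        using l by (intro mult_left_mono) auto
      have 2: "(norm (v + s *\<^sub>R (w - v) - u))\<^sup>2 = (norm (v - u))\<^sup>2 - 2 * s * inner (u - v) (w - v) + s\<^sup>2 * (norm (w - v))\<^sup>2"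
      proof -
        have "v + s *\<^sub>R (w - v) - u = s *\<^sub>R (w - v) - (u - v)" by simp
        then have "(norm (v + s *\<^sub>R (w - v) - u))\<^sup>2 = inner (s *\<^sub>R (w - v) - (u - v)) (s *\<^sub>R (w - v) - (u - v))"
          by (simp only: power2_norm_eq_inner)
        also have "\<dots> = inner (u - v) (u - v) - 2 * s * inner (u - v) (w - v) + s\<^sup>2 * inner (w - v) (w - v)"
          by (simp only: inner_diff_left[of "s *\<^sub>R (w - v)"] inner_diff_right[of _ "s *\<^sub>R (w - v)"])
            (simp add: inner_commute[of "w - v" "u - v"] power2_eq_square)
        finally show ?thesis by (simp add: power2_norm_eq_inner[symmetric] norm_minus_commute)
      qed
      have "s * (2 * inner (u - v) (w - v)) \<le> s * (2 * l * (\<phi> w - \<phi> v) + s * (norm (w - v))\<^sup>2)"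
        using min[of "v + s *\<^sub>R (w - v)"] 1 2 unfolding \<psi>_def by (simp add: algebra_simps power2_eq_square)
      then show ?thesis using s by simp
    qed
    have "2 * inner (u - v) (w - v) \<le> 2 * l * (\<phi> w - \<phi> v) + 0 * (norm (w - v))\<^sup>2"
    proof (rule tendsto_lowerbound)
      show "((\<lambda>s. 2 * l * (\<phi> w - \<phi> v) + s * (norm (w - v))\<^sup>2) \<longlongrightarrow> 2 * l * (\<phi> w - \<phi> v) + 0 * (norm (w - v))\<^sup>2) (at_right 0)"
        by (intro tendsto_intros)
      show "\<forall>\<^sub>F s in at_right 0. 2 * inner (u - v) (w - v) \<le> 2 * l * (\<phi> w - \<phi> v) + s * (norm (w - v))\<^sup>2"
        unfolding eventually_at_right_field using ineq by (intro exI[of _ 1]) auto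
    qed simp
    also have "\<dots> = 2 * (l * (\<phi> w - \<phi> v))" by (simp only: mult.assoc mult_zero_left add_0_right)
    finally have "inner (u - v) (w - v) \<le> l * (\<phi> w - \<phi> v)"
      by (simp only: mult_le_cancel_left_pos[OF zero_less_numeral])
    then have "inner (u - v) (w - v) / l \<le> \<phi> w - \<phi> v"
      by (metis pos_divide_le_eq[OF l] mult.commute)
    moreover have "inner ((u - v) /\<^sub>R l) (w - v) = inner (u - v) (w - v) / l"
      by (simp only: inner_scaleR_left divide_inverse mult.commute)
    ultimately show ?thesis by linarith
  qed
  then show ?thesis by (auto simp: subdifferential_def)
qed

lemma m_accretive_subdifferential:
  fixes \<phi> :: "'a::{real_inner, complete_space} \<Rightarrow> real"
  assumes "damping_potential \<phi>"
  shows "m_accretive (subdifferential \<phi>)"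
proof
  show "\<exists>v. (u - v) /\<^sub>R l \<in> subdifferential \<phi> v" if "0 < l" for l u
    using assms that unfolding damping_potential_def by (intro proximal_point_exists) auto
  show "0 \<in> subdifferential \<phi> 0"
    using assms unfolding damping_potential_def by (intro subdifferential_minimizer) auto
qed (rule subdifferential_monotone)

lemma subgradient_norm_bound:
  assumes \<xi>: "\<xi> \<in> subdifferential \<phi> v" and "0 < r" and nonneg: "0 \<le> \<phi> v"
    and B: "\<And>w. norm (w - v) \<le> r \<Longrightarrow> \<phi> w \<le> B"
  shows "norm \<xi> \<le> B / r"
proof -
  have "\<phi> v + inner \<xi> ((v + r *\<^sub>R sgn \<xi>) - v) \<le> \<phi> (v + r *\<^sub>R sgn \<xi>)" by (rule subdifferentialD[OF \<xi>])
  also have "\<dots> \<le> B" using \<open>0 < r\<close> by (intro B) (simp add: norm_sgn)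
  also have "inner \<xi> ((v + r *\<^sub>R sgn \<xi>) - v) = r * norm \<xi>"
    by (cases "\<xi> = 0") (simp_all add: sgn_div_norm power2_norm_eq_inner[symmetric] power2_eq_square)
  finally show ?thesis using \<open>0 < r\<close> nonneg by (simp add: pos_le_divide_eq mult.commute)
qed

text \<open>The definition of \<open>min_subgradient\<close> by choice is meaningful only if a least subgradient exists.
  Since \<open>\<phi>\<close> is bounded above near \<open>u\<close>, subgradients at points near \<open>u\<close> are bounded, and the resolvents
  of \<open>u\<close> stay near \<open>u\<close>; so the Yosida approximations at \<open>u\<close> are bounded and converge to the least
  subgradient.\<close>

lemma min_subgradient_mem:
  fixes \<phi> :: "'a::{real_inner, complete_space} \<Rightarrow> real"
  assumes dp: "damping_potential \<phi>"
  shows "min_subgradient \<phi> u \<in> subdifferential \<phi> u"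
proof -
  interpret m_accretive "subdifferential \<phi>" by (rule m_accretive_subdifferential[OF dp])
  have nonneg: "0 \<le> \<phi> v" and cont: "isCont \<phi> u" for v
    using dp unfolding damping_potential_def by (auto simp: continuous_on_eq_continuous_at)
  obtain r where r: "0 < r" "\<And>w. dist w u < r \<Longrightarrow> dist (\<phi> w) (\<phi> u) < 1"
    using cont[unfolded continuous_at_eps_delta, rule_format, of 1] by auto
  define \<rho> where "\<rho> = r / 3"
  have \<rho>: "0 < \<rho>" using r by (simp add: \<rho>_def)
  have loc: "\<phi> w \<le> \<phi> u + 1" if "norm (w - u) \<le> 2 * \<rho>" for w
    using r(2)[of w] that r(1) by (simp add: dist_norm \<rho>_def)
  have l0: "0 < \<rho>\<^sup>2 / (\<phi> u + 1)" using \<rho> nonneg[of u] by (simp add: add_nonneg_pos)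
  have bd: "norm (yosida l (u - l *\<^sub>R 0)) \<le> (\<phi> u + 1) / \<rho>" if l: "0 < l" "l < \<rho>\<^sup>2 / (\<phi> u + 1)" for l
  proof -
    let ?v = "resolvent l u"
    have "\<phi> ?v + inner (yosida l u) (u - ?v) \<le> \<phi> u" by (rule subdifferentialD[OF yosida_mem[OF l(1)]])
    then have "inner (yosida l u) (u - ?v) \<le> \<phi> u" using nonneg[of ?v] by linarith
    then have "l * inner (yosida l u) (u - ?v) \<le> l * \<phi> u" using l by (intro mult_left_mono) auto
    also have "l * inner (yosida l u) (u - ?v) = (norm (u - ?v))\<^sup>2"
      using l by (simp add: yosida_def power2_norm_eq_inner)
    also have "l * \<phi> u \<le> l * (\<phi> u + 1)" using l by simp
    also have "\<dots> \<le> \<rho>\<^sup>2"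
      using l nonneg[of u] by (simp add: pos_less_divide_eq add_nonneg_pos less_imp_le)
    finally have near: "norm (u - ?v) \<le> \<rho>" by (rule power2_le_imp_le) (use \<rho> in simp)
    have "norm (w - u) \<le> 2 * \<rho>" if "norm (w - ?v) \<le> \<rho>" for w
      using norm_triangle_ineq4[of "w - ?v" "u - ?v"] that near by simp
    then have "norm (yosida l u) \<le> (\<phi> u + 1) / \<rho>"
      using loc by (intro subgradient_norm_bound[OF yosida_mem[OF l(1)] \<rho> nonneg]) auto
    then show ?thesis by simp
  qed
  obtain \<zeta> where "\<zeta> - 0 \<in> subdifferential \<phi> u" "\<And>\<xi>. \<xi> \<in> subdifferential \<phi> u \<Longrightarrow> norm \<zeta> \<le> norm (\<xi> + 0)"
    using minimal_selection_approx[OF l0 bd] by metis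
  then show ?thesis
    unfolding min_subgradient_def
    by (rule_tac arg_minI[where P = "\<lambda>\<xi>. \<xi> \<in> subdifferential \<phi> u" and f = norm and x = \<zeta>])
      (auto simp: not_less)
qed

text \<open>The bound on minimal subgradients bounds \<open>\<phi>\<close> from above on balls, since \<open>\<phi> w \<le> \<langle>\<xi>, w\<rangle>\<close> for a
  subgradient \<open>\<xi>\<close> at \<open>w\<close>. A bound for \<open>\<phi>\<close> on a larger ball in turn bounds all subgradients.\<close>

lemma bounded_m_accretive_subdifferential:
  fixes \<phi> :: "'a::{real_inner, complete_space} \<Rightarrow> real"
  assumes dp: "damping_potential \<phi>"
  shows "bounded_m_accretive (subdifferential \<phi>)"
proof -
  interpret m_accretive "subdifferential \<phi>" by (rule m_accretive_subdifferential[OF dp])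
  have nonneg: "0 \<le> \<phi> v" and \<phi>0: "\<phi> 0 = 0" for v using dp unfolding damping_potential_def by auto
  show ?thesis
  proof
    fix R :: real
    define S where "S = \<bar>R\<bar> + 1"
    have S: "0 < S" by (simp add: S_def)
    then have "bdd_above ((\<lambda>u. norm (min_subgradient \<phi> u)) ` cball 0 S)"
      using dp by (simp add: damping_potential_def)
    then obtain C where "\<forall>y\<in>(\<lambda>u. norm (min_subgradient \<phi> u)) ` cball 0 S. y \<le> C"
      unfolding bdd_above_def by blast
    then have C: "norm (min_subgradient \<phi> u) \<le> C" if "norm u \<le> S" for u using that by auto
    have C0: "0 \<le> C" using C[of 0] S norm_ge_zero[of "min_subgradient \<phi> 0"] by (simp del: norm_ge_zero)
    have up: "\<phi> w \<le> C * S" if "norm w \<le> S" for w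
    proof -
      have "\<phi> w \<le> inner (min_subgradient \<phi> w) w"
        using subdifferentialD[OF min_subgradient_mem[OF dp], of w 0] by (simp add: \<phi>0)
      also have "\<dots> \<le> norm (min_subgradient \<phi> w) * norm w" by (rule norm_cauchy_schwarz)
      also have "\<dots> \<le> C * S" using C[OF that] that C0 by (intro mult_mono) auto
      finally show ?thesis .
    qed
    have "norm \<xi> \<le> C * S / 1" if "u \<in> cball 0 R" "\<xi> \<in> subdifferential \<phi> u" for u \<xi>
    proof (rule subgradient_norm_bound[OF that(2) _ nonneg])
      fix w assume "norm (w - u) \<le> 1"
      then show "\<phi> w \<le> C * S"
        using norm_triangle_sub[of w u] that(1) by (intro up) (auto simp: S_def)
    qed simp
    then show "\<exists>C. \<forall>u\<in>cball 0 R. \<forall>\<xi>\<in>subdifferential \<phi> u. norm \<xi> \<le> C" by blast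
  qed
qed

section \<open>Convex potentials of class C2\<close>

lemma gradient_in_subdifferential:
  fixes f :: "'a::real_inner \<Rightarrow> real"
  assumes convex: "convex_on UNIV f" and grad: "GDERIV f x :> g"
  shows "g \<in> subdifferential f x"
proof -
  have "inner g (y - x) \<le> f y - f x" for y
  proof -
    define k where "k s = f (x + s *\<^sub>R (y - x))" for s :: real
    have "convex_on UNIV k"
    proof (rule convex_onI)
      fix t a b :: real assume t: "0 < t" "t < 1"
      have "x + ((1 - t) *\<^sub>R a + t *\<^sub>R b) *\<^sub>R (y - x)
         = (1 - t) *\<^sub>R (x + a *\<^sub>R (y - x)) + t *\<^sub>R (x + b *\<^sub>R (y - x))" by (simp add: algebra_simps)
      then show "k ((1 - t) *\<^sub>R a + t *\<^sub>R b) \<le> (1 - t) * k a + t * k b"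
        using convex_onD[OF convex, of t "x + a *\<^sub>R (y - x)" "x + b *\<^sub>R (y - x)"] t by (simp add: k_def)
    qed simp
    moreover have "(k has_field_derivative inner g (y - x)) (at 0 within UNIV)"
    proof -
      have 1: "((\<lambda>s. x + s *\<^sub>R (y - x)) has_derivative (\<lambda>s. s *\<^sub>R (y - x))) (at (0::real))"
        by (auto intro!: derivative_eq_intros)
      have "(f has_derivative (\<lambda>h. inner h g)) (at (x + (0::real) *\<^sub>R (y - x)))"
        using grad by (simp add: gderiv_def)
      from has_derivative_compose[OF 1 this] show ?thesis
        unfolding k_def by (intro has_derivative_imp_has_field_derivative) (auto simp: inner_commute)
    qed
    ultimately have "k 1 - k 0 \<ge> inner g (y - x) * (1 - 0)"
      by (intro convex_on_imp_above_tangent[where A = UNIV]) auto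
    then show ?thesis by (simp add: k_def)
  qed
  then show ?thesis by (auto simp: subdifferential_def algebra_simps)
qed

text \<open>The gradient of a convex function is monotone, so \<open>s \<mapsto> \<langle>g (x + s u), u\<rangle>\<close> has a nonnegative derivative
  at \<open>0\<close>.\<close>

lemma hessian_psd:
  fixes f :: "'a::real_inner \<Rightarrow> real"
  assumes convex: "convex_on UNIV f" and C2: "C2_with f g h"
  shows "0 \<le> inner (blinfun_apply (h x) u) u"
proof (rule ccontr)
  define q where "q s = inner (g (x + s *\<^sub>R u)) u" for s :: real
  assume "\<not> 0 \<le> inner (blinfun_apply (h x) u) u"
  moreover have "(q has_real_derivative inner (blinfun_apply (h x) u) u) (at 0)"
  proof -
    have 1: "((\<lambda>s. x + s *\<^sub>R u) has_derivative (\<lambda>s. s *\<^sub>R u)) (at (0::real))"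
      by (auto intro!: derivative_eq_intros)
    have "(g has_derivative blinfun_apply (h x)) (at (x + (0::real) *\<^sub>R u))"
      using C2 by (simp add: C2_with_def)
    from has_derivative_inner_left[OF has_derivative_compose[OF 1 this], of u] show ?thesis
      unfolding q_def by (intro has_derivative_imp_has_field_derivative) (auto simp: blinfun.scaleR_right)
  qed
  ultimately obtain d where d: "d > 0" "\<And>s. 0 < s \<Longrightarrow> s < d \<Longrightarrow> q (0 + s) < q 0"
    using DERIV_neg_dec_right[of q _ 0] by (auto simp: not_le)
  define s where "s = d / 2"
  have s: "0 < s" "s < d" using d by (auto simp: s_def)
  have "0 \<le> inner (g (x + s *\<^sub>R u) - g x) ((x + s *\<^sub>R u) - x)"
    using C2 unfolding C2_with_def
    by (intro subdifferential_monotone[of _ f] gradient_in_subdifferential convex) auto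
  then have "q 0 \<le> q s" using s by (simp add: q_def inner_diff_left zero_le_mult_iff)
  then show False using d(2)[OF s] by simp
qed

lemma damping_force_lipschitz:
  fixes g :: "'a::real_inner \<Rightarrow> 'a" and h :: "'a \<Rightarrow> 'a \<Rightarrow>\<^sub>L 'a"
  assumes "0 \<le> \<beta>" "lipschitz_on_bounded_sets g" "lipschitz_on_bounded_sets h"
  shows "\<exists>L. L-lipschitz_on (cball 0 R) (\<lambda>z. \<beta> *\<^sub>R blinfun_apply (h (fst z)) (snd z) + g (fst z))"
proof -
  define S where "S = max R 0"
  have "bounded (cball (0::'a) S)" by simp
  then obtain Lg Lh where Lg: "Lg-lipschitz_on (cball 0 S) g" and Lh: "Lh-lipschitz_on (cball 0 S) h"
    using assms(2,3) unfolding lipschitz_on_bounded_sets_def by blast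
  have L0: "0 \<le> Lg" "0 \<le> Lh" using Lg Lh lipschitz_on_nonneg by auto
  define H where "H = norm (h 0) + Lh * S"
  have S0: "0 \<le> S" by (simp add: S_def)
  have H: "norm (h x) \<le> H" if "norm x \<le> S" for x
  proof -
    have "norm (h x - h 0) \<le> Lh * norm (x - 0)" using that S0 by (intro lipschitz_on_normD[OF Lh]) auto
    also have "\<dots> \<le> Lh * S" using that L0 by (auto intro: mult_left_mono)
    finally show ?thesis using norm_triangle_sub[of "h x" "h 0"] by (simp add: H_def)
  qed
  have H0: "0 \<le> H" using L0 S0 by (simp add: H_def)
  have "(\<beta> * (H + Lh * S) + Lg)-lipschitz_on (cball 0 R) (\<lambda>z. \<beta> *\<^sub>R blinfun_apply (h (fst z)) (snd z) + g (fst z))"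
  proof (rule lipschitz_onI)
    fix z w :: "'a \<times> 'a" assume "z \<in> cball 0 R" "w \<in> cball 0 R"
    then have "norm z \<le> S" "norm w \<le> S" by (auto simp: S_def)
    obtain x u y v where zw: "z = (x, u)" "w = (y, v)" by (cases z, cases w) auto
    have le: "norm x \<le> S" "norm u \<le> S" "norm y \<le> S" "norm v \<le> S"
      using \<open>norm z \<le> S\<close> \<open>norm w \<le> S\<close> norm_fst_le[of x u] norm_snd_le[of u x] norm_fst_le[of y v] norm_snd_le[of v y]
      unfolding zw by linarith+
    let ?n = "norm (z - w)"
    have d: "norm (x - y) \<le> ?n" "norm (u - v) \<le> ?n"
      unfolding zw using norm_fst_le[of "x - y" "u - v"] norm_snd_le[of "u - v" "x - y"] by auto
    have "blinfun_apply (h x) u - blinfun_apply (h y) v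
       = blinfun_apply (h x) (u - v) + blinfun_apply (h x - h y) v"
      by (simp add: blinfun.diff_right blinfun.diff_left)
    then have "norm (blinfun_apply (h x) u - blinfun_apply (h y) v)
       \<le> norm (h x) * norm (u - v) + norm (h x - h y) * norm v"
      by (metis norm_triangle_mono norm_blinfun)
    also have "\<dots> \<le> H * ?n + (Lh * ?n) * S"
    proof (intro add_mono mult_mono)
      have "norm (h x - h y) \<le> Lh * norm (x - y)" using le by (intro lipschitz_on_normD[OF Lh]) auto
      also have "\<dots> \<le> Lh * ?n" using d L0 by (intro mult_left_mono) auto
      finally show "norm (h x - h y) \<le> Lh * ?n" .
    qed (use H le d H0 L0 in auto)
    finally have 1: "\<beta> * norm (blinfun_apply (h x) u - blinfun_apply (h y) v) \<le> \<beta> * (H * ?n + (Lh * ?n) * S)"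
      using assms(1) by (intro mult_left_mono)
    have "norm (g x - g y) \<le> Lg * norm (x - y)" using le by (intro lipschitz_on_normD[OF Lg]) auto
    also have "\<dots> \<le> Lg * ?n" using d L0 by (intro mult_left_mono) auto
    finally have 2: "norm (g x - g y) \<le> Lg * ?n" .
    have "(\<beta> *\<^sub>R blinfun_apply (h x) u + g x) - (\<beta> *\<^sub>R blinfun_apply (h y) v + g y)
       = \<beta> *\<^sub>R (blinfun_apply (h x) u - blinfun_apply (h y) v) + (g x - g y)" by (simp add: algebra_simps)
    then have "norm ((\<beta> *\<^sub>R blinfun_apply (h x) u + g x) - (\<beta> *\<^sub>R blinfun_apply (h y) v + g y))
       \<le> \<beta> * norm (blinfun_apply (h x) u - blinfun_apply (h y) v) + norm (g x - g y)"
      using norm_triangle_ineq[of "\<beta> *\<^sub>R (blinfun_apply (h x) u - blinfun_apply (h y) v)" "g x - g y"] assms(1)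
      by (simp only: norm_scaleR abs_of_nonneg)
    also have "\<dots> \<le> \<beta> * (H * ?n + (Lh * ?n) * S) + Lg * ?n" using 1 2 by (rule add_mono)
    also have "\<dots> = (\<beta> * (H + Lh * S) + Lg) * ?n" by (simp add: algebra_simps)
    finally show "dist (\<beta> *\<^sub>R blinfun_apply (h (fst z)) (snd z) + g (fst z))
        (\<beta> *\<^sub>R blinfun_apply (h (fst w)) (snd w) + g (fst w)) \<le> (\<beta> * (H + Lh * S) + Lg) * dist z w"
      by (simp add: dist_norm zw)
  qed (use assms(1) L0 S0 H0 in auto)
  then show ?thesis by blast
qed

section \<open>Strong global solutions\<close>

lemma velocity_eq:
  assumes "(x has_vector_derivative v) (at t within {0..})" "0 \<le> t"
  shows "velocity x t = v"
proof -
  have "t islimpt {t<..t + 1}" by (simp add: islimpt_Ioc)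
  then have "t islimpt {0..}" by (rule islimpt_subset) (use assms(2) in auto)
  then show ?thesis
    unfolding velocity_def using assms(1)
    by (intro vector_derivative_within) (simp_all only: trivial_limit_within not_not)
qed

lemma strong_global_solution_of_trajectory:
  fixes h :: "'a::real_inner \<Rightarrow> 'a \<Rightarrow>\<^sub>L 'a"
  assumes tr: "trajectory (subdifferential \<phi>) (\<lambda>z. \<beta> *\<^sub>R blinfun_apply (h (fst z)) (snd z) + g (fst z)) x u N"
  shows "strong_global_solution \<phi> \<beta> g h x" "0 \<le> t \<Longrightarrow> velocity x t = u t"
proof -
  have x': "(x has_vector_derivative u t) (at t within {0..})" if "0 \<le> t" for t
    using tr that unfolding trajectory_def by blast
  have lip: "\<exists>L. L-lipschitz_on {0..T} u" for T using tr unfolding trajectory_def by blast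
  have N: "negligible N" using tr unfolding trajectory_def by blast
  show vel: "velocity x t = u t" if "0 \<le> t" for t using velocity_eq[OF x'] that by blast
  have cont: "continuous_on {0..} u"
    unfolding continuous_on_eq_continuous_within
  proof
    fix t :: real assume t: "t \<in> {0..}"
    obtain L where "L-lipschitz_on {0..t + 1} u" using lip by blast
    then have "continuous (at t within {0..t + 1}) u"
      using t by (intro lipschitz_on_continuous_within) auto
    moreover have "at t within {0..t + 1} = at t within {0..}"
      by (rule at_within_nhd[of _ "{..<t + 1}"]) auto
    ultimately show "continuous (at t within {0..}) u" by simp
  qed
  have acc: "\<exists>\<xi>\<in>subdifferential \<phi> (velocity x t). acceleration x t =
        - \<xi> - (\<beta> *\<^sub>R blinfun_apply (h (x t)) (velocity x t) + g (x t)) \<and>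
      (velocity x has_vector_derivative acceleration x t) (at t)" if t: "0 < t" "t \<notin> N" for t
  proof -
    obtain \<xi> where \<xi>: "\<xi> \<in> subdifferential \<phi> (u t)"
      "(u has_vector_derivative (- \<xi> - (\<beta> *\<^sub>R blinfun_apply (h (x t)) (u t) + g (x t)))) (at t)"
      using tr t unfolding trajectory_def by auto
    have "(velocity x has_vector_derivative (- \<xi> - (\<beta> *\<^sub>R blinfun_apply (h (x t)) (u t) + g (x t)))) (at t)"
      by (rule has_vector_derivative_transform_within_open[OF \<xi>(2), of "{0<..}"]) (use t vel in auto)
    then show ?thesis
      using \<xi>(1) vel[of t] t by (auto simp: acceleration_def vector_derivative_at)
  qed
  have S: "{0<..<T} \<in> sets lebesgue" "{0::real<..} \<in> sets lebesgue" for T :: real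
    by auto
  show "strong_global_solution \<phi> \<beta> g h x"
    unfolding strong_global_solution_def
  proof (intro conjI allI impI)
    show "x differentiable_on {0..}"
      using x' unfolding differentiable_on_def by (auto intro: differentiableI_vector)
    show "continuous_on {0..} (velocity x)"
      using cont by (rule continuous_on_cong[THEN iffD1, rotated -1]) (auto simp: vel)
    fix T :: real assume "0 < T"
    obtain L where L: "L-lipschitz_on {0..T + 1} u" using lip by blast
    have "L-lipschitz_on {0<..<T} (velocity x)"
      by (rule lipschitz_on_transform[OF lipschitz_on_subset[OF L]]) (auto simp: vel)
    then show "\<exists>L. L-lipschitz_on {0<..<T} (velocity x)" by blast
    show "AE t in lebesgue_on {0<..<T}. velocity x differentiable at t"
      unfolding AE_lebesgue_on_iff_negligible[OF S(1)]
    proof (intro exI conjI ballI)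
      show "velocity x differentiable at t" if "t \<in> {0<..<T} - N" for t
        using acc[of t] that by (auto intro: differentiableI_vector)
    qed (rule N)
    have "(u has_vector_derivative acceleration x t) (at t)" if "t \<in> {0<..<T} - N" for t
    proof (rule has_vector_derivative_transform_within_open)
      show "(velocity x has_vector_derivative acceleration x t) (at t)" using acc that by auto
    qed (use that vel in \<open>auto intro: open_greaterThan[of 0]\<close>)
    then show "in_Linfty (lebesgue_on {0<..<T}) (acceleration x)"
      by (rule derivative_of_lipschitz_in_Linfty[OF \<open>0 < T\<close> L N])
  next
    have "0 \<in> {acceleration x t + \<xi> + \<beta> *\<^sub>R blinfun_apply (h (x t)) (velocity x t) + g (x t) | \<xi>.
        \<xi> \<in> subdifferential \<phi> (velocity x t)}" if t: "t \<in> {0<..} - N" for t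
    proof -
      obtain \<xi> where "\<xi> \<in> subdifferential \<phi> (velocity x t)" "acceleration x t =
        - \<xi> - (\<beta> *\<^sub>R blinfun_apply (h (x t)) (velocity x t) + g (x t))" using acc[of t] t by auto
      then show ?thesis by (intro CollectI exI[of _ \<xi>]) simp
    qed
    then show "AE t in lebesgue_on {0<..}. 0 \<in> {acceleration x t + \<xi> + \<beta> *\<^sub>R blinfun_apply (h (x t)) (velocity x t) + g (x t) | \<xi>.
        \<xi> \<in> subdifferential \<phi> (velocity x t)}"
      unfolding AE_lebesgue_on_iff_negligible[OF S(2)] using N by blast
  qed
qed

lemma trajectory_of_strong_global_solution:
  fixes h :: "'a::real_inner \<Rightarrow> 'a \<Rightarrow>\<^sub>L 'a"
  assumes sol: "strong_global_solution \<phi> \<beta> g h x"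
  obtains N where "trajectory (subdifferential \<phi>)
    (\<lambda>z. \<beta> *\<^sub>R blinfun_apply (h (fst z)) (snd z) + g (fst z)) x (velocity x) N"
proof -
  have S: "{0<..<T} \<in> sets lebesgue" "{0::real<..} \<in> sets lebesgue" for T :: real
    by auto
  have diff: "x differentiable_on {0..}" and cont: "continuous_on {0..} (velocity x)"
    and lip: "\<And>T. 0 < T \<Longrightarrow> \<exists>L. L-lipschitz_on {0<..<T} (velocity x)"
    and ae: "\<And>T. 0 < T \<Longrightarrow> AE t in lebesgue_on {0<..<T}. velocity x differentiable (at t)"
    and incl: "AE t in lebesgue_on {0<..}. 0 \<in> {acceleration x t + \<xi> + \<beta> *\<^sub>R blinfun_apply (h (x t)) (velocity x t) + g (x t) | \<xi>.
        \<xi> \<in> subdifferential \<phi> (velocity x t)}"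
    using sol unfolding strong_global_solution_def by simp_all
  have x': "(x has_vector_derivative velocity x t) (at t within {0..})" if "0 \<le> t" for t
    unfolding velocity_def using diff that
    by (simp add: differentiable_on_def vector_derivative_works[symmetric])
  have lip': "\<exists>L. L-lipschitz_on {0..T} (velocity x)" for T
  proof -
    have "0 < max T 1" by simp
    from lip[OF this] obtain L where L: "L-lipschitz_on {0<..<max T 1} (velocity x)" by blast
    have "L-lipschitz_on (closure {0<..<max T 1}) (velocity x)"
      using L by (rule lipschitz_on_closure) (use cont in \<open>auto intro: continuous_on_subset\<close>)
    then have "L-lipschitz_on {0..T} (velocity x)"
      by (rule lipschitz_on_subset) auto
    then show ?thesis by blast
  qed
  have "\<exists>N. negligible N \<and> (\<forall>t\<in>{0<..<real n + 1} - N. velocity x differentiable (at t))" for n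
    using ae[of "real n + 1"] unfolding AE_lebesgue_on_iff_negligible[OF S(1)] by simp
  then obtain N where N: "\<And>n. negligible (N n)"
    "\<And>n t. t \<in> {0<..<real n + 1} - N n \<Longrightarrow> velocity x differentiable (at t)" by metis
  obtain M where M: "negligible M" and "\<forall>t\<in>{0<..} - M.
    0 \<in> {acceleration x t + \<xi> + \<beta> *\<^sub>R blinfun_apply (h (x t)) (velocity x t) + g (x t) | \<xi>.
        \<xi> \<in> subdifferential \<phi> (velocity x t)}"
    using incl[unfolded AE_lebesgue_on_iff_negligible[OF S(2)]] by (elim exE conjE) (rule that)
  then have incl': "\<exists>\<xi>\<in>subdifferential \<phi> (velocity x t).
      0 = acceleration x t + \<xi> + \<beta> *\<^sub>R blinfun_apply (h (x t)) (velocity x t) + g (x t)"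
    if "t \<in> {0<..} - M" for t using that by fast
  let ?N = "(\<Union>n. N n) \<union> M"
  have "\<exists>\<xi>\<in>subdifferential \<phi> (velocity x t). (velocity x has_vector_derivative
      (- \<xi> - (\<beta> *\<^sub>R blinfun_apply (h (x t)) (velocity x t) + g (x t)))) (at t)"
    if t: "0 < t" "t \<notin> ?N" for t
  proof -
    obtain n where "t < real n" using reals_Archimedean2 by blast
    then have "velocity x differentiable (at t)" using N(2)[of t n] t by auto
    then have der: "(velocity x has_vector_derivative acceleration x t) (at t)"
      unfolding acceleration_def by (simp add: vector_derivative_works)
    obtain \<xi> where \<xi>: "\<xi> \<in> subdifferential \<phi> (velocity x t)"
      "0 = acceleration x t + \<xi> + \<beta> *\<^sub>R blinfun_apply (h (x t)) (velocity x t) + g (x t)"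
      using incl'[of t] t by auto
    have "acceleration x t = - \<xi> - (\<beta> *\<^sub>R blinfun_apply (h (x t)) (velocity x t) + g (x t))
        + (acceleration x t + \<xi> + \<beta> *\<^sub>R blinfun_apply (h (x t)) (velocity x t) + g (x t))"
      by (simp add: algebra_simps)
    then have "acceleration x t = - \<xi> - (\<beta> *\<^sub>R blinfun_apply (h (x t)) (velocity x t) + g (x t))"
      using \<xi>(2) by simp
    then show ?thesis using der \<xi>(1) by metis
  qed
  moreover have "negligible ?N" using N(1) M by (intro negligible_Un negligible_Union_nat)
  ultimately have "trajectory (subdifferential \<phi>)
    (\<lambda>z. \<beta> *\<^sub>R blinfun_apply (h (fst z)) (snd z) + g (fst z)) x (velocity x) ?N"
    unfolding trajectory_def using x' lip' by auto
  then show thesis by (rule that)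
qed

theorem theorem9p1:
  fixes f \<phi> :: "'a::{real_inner, complete_space} \<Rightarrow> real"
    and gradf :: "'a \<Rightarrow> 'a" and hessf :: "'a \<Rightarrow> 'a \<Rightarrow>\<^sub>L 'a"
    and \<beta> :: real and x0 x1 :: 'a
  assumes "\<beta> \<ge> 0"
    and "convex_on UNIV f"
    and "C2_with f gradf hessf"
    and "bdd_below (range f)"
    and "lipschitz_on_bounded_sets gradf"
    and "lipschitz_on_bounded_sets hessf"
    and "damping_potential \<phi>"
  shows "\<exists>x. strong_global_solution \<phi> \<beta> gradf hessf x \<and> x 0 = x0 \<and> velocity x 0 = x1 \<and>
           (\<forall>y. strong_global_solution \<phi> \<beta> gradf hessf y \<and> y 0 = x0 \<and> velocity y 0 = x1
                \<longrightarrow> (\<forall>t\<ge>0. y t = x t))"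
proof -
  define F where "F = (\<lambda>z. \<beta> *\<^sub>R blinfun_apply (hessf (fst z)) (snd z) + gradf (fst z))"
  interpret bounded_m_accretive "subdifferential \<phi>"
    by (rule bounded_m_accretive_subdifferential) fact
  interpret damped_system "subdifferential \<phi>" F f gradf "Inf (range f)"
  proof
    show "\<exists>L. L-lipschitz_on (cball 0 R) F" for R
      unfolding F_def by (rule damping_force_lipschitz) fact+
    show "GDERIV f x :> gradf x" for x using assms(3) by (simp add: C2_with_def)
    show "Inf (range f) \<le> f x" for x using assms(4) by (intro cInf_lower) auto
    show "inner (gradf x) u \<le> inner (F (x, u)) u" for x u
      using hessian_psd[OF assms(2,3), of x u] assms(1) by (simp add: F_def inner_add_left)
  qed
  obtain x u N where x: "x 0 = x0" "u 0 = x1" "trajectory (subdifferential \<phi>) F x u N"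
    using trajectory_exists by blast
  have sol: "strong_global_solution \<phi> \<beta> gradf hessf x" and vel: "velocity x 0 = x1"
    using strong_global_solution_of_trajectory[OF x(3)[unfolded F_def]] x(2) by auto
  have "y t = x t"
    if y: "strong_global_solution \<phi> \<beta> gradf hessf y" "y 0 = x0" "velocity y 0 = x1" and "0 \<le> t" for y t
  proof -
    obtain M where M: "trajectory (subdifferential \<phi>) F y (velocity y) M"
      unfolding F_def using trajectory_of_strong_global_solution[OF y(1)] by blast
    show ?thesis
      by (rule trajectory_unique[OF M x(3)]) (use x y \<open>0 \<le> t\<close> in simp_all)
  qed
  with sol vel x(1) show ?thesis by blast
qed

end
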